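(* $u\in C^1((0,\infty))$.
   Context: $B^1,B^2$ are independent Brownian motions on $(\Omega,\mathcal F,\mathsf P)$, $\mathbb F$ their completed natural filtration, $\mathcal T$ the set of $\mathbb F$-stopping times with values in $[0,\infty]$. Constants: $\mu_1,\mu_2\in\mathbb R$, $\sigma_1,\sigma_2>0$, $\nu\in[-1,1]$, $p\in(0,1)$, $r>0$ with $r>\mu_i+\sigma_i^2/2$ for $i=1,2$. $F$ is the cumulative distribution function of a non-negative random variable (integrals against $F(\mathrm dt)$ include a possible atom at $0$). Let $\beta_1=\sigma_2\nu-\sigma_1$, $\beta_2=\sigma_2\sqrt{1-\nu^2}$, assume $\beta_1^2+\beta_2^2>0$, let $\tilde B=(\beta_1B^1+\beta_2B^2)/\sqrt{\beta_1^2+\beta_2^2}$ and let $Z$ solve $\mathrm dZ_t=(\mu_2-\mu_1)Z_t\,\mathrm dt+\sqrt{\beta_1^2+\beta_2^2}\,Z_t\,\mathrm d\tilde B_t$, with $Z_0=z>0$ under $\mathsf P_z$. $\mathcal A_1^+$ is the set of continuous $g:(0,\infty)\to[0,\infty)$ with $\|g\|^2_{\mathcal A_1^+}=\sup_{z>0}|g(z)|^2/(1+z^2)<\infty$. For $g\in\mathcal A_1^+$, $(\Pi g)(z)=\int_0^\infty e^{-(r-\mu_1)t}\mathsf E_z[p(1+Z_t)+(1-p)g(Z_t)]F(\mathrm dt)$. $u$ denotes the unique function in $\mathcal A_1^+$ (it exists) with $$u(z)=\sup_{\tau\in\mathcal T}\mathsf E_z[e^{-(r-\mu_1)\tau}\max\{1,(\Pi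 u)(Z_\tau)\}],\qquad z>0,$$ where payoffs are $0$ on $\{\tau=\infty\}$ (coinciding with the $\limsup$ as $t\to\infty$ of the discounted payoff). *)

theory Defs
  imports "HOL-Probability.Probability"
begin

definition brownian_motion :: "'a measure \<Rightarrow> (real \<Rightarrow> 'a \<Rightarrow> real) \<Rightarrow> bool" where
  "brownian_motion M B \<longleftrightarrow>
     (\<forall>t\<ge>0. B t \<in> borel_measurable M) \<and>
     (AE \<omega> in M. B 0 \<omega> = 0) \<and>
     (AE \<omega> in M. continuous_on {0..} (\<lambda>t. B t \<omega>)) \<and>
     (\<forall>s t. 0 \<le> s \<and> s < t \<longrightarrow>
        distributed M lborel (\<lambda>\<omega>. B t \<omega> - B s \<omega>) (normal_density 0 (sqrt (t - s)))) \<and>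
     (\<forall>n (tp :: nat \<Rightarrow> real). 0 \<le> tp 0 \<and> strict_mono_on {..n} tp \<longrightarrow>
        prob_space.indep_vars M (\<lambda>_. borel) (\<lambda>i \<omega>. B (tp (Suc i)) \<omega> - B (tp i) \<omega>) {..<n})"

definition indep_processes ::
  "'a measure \<Rightarrow> (real \<Rightarrow> 'a \<Rightarrow> real) \<Rightarrow> (real \<Rightarrow> 'a \<Rightarrow> real) \<Rightarrow> bool" where
  "indep_processes M X Y \<longleftrightarrow>
     prob_space.indep_var M
       (PiM {0..} (\<lambda>_. borel)) (\<lambda>\<omega>. \<lambda>t\<in>{0..}. X t \<omega>)
       (PiM {0..} (\<lambda>_. borel)) (\<lambda>\<omega>. \<lambda>t\<in>{0..}. Y t \<omega>)"

(* The time index ranges over [0, \<infinity>] (type ennreal), so that the library's stopping_time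
   yields stopping times with values in [0, \<infinity>]. M itself need not be complete; the
   \<sigma>-algebras below are sub-\<sigma>-algebras of completion M. *)
definition completed_natural_filtration ::
  "'a measure \<Rightarrow> (real \<Rightarrow> 'a \<Rightarrow> real) \<Rightarrow> (real \<Rightarrow> 'a \<Rightarrow> real) \<Rightarrow> ennreal \<Rightarrow> 'a measure" where
  "completed_natural_filtration M B1 B2 t =
     sigma (space M)
       ({B1 s -` A \<inter> space M | s A. 0 \<le> s \<and> ennreal s \<le> t \<and> A \<in> sets borel} \<union>
        {B2 s -` A \<inter> space M | s A. 0 \<le> s \<and> ennreal s \<le> t \<and> A \<in> sets borel} \<union>
        null_sets (completion M))"

definition converges_in_prob ::
  "'a measure \<Rightarrow> (nat \<Rightarrow> 'a \<Rightarrow> real) \<Rightarrow> ('a \<Rightarrow> real) \<Rightarrow> bool" where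
  "converges_in_prob P X Y \<longleftrightarrow>
     (\<forall>n. X n \<in> borel_measurable P) \<and> Y \<in> borel_measurable P \<and>
     (\<forall>\<epsilon>>0. (\<lambda>n. measure P {\<omega> \<in> space P. \<bar>X n \<omega> - Y \<omega>\<bar> > \<epsilon>}) \<longlonglongrightarrow> 0)"

(* (n, tp, \<xi>) encodes the simple integrand  sum_{i<n} \<xi>_i 1_(tp_i, tp_{i+1}]  on (0, t]. *)
definition simple_integrand ::
  "'a measure \<Rightarrow> (ennreal \<Rightarrow> 'a measure) \<Rightarrow> real
     \<Rightarrow> nat \<Rightarrow> (nat \<Rightarrow> real) \<Rightarrow> (nat \<Rightarrow> 'a \<Rightarrow> real) \<Rightarrow> bool" where
  "simple_integrand P FF t n tp \<xi> \<longleftrightarrow>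
     tp 0 = 0 \<and> tp n = t \<and> strict_mono_on {..n} tp \<and>
     (\<forall>i<n. \<xi> i \<in> borel_measurable (FF (ennreal (tp i))) \<and>
            (\<exists>C. \<forall>\<omega>\<in>space P. \<bar>\<xi> i \<omega>\<bar> \<le> C))"

definition simple_process ::
  "nat \<Rightarrow> (nat \<Rightarrow> real) \<Rightarrow> (nat \<Rightarrow> 'a \<Rightarrow> real) \<Rightarrow> real \<Rightarrow> 'a \<Rightarrow> real" where
  "simple_process n tp \<xi> s \<omega> = (\<Sum>i<n. \<xi> i \<omega> * indicator {tp i<..tp (Suc i)} s)"

definition simple_ito_integral ::
  "(real \<Rightarrow> 'a \<Rightarrow> real) \<Rightarrow> nat \<Rightarrow> (nat \<Rightarrow> real) \<Rightarrow> (nat \<Rightarrow> 'a \<Rightarrow> real) \<Rightarrow> 'a \<Rightarrow> real" where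
  "simple_ito_integral W n tp \<xi> \<omega> = (\<Sum>i<n. \<xi> i \<omega> * (W (tp (Suc i)) \<omega> - W (tp i) \<omega>))"

(* J is a version of the Ito integral of H over [0, t] with respect to W, for integrands that
   are almost surely square integrable on [0, t] (hence the limits in probability rather
   than in mean square). *)
definition is_ito_integral ::
  "'a measure \<Rightarrow> (ennreal \<Rightarrow> 'a measure) \<Rightarrow> (real \<Rightarrow> 'a \<Rightarrow> real)
     \<Rightarrow> (real \<Rightarrow> 'a \<Rightarrow> real) \<Rightarrow> real \<Rightarrow> ('a \<Rightarrow> real) \<Rightarrow> bool" where
  "is_ito_integral P FF W H t J \<longleftrightarrow>
     (\<forall>s\<in>{0..t}. H s \<in> borel_measurable (FF (ennreal s))) \<and>
     (AE \<omega> in P. set_borel_measurable lborel {0..t} (\<lambda>s. H s \<omega>) \<and>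
                  set_integrable lborel {0..t} (\<lambda>s. (H s \<omega>)\<^sup>2)) \<and>
     (\<exists>n tp \<xi>.
        (\<forall>k. simple_integrand P FF t (n k) (tp k) (\<xi> k)) \<and>
        converges_in_prob P
          (\<lambda>k \<omega>. LBINT s:{0..t}. (simple_process (n k) (tp k) (\<xi> k) s \<omega> - H s \<omega>)\<^sup>2) (\<lambda>_. 0) \<and>
        converges_in_prob P (\<lambda>k. simple_ito_integral W (n k) (tp k) (\<xi> k)) J)"

(* X is a (strong) solution of  dX_t = b(X_t) dt + a(X_t) dW_t,  X_0 = x. *)
definition sde_solution ::
  "'a measure \<Rightarrow> (ennreal \<Rightarrow> 'a measure) \<Rightarrow> (real \<Rightarrow> 'a \<Rightarrow> real)
     \<Rightarrow> (real \<Rightarrow> real) \<Rightarrow> (real \<Rightarrow> real) \<Rightarrow> real \<Rightarrow> (real \<Rightarrow> 'a \<Rightarrow> real) \<Rightarrow> bool" where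
  "sde_solution P FF W b a x X \<longleftrightarrow>
     (\<forall>t\<ge>0. X t \<in> borel_measurable (FF (ennreal t))) \<and>
     (AE \<omega> in P. continuous_on {0..} (\<lambda>t. X t \<omega>)) \<and>
     (AE \<omega> in P. X 0 \<omega> = x) \<and>
     (\<forall>t\<ge>0. \<exists>J. is_ito_integral P FF W (\<lambda>s \<omega>. a (X s \<omega>)) t J \<and>
        (AE \<omega> in P. set_integrable lborel {0..t} (\<lambda>s. b (X s \<omega>)) \<and>
                     X t \<omega> = x + (LBINT s:{0..t}. b (X s \<omega>)) + J \<omega>))"

definition cdf_of_nonneg_rv :: "(real \<Rightarrow> real) \<Rightarrow> bool" where
  "cdf_of_nonneg_rv F \<longleftrightarrow>
     (\<exists>D. real_distribution D \<and> (AE x in D. 0 \<le> x) \<and> F = cdf D)"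

(* The class A_1^+; only the values of g on (0, \<infinity>) matter. *)
definition A1plus :: "(real \<Rightarrow> real) set" where
  "A1plus = {g. continuous_on {0<..} g \<and> (\<forall>z>0. 0 \<le> g z) \<and>
               bdd_above ((\<lambda>z. \<bar>g z\<bar>\<^sup>2 / (1 + z\<^sup>2)) ` {0<..})}"

(* Below, \<rho> is the discount rate, and Z z is the process started at z, so that the
   expectation E_z[f(Z_t)] is the integral of f (Z z t) over P. *)
definition Pi_operator ::
  "'a measure \<Rightarrow> (real \<Rightarrow> real \<Rightarrow> 'a \<Rightarrow> real) \<Rightarrow> (real \<Rightarrow> real) \<Rightarrow> real \<Rightarrow> real
     \<Rightarrow> (real \<Rightarrow> real) \<Rightarrow> real \<Rightarrow> real" where
  "Pi_operator P Z F \<rho> p g z =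
     (LINT t:{0..}|interval_measure F.
        exp (- \<rho> * t) * (LINT \<omega>|P. p * (1 + Z z t \<omega>) + (1 - p) * g (Z z t \<omega>)))"

(* Discounted payoffs are non-negative, so their expectations and the supremum over
   stopping times are taken in [0, \<infinity>]. *)
definition stopping_value ::
  "'a measure \<Rightarrow> (ennreal \<Rightarrow> 'a measure) \<Rightarrow> (real \<Rightarrow> real \<Rightarrow> 'a \<Rightarrow> real) \<Rightarrow> real
     \<Rightarrow> (real \<Rightarrow> real) \<Rightarrow> real \<Rightarrow> ennreal" where
  "stopping_value P FF Z \<rho> G z =
     (SUP \<tau>\<in>{\<tau>. stopping_time FF \<tau>}.
        \<integral>\<^sup>+ \<omega>. (if \<tau> \<omega> = \<infinity> then 0
              else ennreal (exp (- \<rho> * enn2real (\<tau> \<omega>)) * G (Z z (enn2real (\<tau> \<omega>)) \<omega>))) \<partial>P)"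

end

(* The paper's process started at z is the geometric Brownian motion z * exp (...): the Euler
   scheme of the linear equation converges in probability to any solution (discrete Gronwall
   inequality), and to the exponential by a second-moment computation.

   Restricting the exercise times to a grid gives values H that are suprema of Bellman iterates,
   and H tends to the continuous-time value as the grid is refined. Since z enters the dynamics
   linearly, the semigroup and the Bellman iterates preserve convexity. The operator Pi
   involves u itself, so this is used in an approximate form: if u is convex up to an error
   c (1 + z), then Pi u, hence the payoff max 1 (Pi u), hence u, is convex up to the error
   (1 - p) c (1 + z). A function of linear growth satisfies this for some c, and iterating
   shows that u is convex.

   A convex function is continuously differentiable where it has a unique subgradient. If u had
   two subgradients a < b at z, then the expectation of u at a small time t would exceed u(z) by
   at least a multiple of (b - a) sqrt t, up to an error O(t); this contradicts the fact that u
   is superharmonic for the discounted process. *)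

theory Submission
  imports Defs
begin

section \<open>Gaussian integrals and Brownian filtrations\<close>

text \<open>The hypotheses describe \<open>Z\<close> only through Ito integrals that are limits in
  probability, with a separate approximating sequence for each time and no moment bound on
  \<open>Z\<close>. Second-moment estimates therefore act on truncated integrands.

  The convexity error is weighted by \<open>1 + z\<close> because this function is superharmonic for
  the discounted process: \<open>0 \<le> r - \<mu>1\<close> and
  \<open>\<mu>2 - \<mu>1 \<le> r - \<mu>1\<close>. The semigroup and the maximum thus leave the
  constant \<open>c\<close> alone, and the factor \<open>1 - p\<close>, the weight of
  \<open>u\<close> inside the payoff operator, is the only source of contraction.

  The grids are dyadic, hence nested: the step \<open>1 / 2 ^ j\<close> is a multiple of every finer
  step, so superharmonicity at that step survives the refinement. These times tend to
  \<open>0\<close>, and the argument against kinks runs along them. The limit rests on two bounds,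
  that \<open>u\<close> dominates the values \<open>H\<close> and is dominated by their liminf, with
  Fatou's lemma in place of uniform integrability; this is why values live in
  \<open>ennreal\<close>.\<close>

abbreviation gauss :: "real measure" where
  "gauss \<equiv> density lborel (\<lambda>y. ennreal (std_normal_density y))"

section \<open>Moments of the standard Gaussian\<close>

lemma prob_space_gauss: "prob_space gauss"
  by (rule prob_space_normal_density) simp

lemma has_bochner_integral_gauss:
  fixes f :: "real \<Rightarrow> real"
  assumes "f \<in> borel_measurable borel"
  shows "has_bochner_integral gauss f I \<longleftrightarrow>
         has_bochner_integral lborel (\<lambda>y. std_normal_density y * f y) I"
  using assms by (simp add: has_bochner_integral_iff integrable_density integral_density)

text \<open>Completing the square in the exponent absorbs \<open>exp (a * y)\<close> into a
  translation of the Gaussian by \<open>a\<close>, up to the factor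
  \<open>exp (a\<^sup>2 / 2)\<close>: the one-dimensional Cameron-Martin formula. The exponential
  moments below are the cases of a constant and of an affine \<open>f\<close>.\<close>

lemma has_bochner_integral_gauss_shift:
  fixes f :: "real \<Rightarrow> real"
  assumes [measurable]: "f \<in> borel_measurable borel"
    and f: "has_bochner_integral gauss (\<lambda>y. f (y + a)) I"
  shows "has_bochner_integral gauss (\<lambda>y. f y * exp (a * y)) (exp (a\<^sup>2 / 2) * I)"
proof -
  have *: "std_normal_density (y - a) * exp (a\<^sup>2 / 2) = std_normal_density y * exp (a * y)" for y
    by (simp add: std_normal_density_def flip: exp_add) (simp add: power2_eq_square field_simps)
  have **: "std_normal_density y * (f y * exp (a * y)) = std_normal_density (y - a) * f y * exp (a\<^sup>2 / 2)" for y
    using *[of y] by (simp add: mult_ac)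
  have "has_bochner_integral lborel (\<lambda>y. std_normal_density y * f (y + a)) I"
    using f by (simp add: has_bochner_integral_gauss)
  from lborel_has_bochner_integral_real_affine_iff[THEN iffD1, OF _ this, of 1 "-a"]
  have "has_bochner_integral lborel (\<lambda>y. std_normal_density (y - a) * f y) I"
    by simp
  from has_bochner_integral_mult_left[OF this, of "exp (a\<^sup>2 / 2)"]
  have "has_bochner_integral lborel (\<lambda>y. std_normal_density y * (f y * exp (a * y))) (exp (a\<^sup>2 / 2) * I)"
    unfolding ** by (simp only: mult.commute[of I])
  then show ?thesis by (simp add: has_bochner_integral_gauss)
qed

lemma has_bochner_integral_gauss_const: "has_bochner_integral gauss (\<lambda>_. c) (c::real)"
proof -
  interpret prob_space gauss by (rule prob_space_gauss)
  show ?thesis using prob_space by (simp add: has_bochner_integral_iff)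
qed

lemma has_bochner_integral_gauss_id: "has_bochner_integral gauss (\<lambda>y. y) 0"
  using std_normal_moment_odd[of 0] by (simp add: has_bochner_integral_gauss)

lemma has_bochner_integral_gauss_square: "has_bochner_integral gauss (\<lambda>y. y\<^sup>2) 1"
  using std_normal_moment_even[of 1] by (simp add: has_bochner_integral_gauss)

lemma has_bochner_integral_gauss_exp:
  "has_bochner_integral gauss (\<lambda>y. exp (a * y)) (exp (a\<^sup>2 / 2))"
  using has_bochner_integral_gauss_shift[OF _ has_bochner_integral_gauss_const, of 1 a] by simp

lemma has_bochner_integral_gauss_affine_exp:
  "has_bochner_integral gauss (\<lambda>y. (b + c * y) * exp (a * y)) (exp (a\<^sup>2 / 2) * (b + c * a))"
proof (rule has_bochner_integral_gauss_shift)
  have "has_bochner_integral gauss (\<lambda>y. (b + c * a) + c * y) ((b + c * a) + c * 0)"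
    by (intro has_bochner_integral_add has_bochner_integral_gauss_const
        has_bochner_integral_mult_right has_bochner_integral_gauss_id)
  then show "has_bochner_integral gauss (\<lambda>y. b + c * (y + a)) (b + c * a)"
    by (simp add: algebra_simps)
qed simp

lemma nn_integral_gauss_exp: "(\<integral>\<^sup>+y. ennreal (exp (a * y)) \<partial>gauss) = ennreal (exp (a\<^sup>2 / 2))"
  using has_bochner_integral_gauss_exp[of a]
  by (subst nn_integral_eq_integral) (auto simp: has_bochner_integral_iff)

text \<open>Independence of an increment from the past is stated on events, with the law of the
  increment written as the image of the standard Gaussian under multiplication by
  \<open>sqrt (t - s)\<close>. This form involves no density and so covers \<open>s = t\<close>,
  where the image is the point mass at \<open>0\<close>.\<close>

locale filtered_bm = prob_space N for N :: "'a measure" +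
  fixes F :: "real \<Rightarrow> 'a measure" and W :: "real \<Rightarrow> 'a \<Rightarrow> real"
  assumes complete: "complete_measure N"
    and subalg: "\<And>t. 0 \<le> t \<Longrightarrow> subalgebra N (F t)"
    and F_mono: "\<And>s t. 0 \<le> s \<Longrightarrow> s \<le> t \<Longrightarrow> sets (F s) \<subseteq> sets (F t)"
    and null_F: "\<And>A t. 0 \<le> t \<Longrightarrow> A \<in> null_sets N \<Longrightarrow> A \<in> sets (F t)"
    and W_adapted: "\<And>t. 0 \<le> t \<Longrightarrow> W t \<in> borel_measurable (F t)"
    and W_0: "AE \<omega> in N. W 0 \<omega> = 0"
    and W_cont: "AE \<omega> in N. continuous_on {0..} (\<lambda>t. W t \<omega>)"
    and W_indep: "\<And>s t A C. 0 \<le> s \<Longrightarrow> s \<le> t \<Longrightarrow> A \<in> sets (F s) \<Longrightarrow> C \<in> sets borel \<Longrightarrow>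
        prob (A \<inter> {\<omega>\<in>space N. W t \<omega> - W s \<omega> \<in> C}) =
        prob A * measure gauss {y. sqrt (t - s) * y \<in> C}"
begin

lemma space_F: "0 \<le> t \<Longrightarrow> space (F t) = space N"
  using subalg by (simp add: subalgebra_def)

lemma sets_F: "0 \<le> t \<Longrightarrow> A \<in> sets (F t) \<Longrightarrow> A \<in> sets N"
  using subalg by (auto simp: subalgebra_def)

lemma measurable_F_N: "f \<in> measurable (F t) S \<Longrightarrow> 0 \<le> t \<Longrightarrow> f \<in> measurable N S"
  using measurable_from_subalg[OF subalg] by blast

lemma subalg_F: "0 \<le> s \<Longrightarrow> s \<le> t \<Longrightarrow> subalgebra (F t) (F s)"
  using F_mono space_F by (simp add: subalgebra_def)

lemma measurable_F_mono: "f \<in> measurable (F s) S \<Longrightarrow> 0 \<le> s \<Longrightarrow> s \<le> t \<Longrightarrow> f \<in> measurable (F t) S"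
  using measurable_from_subalg[OF subalg_F] by blast

lemma W_measurable: "0 \<le> t \<Longrightarrow> W t \<in> borel_measurable N"
  by (rule measurable_F_N[OF W_adapted])

text \<open>The preimages under \<open>f\<close> and \<open>g\<close> differ inside a null set;
  completeness makes both difference pieces null sets of \<open>N\<close>, and \<open>null_F\<close>
  puts them into \<open>F t\<close>. It serves for functions of the solution \<open>Z\<close> that
  are known only up to a null set.\<close>

lemma AE_cong_F:
  fixes f g :: "'a \<Rightarrow> 'b :: topological_space"
  assumes f: "f \<in> borel_measurable (F t)" and fg: "AE \<omega> in N. f \<omega> = g \<omega>" and t: "0 \<le> t"
  shows "g \<in> borel_measurable (F t)"
proof (rule measurableI)
  interpret complete_measure N by (rule complete)
  fix A :: "'b set" assume A: "A \<in> sets borel"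
  obtain E where E: "{\<omega>\<in>space N. f \<omega> \<noteq> g \<omega>} \<subseteq> E" "E \<in> null_sets N"
    using fg unfolding eventually_ae_filter by blast
  define E1 where "E1 = (g -` A \<inter> space N) \<inter> E"
  define E2 where "E2 = (f -` A \<inter> space N) \<inter> E"
  have "E1 \<in> null_sets N" "E2 \<in> null_sets N"
    using complete2[OF _ E(2)] unfolding E1_def E2_def by auto
  then have *: "E1 \<in> sets (F t)" "E2 \<in> sets (F t)"
    using null_F t by auto
  have "g -` A \<inter> space (F t) = ((f -` A \<inter> space (F t)) - E2) \<union> E1"
    using E(1) t by (auto simp: E1_def E2_def space_F)
  then show "g -` A \<inter> space (F t) \<in> sets (F t)"
    using * measurable_sets[OF f A] by auto
qed simp

text \<open>With \<omega> itself regarded as a random element of \<open>F s\<close>, independence of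
  the increment from the past says that the pair has a product law; on rectangles this is
  \<open>W_indep\<close>, and rectangles determine the measure.\<close>

lemma distr_freeze:
  assumes s: "0 \<le> s" "s \<le> t"
  shows "distr N (F s \<Otimes>\<^sub>M borel) (\<lambda>\<omega>. (\<omega>, W t \<omega> - W s \<omega>)) =
         restr_to_subalg N (F s) \<Otimes>\<^sub>M distr gauss borel (\<lambda>y. sqrt (t - s) * y)"
proof (rule pair_measure_eqI[symmetric])
  interpret g: prob_space gauss by (rule prob_space_gauss)
  interpret R: prob_space "restr_to_subalg N (F s)"
    by (rule prob_space_restr_to_subalg) (use subalg s prob_space_axioms in auto)
  interpret D: prob_space "distr gauss borel (\<lambda>y. sqrt (t - s) * y)"
    by (rule g.prob_space_distr) simp
  show "sigma_finite_measure (restr_to_subalg N (F s))" ..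
  show "sigma_finite_measure (distr gauss borel (\<lambda>y. sqrt (t - s) * y))" ..
  have [measurable]: "(\<lambda>\<omega>. \<omega>) \<in> N \<rightarrow>\<^sub>M F s" "W t \<in> borel_measurable N" "W s \<in> borel_measurable N"
    using s W_measurable by (auto simp: measurable_def space_F sets_F sets.Int_space_eq2)
  show sets: "sets (restr_to_subalg N (F s) \<Otimes>\<^sub>M distr gauss borel (\<lambda>y. sqrt (t - s) * y)) =
        sets (distr N (F s \<Otimes>\<^sub>M borel) (\<lambda>\<omega>. (\<omega>, W t \<omega> - W s \<omega>)))"
    unfolding sets_distr by (rule sets_pair_measure_cong) (auto simp: sets_restr_to_subalg subalg s)
  fix A C assume "A \<in> sets (restr_to_subalg N (F s))" "C \<in> sets (distr gauss borel (\<lambda>y. sqrt (t - s) * y))"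
  then have A: "A \<in> sets (F s)" and C[measurable]: "C \<in> sets borel"
    by (auto simp: sets_restr_to_subalg subalg s)
  note A[measurable]
  have "A \<subseteq> space N" using sets.sets_into_space[OF A] s by (simp add: space_F)
  then have "(\<lambda>\<omega>. (\<omega>, W t \<omega> - W s \<omega>)) -` (A \<times> C) \<inter> space N = A \<inter> {\<omega>\<in>space N. W t \<omega> - W s \<omega> \<in> C}"
    by auto
  then have "emeasure (distr N (F s \<Otimes>\<^sub>M borel) (\<lambda>\<omega>. (\<omega>, W t \<omega> - W s \<omega>))) (A \<times> C) =
     prob A * measure gauss {y. sqrt (t - s) * y \<in> C}"
    by (subst emeasure_distr) (auto simp: emeasure_eq_measure W_indep[OF s A C])
  also have "\<dots> = emeasure (restr_to_subalg N (F s)) A * emeasure (distr gauss borel (\<lambda>y. sqrt (t - s) * y)) C"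
    using A s by (subst emeasure_distr)
      (auto simp: emeasure_restr_to_subalg subalg emeasure_eq_measure g.emeasure_eq_measure ennreal_mult vimage_def)
  finally show "emeasure (restr_to_subalg N (F s)) A * emeasure (distr gauss borel (\<lambda>y. sqrt (t - s) * y)) C =
      emeasure (distr N (F s \<Otimes>\<^sub>M borel) (\<lambda>\<omega>. (\<omega>, W t \<omega> - W s \<omega>))) (A \<times> C)" ..
qed

text \<open>Tonelli for the product law: whatever is known at time \<open>s\<close> may be held
  fixed while the increment is integrated out. This stands in for conditional expectations and
  yields the Markov property.\<close>

lemma nn_integral_freeze:
  assumes s: "0 \<le> s" "s \<le> t" and f[measurable]: "f \<in> borel_measurable (F s \<Otimes>\<^sub>M borel)"
  shows "(\<integral>\<^sup>+\<omega>. f (\<omega>, W t \<omega> - W s \<omega>) \<partial>N) = (\<integral>\<^sup>+\<omega>. \<integral>\<^sup>+y. f (\<omega>, sqrt (t - s) * y) \<partial>gauss \<partial>N)"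
proof -
  interpret g: prob_space gauss by (rule prob_space_gauss)
  interpret D: prob_space "distr gauss borel (\<lambda>y. sqrt (t - s) * y)"
    by (rule g.prob_space_distr) simp
  have [measurable]: "(\<lambda>\<omega>. \<omega>) \<in> N \<rightarrow>\<^sub>M F s" "W t \<in> borel_measurable N" "W s \<in> borel_measurable N"
    using s W_measurable by (auto simp: measurable_def space_F sets_F sets.Int_space_eq2)
  have sets: "sets (restr_to_subalg N (F s) \<Otimes>\<^sub>M distr gauss borel (\<lambda>y. sqrt (t - s) * y)) = sets (F s \<Otimes>\<^sub>M borel)"
    by (rule sets_pair_measure_cong) (auto simp: sets_restr_to_subalg subalg s)
  have f': "f \<in> borel_measurable (restr_to_subalg N (F s) \<Otimes>\<^sub>M distr gauss borel (\<lambda>y. sqrt (t - s) * y))"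
    using f by (simp add: measurable_cong_sets[OF sets refl])
  have sf: "subalgebra N (F s)" using subalg s by simp
  have "(\<integral>\<^sup>+\<omega>. f (\<omega>, W t \<omega> - W s \<omega>) \<partial>N) =
    integral\<^sup>N (distr N (F s \<Otimes>\<^sub>M borel) (\<lambda>\<omega>. (\<omega>, W t \<omega> - W s \<omega>))) f"
    by (subst nn_integral_distr) auto
  also have "\<dots> = (\<integral>\<^sup>+\<omega>. \<integral>\<^sup>+y. f (\<omega>, y) \<partial>distr gauss borel (\<lambda>y. sqrt (t - s) * y) \<partial>restr_to_subalg N (F s))"
    unfolding distr_freeze[OF s] by (subst D.nn_integral_fst[OF f', symmetric]) simp
  also have "\<dots> = (\<integral>\<^sup>+\<omega>. \<integral>\<^sup>+y. f (\<omega>, sqrt (t - s) * y) \<partial>gauss \<partial>restr_to_subalg N (F s))"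
    by (intro nn_integral_cong, subst nn_integral_distr)
       (auto simp: space_restr_to_subalg sf space_F s intro!: measurable_compose[OF _ f])
  also have "\<dots> = (\<integral>\<^sup>+\<omega>. \<integral>\<^sup>+y. f (\<omega>, sqrt (t - s) * y) \<partial>gauss \<partial>N)"
  proof (rule nn_integral_subalgebra2[OF sf])
    have "(\<lambda>z. f (fst z, sqrt (t - s) * snd z)) \<in> borel_measurable (F s \<Otimes>\<^sub>M gauss)"
    proof -
      have "sets (F s \<Otimes>\<^sub>M gauss) = sets (F s \<Otimes>\<^sub>M borel)" by (rule sets_pair_measure_cong) auto
      then show ?thesis by (subst measurable_cong_sets[OF _ refl]) measurable
    qed
    from g.borel_measurable_nn_integral_fst[OF this]
    show "(\<lambda>\<omega>. \<integral>\<^sup>+y. f (\<omega>, sqrt (t - s) * y) \<partial>gauss) \<in> borel_measurable (F s)" by simp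
  qed
  finally show ?thesis .
qed

lemma indep_var_increment:
  assumes s: "0 \<le> s" "s \<le> t" and X: "X \<in> borel_measurable (F s)"
  shows "indep_var borel X borel (\<lambda>\<omega>. W t \<omega> - W s \<omega>)"
  unfolding indep_var_distribution_eq
proof (intro conjI)
  have [measurable]: "X \<in> borel_measurable N" "W t \<in> borel_measurable N" "W s \<in> borel_measurable N"
    using s W_measurable measurable_F_N X by auto
  show rv: "random_variable borel X" "random_variable borel (\<lambda>\<omega>. W t \<omega> - W s \<omega>)"
    by measurable
  interpret X: prob_space "distr N borel X" by (rule prob_space_distr) fact
  interpret Y: prob_space "distr N borel (\<lambda>\<omega>. W t \<omega> - W s \<omega>)" by (rule prob_space_distr) fact
  have *: "prob (E \<inter> {\<omega>\<in>space N. W t \<omega> - W s \<omega> \<in> C}) = prob E * prob {\<omega>\<in>space N. W t \<omega> - W s \<omega> \<in> C}"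
    if "E \<in> sets (F s)" "C \<in> sets borel" for E C
    using W_indep[OF s that] W_indep[OF s _ that(2), of "space N"] sets.top[of "F s"] s
    by (simp add: space_F prob_space Int_absorb1 Collect_conj_eq[symmetric] cong: conj_cong)
  show "distr N borel X \<Otimes>\<^sub>M distr N borel (\<lambda>\<omega>. W t \<omega> - W s \<omega>) =
        distr N (borel \<Otimes>\<^sub>M borel) (\<lambda>\<omega>. (X \<omega>, W t \<omega> - W s \<omega>))"
  proof (rule pair_measure_eqI)
    show "sigma_finite_measure (distr N borel X)" ..
    show "sigma_finite_measure (distr N borel (\<lambda>\<omega>. W t \<omega> - W s \<omega>))" ..
    fix A C assume "A \<in> sets (distr N borel X)" "C \<in> sets (distr N borel (\<lambda>\<omega>. W t \<omega> - W s \<omega>))"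
    then have [measurable]: "A \<in> sets borel" "C \<in> sets borel" by auto
    have XA: "X -` A \<inter> space N \<in> sets (F s)"
      using measurable_sets[OF X, of A] s by (simp add: space_F)
    have "(\<lambda>\<omega>. (X \<omega>, W t \<omega> - W s \<omega>)) -` (A \<times> C) \<inter> space N =
        (X -` A \<inter> space N) \<inter> {\<omega>\<in>space N. W t \<omega> - W s \<omega> \<in> C}" by auto
    moreover have "(\<lambda>\<omega>. W t \<omega> - W s \<omega>) -` C \<inter> space N = {\<omega>\<in>space N. W t \<omega> - W s \<omega> \<in> C}" by auto
    ultimately show "emeasure (distr N borel X) A * emeasure (distr N borel (\<lambda>\<omega>. W t \<omega> - W s \<omega>)) C =
        emeasure (distr N (borel \<Otimes>\<^sub>M borel) (\<lambda>\<omega>. (X \<omega>, W t \<omega> - W s \<omega>))) (A \<times> C)"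
      using *[OF XA, of C] by (simp add: emeasure_distr emeasure_eq_measure ennreal_mult)
  qed simp
qed

end

section \<open>Approximation by elementary integrands\<close>

text \<open>The running sums are nondecreasing, so the retained terms form an initial block whose
  sum has itself passed the test. The induction carries a second bound, by the untruncated sum, to
  handle a term that is still retained.\<close>

lemma sum_truncated_le:
  fixes x :: "nat \<Rightarrow> real"
  assumes "\<And>j. 0 \<le> x j" and "0 \<le> \<delta>"
  shows "(\<Sum>j<i. if (\<Sum>k\<le>j. x k) \<le> \<delta> then x j else 0) \<le> \<delta>"
proof -
  have "(\<Sum>j<i. if (\<Sum>k\<le>j. x k) \<le> \<delta> then x j else 0) \<le> min \<delta> (\<Sum>k<i. x k)"
  proof (induction i)
    case (Suc i)
    have "(\<Sum>k\<le>i. x k) = (\<Sum>k<i. x k) + x i" by (simp flip: lessThan_Suc_atMost)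
    then show ?case using Suc assms(1)[of i] by (simp split: if_splits)
  qed (use assms in simp)
  then show ?thesis by simp
qed

lemma grid_mono:
  fixes t :: "nat \<Rightarrow> real"
  assumes "\<forall>i<n. t i \<le> t (Suc i)" "i \<le> j" "j \<le> n"
  shows "t i \<le> t j"
  using assms(2,3)
proof (induction j rule: dec_induct)
  case (step m)
  then have "t i \<le> t m" by simp
  also have "\<dots> \<le> t (Suc m)" using assms(1) step by simp
  finally show ?case .
qed simp

lemma ex_grid:
  assumes "finite (D :: real set)" "0 \<le> T"
  obtains t :: "nat \<Rightarrow> real" and n where "t 0 = 0" "t n = T" "\<And>i. i < n \<Longrightarrow> t i < t (Suc i)"
    "\<And>d. d \<in> D \<Longrightarrow> 0 \<le> d \<Longrightarrow> d \<le> T \<Longrightarrow> d \<in> t ` {..n}"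
proof -
  define L where "L = sorted_list_of_set (insert 0 (insert T (D \<inter> {0..T})))"
  have fin: "finite (insert 0 (insert T (D \<inter> {0..T})))" using assms by simp
  have set: "set L = insert 0 (insert T (D \<inter> {0..T}))" unfolding L_def by (rule set_sorted_list_of_set[OF fin])
  have sw: "sorted_wrt (<) L" unfolding L_def by (rule strict_sorted_list_of_set)
  have ne: "length L > 0" using set by (metis empty_not_insert empty_set length_greater_0_conv)
  have mono: "L ! i \<le> L ! j" if "i \<le> j" "j < length L" for i j
    using sorted_wrt_nth_less[OF sw, of i j] that by (cases "i = j") auto
  obtain i0 where "i0 < length L" "L ! i0 = 0" using set by (metis in_set_conv_nth insertI1)
  then have "L ! 0 \<le> 0" using mono[of 0 i0] by auto
  moreover have "L ! 0 \<in> set L" using ne by simp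
  ultimately have L0: "L ! 0 = 0" using set assms by auto
  obtain i1 where "i1 < length L" "L ! i1 = T" using set by (metis in_set_conv_nth insertI1 insertI2)
  then have "T \<le> L ! (length L - 1)" using mono[of i1 "length L - 1"] by auto
  moreover have "L ! (length L - 1) \<in> set L" using ne by simp
  ultimately have L1: "L ! (length L - 1) = T" using set assms by auto
  show ?thesis
  proof (rule that[of "\<lambda>i. L ! i" "length L - 1"])
    show "L ! i < L ! Suc i" if "i < length L - 1" for i
      using sorted_wrt_nth_less[OF sw, of i "Suc i"] that by auto
    fix d assume "d \<in> D" "0 \<le> d" "d \<le> T"
    then have "d \<in> set L" using set by auto
    then show "d \<in> (\<lambda>i. L ! i) ` {..length L - 1}"
      by (force simp: in_set_conv_nth)
  qed (use L0 L1 in auto)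
qed

lemma has_bochner_integral_step:
  fixes f :: "real \<Rightarrow> real" and t :: "nat \<Rightarrow> real"
  assumes t: "\<And>i. i < n \<Longrightarrow> t i \<le> t (Suc i)"
    and f: "\<And>i s. i < n \<Longrightarrow> t i < s \<Longrightarrow> s \<le> t (Suc i) \<Longrightarrow> f s = c i"
  shows "has_bochner_integral lborel (\<lambda>s. indicator {t 0..t n} s * f s) (\<Sum>i<n. c i * (t (Suc i) - t i))"
proof -
  have *: "has_bochner_integral lborel (\<lambda>s. indicator {t 0<..t n} s * f s) (\<Sum>i<n. c i * (t (Suc i) - t i)) \<and> t 0 \<le> t n"
    using assms
  proof (induction n)
    case (Suc n)
    then have IH: "has_bochner_integral lborel (\<lambda>s. indicator {t 0<..t n} s * f s) (\<Sum>i<n. c i * (t (Suc i) - t i))" "t 0 \<le> t n"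
      by auto
    have "has_bochner_integral lborel (\<lambda>s. c n * indicator {t n<..t (Suc n)} s) (c n * (t (Suc n) - t n))"
      using Suc.prems(1)[of n] by (intro has_bochner_integral_mult_right) (auto simp: has_bochner_integral_iff)
    from has_bochner_integral_add[OF IH(1) this]
    have "has_bochner_integral lborel (\<lambda>s. indicator {t 0<..t n} s * f s + c n * indicator {t n<..t (Suc n)} s)
      (\<Sum>i<Suc n. c i * (t (Suc i) - t i))" by simp
    moreover have "indicator {t 0<..t n} s * f s + c n * indicator {t n<..t (Suc n)} s = indicator {t 0<..t (Suc n)} s * f s" for s
      using Suc.prems(1)[of n] Suc.prems(2)[of n s] IH(2) by (auto simp: indicator_def)
    ultimately show ?case using IH(2) Suc.prems(1)[of n] by auto
  qed auto
  \<comment> \<open>The cells are open on the left, so \<open>t 0\<close> lies in none of them;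
    \<open>f (t 0)\<close> is unconstrained, but a single point does not affect the
    integral.\<close>
  have "AE s in lborel. indicator {t 0<..t n} s * f s = indicator {t 0..t n} s * f s"
    using AE_lborel_singleton[of "t 0"] by eventually_elim (auto simp: indicator_def)
  moreover have "(\<lambda>s. indicator {t 0..t n} s * f s) \<in> borel_measurable lborel"
  proof -
    have "(\<lambda>s. indicator {t 0<..t n} s * f s + indicator {t 0} s * f (t 0)) \<in> borel_measurable lborel"
      using * by (auto simp: has_bochner_integral_iff)
    moreover have "indicator {t 0<..t n} s * f s + indicator {t 0} s * f (t 0) = indicator {t 0..t n} s * f s" for s
      using * by (auto simp: indicator_def)
    ultimately show ?thesis by simp
  qed
  ultimately show ?thesis
    using *[THEN conjunct1] borel_measurable_has_bochner_integral[OF *[THEN conjunct1]]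
    by (rule_tac has_bochner_integral_cong_AE[THEN iffD1])
qed

section \<open>Second moments of sums over a grid\<close>

context filtered_bm
begin

lemma has_bochner_integral_increment:
  fixes U :: "'a \<Rightarrow> real" and h :: "real \<Rightarrow> real"
  assumes s: "0 \<le> s" "s \<le> t" and U: "U \<in> borel_measurable (F s)" "integrable N U"
    and h[measurable]: "h \<in> borel_measurable borel"
    and I: "has_bochner_integral gauss (\<lambda>y. h (sqrt (t - s) * y)) I"
  shows "has_bochner_integral N (\<lambda>\<omega>. U \<omega> * h (W t \<omega> - W s \<omega>)) (expectation U * I)"
proof -
  have [measurable]: "U \<in> borel_measurable N" "W t \<in> borel_measurable N" "W s \<in> borel_measurable N"
    using s W_measurable measurable_F_N U by auto
  have D: "distr N borel (\<lambda>\<omega>. W t \<omega> - W s \<omega>) = distr gauss borel (\<lambda>y. sqrt (t - s) * y)"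
  proof (rule measure_eqI)
    fix C assume "C \<in> sets (distr N borel (\<lambda>\<omega>. W t \<omega> - W s \<omega>))"
    then have C[measurable]: "C \<in> sets borel" by simp
    interpret g: prob_space gauss by (rule prob_space_gauss)
    have "prob {\<omega>\<in>space N. W t \<omega> - W s \<omega> \<in> C} = measure gauss {y. sqrt (t - s) * y \<in> C}"
      using W_indep[OF s _ C, of "space N"] sets.top[of "F s"] s by (simp add: space_F prob_space Int_def)
    moreover have "(\<lambda>\<omega>. W t \<omega> - W s \<omega>) -` C \<inter> space N = {\<omega>\<in>space N. W t \<omega> - W s \<omega> \<in> C}" by auto
    ultimately show "emeasure (distr N borel (\<lambda>\<omega>. W t \<omega> - W s \<omega>)) C = emeasure (distr gauss borel (\<lambda>y. sqrt (t - s) * y)) C"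
      by (simp add: emeasure_distr emeasure_eq_measure g.emeasure_eq_measure vimage_def)
  qed simp
  have "has_bochner_integral (distr gauss borel (\<lambda>y. sqrt (t - s) * y)) h I"
    using I by (simp add: has_bochner_integral_iff integrable_distr_eq integral_distr)
  then have hI: "has_bochner_integral N (\<lambda>\<omega>. h (W t \<omega> - W s \<omega>)) I"
    by (simp add: has_bochner_integral_iff integrable_distr_eq integral_distr flip: D)
  have "indep_var borel ((\<lambda>x. x) \<circ> U) borel (h \<circ> (\<lambda>\<omega>. W t \<omega> - W s \<omega>))"
    by (intro indep_var_compose[OF indep_var_increment[OF s U(1)]]) auto
  then have ind: "indep_var borel U borel (\<lambda>\<omega>. h (W t \<omega> - W s \<omega>))"
    by (simp add: comp_def)
  show ?thesis
    using indep_var_integrable[OF ind] indep_var_lebesgue_integral[OF ind] U(2) hI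
    by (auto simp: has_bochner_integral_iff)
qed

lemma has_bochner_integral_increment_square:
  assumes s: "0 \<le> s" "s \<le> t" and G[measurable]: "G \<in> borel_measurable (F s)" and "integrable N (\<lambda>\<omega>. (G \<omega>)\<^sup>2)"
  shows "has_bochner_integral N (\<lambda>\<omega>. (G \<omega> * (W t \<omega> - W s \<omega>))\<^sup>2) (expectation (\<lambda>\<omega>. (G \<omega>)\<^sup>2) * (t - s))"
proof -
  have "has_bochner_integral gauss (\<lambda>y. (sqrt (t - s) * y)\<^sup>2) (t - s)"
    using has_bochner_integral_mult_right[OF has_bochner_integral_gauss_square, of "t - s"] s
    by (simp add: power_mult_distrib)
  from has_bochner_integral_increment[OF s _ assms(4) _ this]
  show ?thesis by (simp add: power_mult_distrib)
qed

lemma integrable_mult_square: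
  fixes S G :: "'a \<Rightarrow> real"
  assumes [measurable]: "S \<in> borel_measurable N" "G \<in> borel_measurable N"
    and "integrable N (\<lambda>\<omega>. (S \<omega>)\<^sup>2)" "integrable N (\<lambda>\<omega>. (G \<omega>)\<^sup>2)"
  shows "integrable N (\<lambda>\<omega>. S \<omega> * G \<omega>)"
proof (rule Bochner_Integration.integrable_bound)
  show "integrable N (\<lambda>\<omega>. (S \<omega>)\<^sup>2 + (G \<omega>)\<^sup>2)" using assms by simp
  have "\<bar>a * b\<bar> \<le> a\<^sup>2 + b\<^sup>2" for a b :: real
    using sum_squares_bound[of "\<bar>a\<bar>" "\<bar>b\<bar>"] mult_nonneg_nonneg[of "\<bar>a\<bar>" "\<bar>b\<bar>"]
    unfolding abs_mult power2_abs mult.assoc by linarith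
  then show "AE \<omega> in N. norm (S \<omega> * G \<omega>) \<le> norm ((S \<omega>)\<^sup>2 + (G \<omega>)\<^sup>2)"
    by simp
qed simp

lemma integrable_square_add:
  fixes S G :: "'a \<Rightarrow> real"
  assumes [measurable]: "S \<in> borel_measurable N" "G \<in> borel_measurable N"
    and "integrable N (\<lambda>\<omega>. (S \<omega>)\<^sup>2)" "integrable N (\<lambda>\<omega>. (G \<omega>)\<^sup>2)"
  shows "integrable N (\<lambda>\<omega>. (S \<omega> + G \<omega>)\<^sup>2)"
  using assms integrable_mult_square[OF assms] by (simp add: power2_sum mult.assoc)

text \<open>Ito's isometry. When the sum is extended by one cell, the cross term is a variable known
  at the left end of the cell times a centred independent increment, hence has mean
  \<open>0\<close>. Adaptedness of the sum belongs to the induction because the next cross term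
  relies on it.\<close>

lemma has_bochner_integral_isometry:
  fixes t :: "nat \<Rightarrow> real" and h :: "nat \<Rightarrow> 'a \<Rightarrow> real"
  assumes "0 \<le> t 0" and "\<And>i. i < n \<Longrightarrow> t i \<le> t (Suc i)"
    and "\<And>i. i < n \<Longrightarrow> h i \<in> borel_measurable (F (t i))"
    and "\<And>i. i < n \<Longrightarrow> integrable N (\<lambda>\<omega>. (h i \<omega>)\<^sup>2)"
  shows "has_bochner_integral N (\<lambda>\<omega>. (\<Sum>i<n. h i \<omega> * (W (t (Suc i)) \<omega> - W (t i) \<omega>))\<^sup>2)
           (\<Sum>i<n. expectation (\<lambda>\<omega>. (h i \<omega>)\<^sup>2) * (t (Suc i) - t i)) \<and>
         (\<lambda>\<omega>. \<Sum>i<n. h i \<omega> * (W (t (Suc i)) \<omega> - W (t i) \<omega>)) \<in> borel_measurable (F (t n)) \<and> 0 \<le> t n"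
  using assms
proof (induction n)
  case 0
  then show ?case by (simp add: has_bochner_integral_zero)
next
  case (Suc n)
  define S where "S = (\<lambda>\<omega>. \<Sum>i<n. h i \<omega> * (W (t (Suc i)) \<omega> - W (t i) \<omega>))"
  have IH: "has_bochner_integral N (\<lambda>\<omega>. (S \<omega>)\<^sup>2) (\<Sum>i<n. expectation (\<lambda>\<omega>. (h i \<omega>)\<^sup>2) * (t (Suc i) - t i))"
    "S \<in> borel_measurable (F (t n))" "0 \<le> t n"
    using Suc unfolding S_def by auto
  have tn: "t n \<le> t (Suc n)" and hn: "h n \<in> borel_measurable (F (t n))" "integrable N (\<lambda>\<omega>. (h n \<omega>)\<^sup>2)"
    using Suc.prems by auto
  have N[measurable]: "S \<in> borel_measurable N" "h n \<in> borel_measurable N"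
    using measurable_F_N IH hn by auto
  have SG: "integrable N (\<lambda>\<omega>. S \<omega> * h n \<omega>)"
    using IH hn by (intro integrable_mult_square N) (auto simp: has_bochner_integral_iff)
  have g0: "has_bochner_integral gauss (\<lambda>y. sqrt (t (Suc n) - t n) * y) 0"
    using has_bochner_integral_mult_right[OF has_bochner_integral_gauss_id] by fastforce
  have SG': "(\<lambda>\<omega>. S \<omega> * h n \<omega>) \<in> borel_measurable (F (t n))" using IH hn by measurable
  have "has_bochner_integral N (\<lambda>\<omega>. 2 * (S \<omega> * h n \<omega> * (W (t (Suc n)) \<omega> - W (t n) \<omega>))) (2 * 0)"
    using has_bochner_integral_increment[OF IH(3) tn SG' SG _ g0]
    by (intro has_bochner_integral_mult_right) simp
  from has_bochner_integral_add[OF has_bochner_integral_add[OF IH(1) this]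
      has_bochner_integral_increment_square[OF IH(3) tn hn]]
  have *: "has_bochner_integral N (\<lambda>\<omega>. (S \<omega>)\<^sup>2 + 2 * (S \<omega> * h n \<omega> * (W (t (Suc n)) \<omega> - W (t n) \<omega>))
       + (h n \<omega> * (W (t (Suc n)) \<omega> - W (t n) \<omega>))\<^sup>2)
      (\<Sum>i<Suc n. expectation (\<lambda>\<omega>. (h i \<omega>)\<^sup>2) * (t (Suc i) - t i))" by simp
  have "(S \<omega>)\<^sup>2 + 2 * (S \<omega> * h n \<omega> * (W (t (Suc n)) \<omega> - W (t n) \<omega>)) + (h n \<omega> * (W (t (Suc n)) \<omega> - W (t n) \<omega>))\<^sup>2
     = (S \<omega> + h n \<omega> * (W (t (Suc n)) \<omega> - W (t n) \<omega>))\<^sup>2" for \<omega>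
    by (simp only: power2_sum mult.assoc)
  note * = *[unfolded this]
  have "S \<in> borel_measurable (F (t (Suc n)))" "h n \<in> borel_measurable (F (t (Suc n)))"
     "W (t n) \<in> borel_measurable (F (t (Suc n)))" "W (t (Suc n)) \<in> borel_measurable (F (t (Suc n)))"
    using measurable_F_mono[OF _ IH(3) tn] IH hn W_adapted tn by auto
  then have m: "(\<lambda>\<omega>. S \<omega> + h n \<omega> * (W (t (Suc n)) \<omega> - W (t n) \<omega>)) \<in> borel_measurable (F (t (Suc n)))"
    by measurable
  have "0 \<le> t (Suc n)" using IH(3) tn by simp
  with * m show ?case unfolding S_def sum.lessThan_Suc by (intro conjI)
qed

text \<open>An elementary integrand together with its integral, as a process in the upper limit $u$.\<close>

inductive elem :: "(real \<Rightarrow> 'a \<Rightarrow> real) \<Rightarrow> (real \<Rightarrow> 'a \<Rightarrow> real) \<Rightarrow> bool" where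
  elem_zero: "elem (\<lambda>s \<omega>. 0) (\<lambda>u \<omega>. 0)"
| elem_step: "elem H I \<Longrightarrow> 0 \<le> a \<Longrightarrow> a \<le> b \<Longrightarrow> \<xi> \<in> borel_measurable (F a) \<Longrightarrow>
     (\<And>\<omega>. \<omega> \<in> space N \<Longrightarrow> \<bar>\<xi> \<omega>\<bar> \<le> C) \<Longrightarrow>
     elem (\<lambda>s \<omega>. H s \<omega> + \<xi> \<omega> * indicator {a<..b} s)
          (\<lambda>u \<omega>. I u \<omega> + \<xi> \<omega> * (W (min b u) \<omega> - W (min a u) \<omega>))"

lemma elem_add: "elem H I \<Longrightarrow> elem H' I' \<Longrightarrow> elem (\<lambda>s \<omega>. H' s \<omega> + H s \<omega>) (\<lambda>u \<omega>. I' u \<omega> + I u \<omega>)"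
proof (induction rule: elem.induct)
  case (elem_step H I a b \<xi> C)
  from elem.elem_step[OF this(6)[OF this(7)] this(2-5)] show ?case
    by (simp add: add.assoc)
qed simp

lemma elem_sum: "finite A \<Longrightarrow> (\<And>i. i \<in> A \<Longrightarrow> elem (H i) (I i)) \<Longrightarrow>
    elem (\<lambda>s \<omega>. \<Sum>i\<in>A. H i s \<omega>) (\<lambda>u \<omega>. \<Sum>i\<in>A. I i u \<omega>)"
proof (induction A rule: finite_induct)
  case empty
  then show ?case by (simp add: elem_zero)
next
  case (insert x A)
  then have "elem (\<lambda>s \<omega>. H x s \<omega> + (\<Sum>i\<in>A. H i s \<omega>)) (\<lambda>u \<omega>. I x u \<omega> + (\<Sum>i\<in>A. I i u \<omega>))"
    by (intro elem_add) auto
  with insert show ?case by simp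
qed

lemma elem_single:
  assumes "0 \<le> a" "a \<le> b" "\<xi> \<in> borel_measurable (F a)" "\<And>\<omega>. \<omega> \<in> space N \<Longrightarrow> \<bar>\<xi> \<omega>\<bar> \<le> C"
  shows "elem (\<lambda>s \<omega>. \<xi> \<omega> * indicator {a<..b} s) (\<lambda>u \<omega>. \<xi> \<omega> * (W (min b u) \<omega> - W (min a u) \<omega>))"
  using elem_step[OF elem_zero assms] by simp

lemma elem_cmult: "elem H I \<Longrightarrow> elem (\<lambda>s \<omega>. c * H s \<omega>) (\<lambda>u \<omega>. c * I u \<omega>)"
proof (induction rule: elem.induct)
  case elem_zero
  then show ?case using elem.elem_zero by simp
next
  case (elem_step H I a b \<xi> C)
  have "elem (\<lambda>s \<omega>. c * H s \<omega> + (c * \<xi> \<omega>) * indicator {a<..b} s)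
     (\<lambda>u \<omega>. c * I u \<omega> + (c * \<xi> \<omega>) * (W (min b u) \<omega> - W (min a u) \<omega>))"
    using elem_step by (intro elem.elem_step[where C = "\<bar>c\<bar> * C"]) (auto simp: abs_mult intro!: mult_left_mono)
  then show ?case by (simp add: algebra_simps)
qed

text \<open>A cell excludes its left end, so the constant value on it is read off at the right end,
  yet it has to be known at the left end. A degenerate cell contains no point and its increment
  vanishes, so it is exempt from the adaptedness condition.\<close>

definition step_on :: "(real \<Rightarrow> 'a \<Rightarrow> real) \<Rightarrow> (real \<Rightarrow> 'a \<Rightarrow> real) \<Rightarrow> (nat \<Rightarrow> real) \<Rightarrow> nat \<Rightarrow> bool" where
  "step_on H I t n \<longleftrightarrow>
     (\<forall>i<n. (\<forall>s \<omega>. t i < s \<longrightarrow> s \<le> t (Suc i) \<longrightarrow> H s \<omega> = H (t (Suc i)) \<omega>) \<and>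
        (H (t (Suc i)) \<in> borel_measurable (F (t i)) \<and> (\<exists>C. \<forall>\<omega>\<in>space N. \<bar>H (t (Suc i)) \<omega>\<bar> \<le> C) \<or> t i = t (Suc i))) \<and>
     (\<forall>i\<le>n. \<forall>\<omega>. I (t i) \<omega> = (\<Sum>j<i. H (t (Suc j)) \<omega> * (W (t (Suc j)) \<omega> - W (t j) \<omega>)))"

text \<open>\<open>D\<close> collects the ends of the intervals from which \<open>H\<close> was
  built. Every grid through the points of \<open>D\<close> up to its last time fits
  \<open>H\<close>, so a grid may be refined further by the times at which the integral is to be
  estimated.\<close>

lemma elem_grid:
  assumes "elem H I"
  shows "\<exists>D. (finite D \<and> D \<subseteq> {0..}) \<and> (\<forall>t n. t 0 = 0 \<longrightarrow> (\<forall>i<n. t i \<le> t (Suc i)) \<longrightarrow> (\<forall>d\<in>D. d \<le> t n \<longrightarrow> d \<in> t ` {..n}) \<longrightarrow>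
     step_on H I t n)"
  using assms
proof (induction rule: elem.induct)
  case elem_zero
  then show ?case by (intro exI[of _ "{}"]) (auto simp: step_on_def)
next
  case (elem_step H I a b \<xi> C)
  then obtain D where D: "finite D \<and> D \<subseteq> {0..}" "\<And>t n. t 0 = 0 \<Longrightarrow> (\<forall>i<n. t i \<le> t (Suc i)) \<Longrightarrow> (\<forall>d\<in>D. d \<le> t n \<longrightarrow> d \<in> t ` {..n}) \<Longrightarrow>
     step_on H I t n"
    by blast
  let ?H = "\<lambda>s \<omega>. H s \<omega> + \<xi> \<omega> * indicator {a<..b} s"
  let ?I = "\<lambda>u \<omega>. I u \<omega> + \<xi> \<omega> * (W (min b u) \<omega> - W (min a u) \<omega>)"
  show ?case
  proof (intro exI[of _ "insert a (insert b D)"] conjI allI impI)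
    fix t :: "nat \<Rightarrow> real" and n
    assume t0: "t 0 = 0" and mono: "\<forall>i<n. t i \<le> t (Suc i)"
      and grid: "\<forall>d\<in>insert a (insert b D). d \<le> t n \<longrightarrow> d \<in> t ` {..n}"
    from grid have "\<forall>d\<in>D. d \<le> t n \<longrightarrow> d \<in> t ` {..n}" by simp
    note IH = D(2)[of t n, OF t0 mono this, unfolded step_on_def]
    show "step_on ?H ?I t n"
      unfolding step_on_def
    proof (intro conjI allI impI)
      have le: "t i \<le> t j" if "i \<le> j" "j \<le> n" for i j
          by (rule grid_mono[of n t i j, OF mono that])
      \<comment> \<open>No interval end falls strictly inside a cell: it is a grid point, or it lies
        beyond the last one.\<close>
      have gap: "d \<le> t i \<or> t (Suc i) \<le> d" if "i < n" "d \<in> {a, b}" for i d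
      proof (cases "d \<le> t n")
        case True
        have "d \<in> insert a (insert b D)" using that(2) by auto
        with grid True have "d \<in> t ` {..n}" by (rule_tac grid[rule_format])
        then obtain k where k: "k \<le> n" "d = t k" by (rule imageE) simp
        show ?thesis
        proof (cases "k \<le> i")
          case True
          then have "t k \<le> t i" using le that(1) by simp
          then show ?thesis using k by simp
        next
          case False
          then have "t (Suc i) \<le> t k" using le k by simp
          then show ?thesis using k by simp
        qed
      next
        case False
        then show ?thesis using le[of "Suc i" n] that(1) by simp
      qed
      {
        fix i assume i: "i < n"
        have ind: "indicator {a<..b} s = (indicator {a<..b} (t (Suc i)) :: real)" if "t i < s" "s \<le> t (Suc i)" for s
          using gap[OF i, of a] gap[OF i, of b] that by (auto simp: indicator_def)
        fix s \<omega> assume s: "t i < s" "s \<le> t (Suc i)"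
        show "?H s \<omega> = ?H (t (Suc i)) \<omega>"
          unfolding ind[OF s] using IH[THEN conjunct1, rule_format, OF i, THEN conjunct1, rule_format, OF s] by simp
      }
      {
        fix i assume i: "i < n"
        show "?H (t (Suc i)) \<in> borel_measurable (F (t i)) \<and> (\<exists>C. \<forall>\<omega>\<in>space N. \<bar>?H (t (Suc i)) \<omega>\<bar> \<le> C) \<or> t i = t (Suc i)"
        proof (cases "t i = t (Suc i)")
          case False
          then obtain C' where C': "H (t (Suc i)) \<in> borel_measurable (F (t i))" "\<And>\<omega>. \<omega>\<in>space N \<Longrightarrow> \<bar>H (t (Suc i)) \<omega>\<bar> \<le> C'"
            using IH[THEN conjunct1, rule_format, OF i, THEN conjunct2] by blast
          show ?thesis
          proof (cases "t (Suc i) \<in> {a<..b}")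
            case True
            then have "a \<le> t i" using gap[OF i, of a] by auto
            then have [measurable]: "\<xi> \<in> borel_measurable (F (t i))"
              using elem_step by (auto intro: measurable_F_mono)
            have "\<bar>?H (t (Suc i)) \<omega>\<bar> \<le> C' + C" if "\<omega> \<in> space N" for \<omega>
              using C'(2)[OF that] elem_step(5)[OF that] True by auto
            moreover have "?H (t (Suc i)) \<in> borel_measurable (F (t i))"
              using C'(1) by measurable
            ultimately show ?thesis by blast
          qed (use C' in auto)
        qed simp
      }
      \<comment> \<open>A telescoping sum to which only the cells between \<open>a\<close> and
        \<open>b\<close> contribute. Each new cell lies before \<open>a\<close>, between
        \<open>a\<close> and \<open>b\<close>, after \<open>b\<close>, or is degenerate.\<close>
      have *: "W (min b (t i)) \<omega> - W (min a (t i)) \<omega> =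
          (\<Sum>j<i. indicator {a<..b} (t (Suc j)) * (W (t (Suc j)) \<omega> - W (t j) \<omega>))" if "i \<le> n" for i \<omega>
        using that
      proof (induction i)
        case 0
        then show ?case using t0 elem_step by simp
      next
        case (Suc i)
        have i: "i < n" and ti: "t i \<le> t (Suc i)" using Suc.prems mono by auto
        consider "t (Suc i) \<le> a" | "a \<le> t i" "a < t (Suc i)" "t (Suc i) \<le> b" | "a \<le> t i" "b \<le> t i" "b < t (Suc i)"
          | "t i = t (Suc i)"
          using gap[OF i, of a] gap[OF i, of b] ti by force
        then show ?case
        proof cases
          case 1
          then show ?thesis using Suc ti elem_step(3) by (simp add: min_absorb2)
        next
          case 2
          then show ?thesis using Suc ti by (simp add: min_absorb2 min_absorb1)
        next
          case 3
          then show ?thesis using Suc ti by (simp add: min_absorb2 min_absorb1)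
        next
          case 4
          then show ?thesis using Suc by simp
        qed
      qed
      fix i \<omega> assume "i \<le> n"
      then have "I (t i) \<omega> = (\<Sum>j<i. H (t (Suc j)) \<omega> * (W (t (Suc j)) \<omega> - W (t j) \<omega>))"
        using IH[THEN conjunct2] by blast
      then show "?I (t i) \<omega> = (\<Sum>j<i. ?H (t (Suc j)) \<omega> * (W (t (Suc j)) \<omega> - W (t j) \<omega>))"
        by (simp add: *[OF \<open>i \<le> n\<close>] sum_distrib_left sum.distrib[symmetric] algebra_simps)
    qed
  qed (use D(1) elem_step in auto)
qed

text \<open>The integrand is stopped before its energy on a grid exceeds $\<delta>$. This yields second-moment
  bounds for integrals whose integrands are only known to be small in probability.\<close>

lemma elem_truncate:
  assumes el: "elem H I" and T: "0 \<le> T" and E: "finite E" "E \<subseteq> {0..T}" and \<delta>: "0 \<le> \<delta>"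
  obtains I' where
    "\<And>u. u \<in> E \<Longrightarrow> I' u \<in> borel_measurable (F u)"
    "\<And>u. u \<in> E \<Longrightarrow> integrable N (\<lambda>\<omega>. (I' u \<omega>)\<^sup>2)"
    "\<And>u. u \<in> E \<Longrightarrow> expectation (\<lambda>\<omega>. (I' u \<omega>)\<^sup>2) \<le> \<delta>"
    "\<And>u \<omega>. u \<in> E \<Longrightarrow> (LBINT s:{0..T}. (H s \<omega>)\<^sup>2) \<le> \<delta> \<Longrightarrow> I' u \<omega> = I u \<omega>"
proof -
  from elem_grid[OF el] obtain D where D: "finite D" "D \<subseteq> {0..}" "\<And>t n. t 0 = 0 \<Longrightarrow> (\<forall>i<n. t i \<le> t (Suc i)) \<Longrightarrow> (\<forall>d\<in>D. d \<le> t n \<longrightarrow> d \<in> t ` {..n}) \<Longrightarrow>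
     step_on H I t n"
    by blast
  obtain t :: "nat \<Rightarrow> real" and n where t: "t 0 = 0" "t n = T" "\<And>i. i < n \<Longrightarrow> t i < t (Suc i)"
    and tD: "\<And>d. d \<in> D \<union> E \<Longrightarrow> 0 \<le> d \<Longrightarrow> d \<le> T \<Longrightarrow> d \<in> t ` {..n}"
    using ex_grid[of "D \<union> E" T] D(1) E(1) T by (metis finite_UnI)
  have le: "t i \<le> t j" if "i \<le> j" "j \<le> n" for i j
  proof (rule grid_mono[of n t i j, OF _ that])
    show "\<forall>i<n. t i \<le> t (Suc i)" using t(3) less_imp_le by blast
  qed
  have pos: "0 \<le> t i" if "i \<le> n" for i using le[of 0 i] that t by simp
  have "\<forall>d\<in>D. d \<le> t n \<longrightarrow> d \<in> t ` {..n}" using tD t D(2) by auto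
  from D(3)[of t n, OF t(1) _ this] t(3)
  have G: "step_on H I t n"
    using less_imp_le by blast
  note G = G[unfolded step_on_def]
  have g1: "H s \<omega> = H (t (Suc i)) \<omega>" if "i < n" "t i < s" "s \<le> t (Suc i)" for i s \<omega>
    by (rule G[THEN conjunct1, rule_format, THEN conjunct1, rule_format]) fact+
  have g2: "H (t (Suc i)) \<in> borel_measurable (F (t i))" "\<exists>C. \<forall>\<omega>\<in>space N. \<bar>H (t (Suc i)) \<omega>\<bar> \<le> C" if "i < n" for i
    using G[THEN conjunct1, rule_format, OF that, THEN conjunct2] t(3)[OF that] by auto
  have g4: "I (t i) \<omega> = (\<Sum>j<i. H (t (Suc j)) \<omega> * (W (t (Suc j)) \<omega> - W (t j) \<omega>))" if "i \<le> n" for i \<omega>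
    by (rule G[THEN conjunct2, rule_format]) fact
  note grid = g1 g2 g4
  obtain idx where idx: "\<And>u. u \<in> E \<Longrightarrow> idx u \<le> n" "\<And>u. u \<in> E \<Longrightarrow> t (idx u) = u"
  proof -
    have "\<forall>u\<in>E. \<exists>i. i \<le> n \<and> t i = u" using tD E(2) by (fastforce simp: image_iff)
    then show ?thesis using that by metis
  qed
  define x where "x = (\<lambda>\<omega> j. if j < n then (H (t (Suc j)) \<omega>)\<^sup>2 * (t (Suc j) - t j) else 0)"
  \<comment> \<open>The running energy in the test includes cell \<open>j\<close> itself. The value
    of \<open>H\<close> on that cell is already known at time \<open>t j\<close>, so the test is
    adapted, and the retained energy stays within \<delta> without overshoot by a last cell.\<close>
  define k where "k = (\<lambda>j \<omega>. if (\<Sum>i\<le>j. x \<omega> i) \<le> \<delta> then H (t (Suc j)) \<omega> else 0)"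
  have x0: "0 \<le> x \<omega> j" for \<omega> j using t(3)[of j] by (auto simp: x_def)
  have [measurable]: "k j \<in> borel_measurable (F (t j))" if j: "j < n" for j
  proof -
    have "H (t (Suc i)) \<in> borel_measurable (F (t j))" if "i \<le> j" for i
      using measurable_F_mono[OF grid(2) _ le, of i j] that j pos[of i] by auto
    then have [measurable]: "(\<lambda>\<omega>. \<Sum>i\<le>j. x \<omega> i) \<in> borel_measurable (F (t j))"
      using j unfolding x_def by (intro borel_measurable_sum) auto
    have [measurable]: "H (t (Suc j)) \<in> borel_measurable (F (t j))" using grid(2) j by blast
    show ?thesis unfolding k_def by measurable
  qed
  have kint: "integrable N (\<lambda>\<omega>. (k j \<omega>)\<^sup>2)" if j: "j < n" for j
  proof -
    obtain C where C: "\<And>\<omega>. \<omega> \<in> space N \<Longrightarrow> \<bar>H (t (Suc j)) \<omega>\<bar> \<le> C" using grid(3)[OF j] by blast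
    have "k j \<in> borel_measurable N" by (rule measurable_F_N) (use j pos[of j] in auto)
    moreover have "\<bar>k j \<omega>\<bar> \<le> C" if "\<omega> \<in> space N" for \<omega>
      using C[OF that] by (auto simp: k_def)
    then have "norm ((k j \<omega>)\<^sup>2) \<le> C\<^sup>2" if "\<omega> \<in> space N" for \<omega>
      using power_mono[of "\<bar>k j \<omega>\<bar>" C 2] that by simp
    ultimately show ?thesis
      by (intro integrable_const_bound[where B = "C\<^sup>2"] AE_I2) auto
  qed
  define I' where "I' = (\<lambda>u \<omega>. \<Sum>j<idx u. k j \<omega> * (W (t (Suc j)) \<omega> - W (t j) \<omega>))"
  have iso: "has_bochner_integral N (\<lambda>\<omega>. (I' u \<omega>)\<^sup>2) (\<Sum>i<idx u. expectation (\<lambda>\<omega>. (k i \<omega>)\<^sup>2) * (t (Suc i) - t i))"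
    "I' u \<in> borel_measurable (F u)" if "u \<in> E" for u
    using has_bochner_integral_isometry[of t "idx u" k] idx[OF that] t(1,3) kint pos
    unfolding I'_def by (auto simp: less_imp_le)
  show ?thesis
  proof (rule that)
    fix u assume u: "u \<in> E"
    show "I' u \<in> borel_measurable (F u)" "integrable N (\<lambda>\<omega>. (I' u \<omega>)\<^sup>2)"
      using iso[OF u] by (auto simp: has_bochner_integral_iff)
    have "expectation (\<lambda>\<omega>. (I' u \<omega>)\<^sup>2) = (\<Sum>i<idx u. expectation (\<lambda>\<omega>. (k i \<omega>)\<^sup>2) * (t (Suc i) - t i))"
      using iso[OF u] by (auto simp: has_bochner_integral_iff)
    also have "\<dots> = expectation (\<lambda>\<omega>. \<Sum>i<idx u. (k i \<omega>)\<^sup>2 * (t (Suc i) - t i))"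
      using kint idx[OF u] by (subst Bochner_Integration.integral_sum) auto
    also have "\<dots> \<le> expectation (\<lambda>\<omega>. \<delta>)"
    proof (rule integral_mono)
      show "integrable N (\<lambda>\<omega>. \<Sum>i<idx u. (k i \<omega>)\<^sup>2 * (t (Suc i) - t i))"
        using kint idx[OF u] by auto
      fix \<omega>
      have "(\<Sum>i<idx u. (k i \<omega>)\<^sup>2 * (t (Suc i) - t i)) = (\<Sum>j<idx u. if (\<Sum>i\<le>j. x \<omega> i) \<le> \<delta> then x \<omega> j else 0)"
        using idx[OF u] by (intro sum.cong) (auto simp: k_def x_def)
      also have "\<dots> \<le> \<delta>" by (rule sum_truncated_le) (use x0 \<delta> in auto)
      finally show "(\<Sum>i<idx u. (k i \<omega>)\<^sup>2 * (t (Suc i) - t i)) \<le> \<delta>" .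
    qed simp
    finally show "expectation (\<lambda>\<omega>. (I' u \<omega>)\<^sup>2) \<le> \<delta>" by (simp add: prob_space)
    \<comment> \<open>On a path whose total energy is at most \<delta> no running sum exceeds
      \<delta>, so nothing was cut off and \<open>I'\<close> is the original integral.\<close>
    fix \<omega> assume H: "(LBINT s:{0..T}. (H s \<omega>)\<^sup>2) \<le> \<delta>"
    have "has_bochner_integral lborel (\<lambda>s. indicator {t 0..t n} s * (H s \<omega>)\<^sup>2) (\<Sum>i<n. (H (t (Suc i)) \<omega>)\<^sup>2 * (t (Suc i) - t i))"
    proof (rule has_bochner_integral_step)
      show "t i \<le> t (Suc i)" if "i < n" for i using t(3)[OF that] by simp
      show "(H s \<omega>)\<^sup>2 = (H (t (Suc i)) \<omega>)\<^sup>2" if "i < n" "t i < s" "s \<le> t (Suc i)" for i s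
        by (simp only: grid(1)[OF that])
    qed
    then have "(LBINT s:{0..T}. (H s \<omega>)\<^sup>2) = (\<Sum>i<n. x \<omega> i)"
      by (simp add: has_bochner_integral_iff set_lebesgue_integral_def t x_def)
    then have "(\<Sum>i\<le>j. x \<omega> i) \<le> \<delta>" if "j < n" for j
      using H sum_mono2[of "{..<n}" "{..j}" "x \<omega>"] x0 that by fastforce
    then have "k j \<omega> = H (t (Suc j)) \<omega>" if "j < n" for j
      using that by (simp add: k_def)
    then have "I' u \<omega> = I (t (idx u)) \<omega>"
      using idx[OF u] unfolding I'_def by (subst grid(4)) auto
    then show "I' u \<omega> = I u \<omega>" using idx[OF u] by simp
  qed
qed

end

section \<open>Convergence in probability\<close>

lemma set_integrable_square_diff:
  fixes f g :: "real \<Rightarrow> real"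
  assumes [measurable]: "f \<in> borel_measurable borel" and f: "\<And>s. \<bar>f s\<bar> \<le> C" and g: "continuous_on {0..T} g"
  shows "set_integrable lborel {0..T} (\<lambda>s. (f s - g s)\<^sup>2)"
proof -
  have "compact (g ` {0..T})" by (rule compact_continuous_image[OF g]) simp
  then have "bounded (g ` {0..T})" by (rule compact_imp_bounded)
  then obtain K where "\<forall>x\<in>g ` {0..T}. norm x \<le> K" unfolding bounded_iff by (rule exE)
  then have K: "\<bar>g s\<bar> \<le> K" if "s \<in> {0..T}" for s using that by simp
  have [measurable]: "(\<lambda>s. indicator {0..T} s * g s) \<in> borel_measurable borel"
    using borel_measurable_continuous_on_indicator[of "{0..T}" g] g by simp
  have "(\<lambda>s. indicator {0..T} s * (f s - indicator {0..T} s * g s)\<^sup>2) \<in> borel_measurable lborel"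
    by measurable
  moreover have "indicator {0..T} s * (f s - indicator {0..T} s * g s)\<^sup>2 = indicator {0..T} s * (f s - g s)\<^sup>2" for s
    by (simp add: indicator_def)
  ultimately have m: "(\<lambda>s. indicator {0..T} s * (f s - g s)\<^sup>2) \<in> borel_measurable lborel" by simp
  have "integrable lborel (\<lambda>s. indicator {0..T} s * (f s - g s)\<^sup>2)"
  proof (rule Bochner_Integration.integrable_bound[where f = "\<lambda>s. indicator {0..T} s * (C + K)\<^sup>2"])
    show "(\<lambda>s. indicator {0..T} s * (f s - g s)\<^sup>2) \<in> borel_measurable lborel" by (rule m)
    show "integrable lborel (\<lambda>s. indicator {0..T} s * (C + K)\<^sup>2)"
      by (intro integrable_mult_left integrable_real_indicator) (auto simp: emeasure_lborel_Icc_eq)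
    have "\<bar>f s - g s\<bar> \<le> C + K" if "s \<in> {0..T}" for s
      using f[of s] K[OF that] by linarith
    then have "(f s - g s)\<^sup>2 \<le> (C + K)\<^sup>2" if "s \<in> {0..T}" for s
      using power_mono[of "\<bar>f s - g s\<bar>" "C + K" 2] that by simp
    then show "AE s in lborel. norm (indicator {0..T} s * (f s - g s)\<^sup>2) \<le> norm (indicator {0..T} s * (C + K)\<^sup>2)"
      by (intro AE_I2) (simp add: indicator_def)
  qed
  then show ?thesis by (simp add: set_integrable_def)
qed

lemma set_integral_square_triangle:
  fixes f g h :: "real \<Rightarrow> real"
  assumes "set_integrable lborel A (\<lambda>s. (f s - h s)\<^sup>2)" "set_integrable lborel A (\<lambda>s. (g s - h s)\<^sup>2)"
    and "set_integrable lborel A (\<lambda>s. (f s - g s)\<^sup>2)"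
  shows "(LBINT s:A. (f s - g s)\<^sup>2) \<le> 2 * (LBINT s:A. (f s - h s)\<^sup>2) + 2 * (LBINT s:A. (g s - h s)\<^sup>2)"
proof -
  have "(LBINT s:A. (f s - g s)\<^sup>2) \<le> (LBINT s:A. 2 * (f s - h s)\<^sup>2 + 2 * (g s - h s)\<^sup>2)"
  proof (rule set_integral_mono)
    show "set_integrable lborel A (\<lambda>s. 2 * (f s - h s)\<^sup>2 + 2 * (g s - h s)\<^sup>2)"
      using assms by (intro set_integral_add) auto
    fix s
    have "2 * (f s - h s)\<^sup>2 + 2 * (g s - h s)\<^sup>2 - (f s - g s)\<^sup>2 = (f s - h s + (g s - h s))\<^sup>2"
      by (simp add: power2_eq_square algebra_simps)
    then show "(f s - g s)\<^sup>2 \<le> 2 * (f s - h s)\<^sup>2 + 2 * (g s - h s)\<^sup>2"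
      using zero_le_power2[of "f s - h s + (g s - h s)"] by linarith
  qed fact
  also have "\<dots> = 2 * (LBINT s:A. (f s - h s)\<^sup>2) + 2 * (LBINT s:A. (g s - h s)\<^sup>2)"
    using assms by (subst set_integral_add) auto
  finally show ?thesis .
qed

lemma ex_rat_seq:
  fixes u T :: real
  assumes "u \<in> {0..T}" "0 < T"
  obtains q where "\<And>k. q k \<in> \<rat> \<inter> {0..T}" "q \<longlonglongrightarrow> u"
proof -
  have "\<exists>x\<in>\<rat>. max 0 (u - 1 / real (Suc k)) < x \<and> x < min T (u + 1 / real (Suc k))" for k
  proof (rule Rats_dense_in_real)
    have "1 / real (Suc k) > 0" by simp
    then show "max 0 (u - 1 / real (Suc k)) < min T (u + 1 / real (Suc k))"
      using assms unfolding max_less_iff_conj min_less_iff_conj atLeastAtMost_iff by linarith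
  qed
  then obtain q where q: "\<And>k. q k \<in> \<rat>" "\<And>k. max 0 (u - 1 / real (Suc k)) < q k" "\<And>k. q k < min T (u + 1 / real (Suc k))"
    by metis
  show ?thesis
  proof (rule that)
    show "q k \<in> \<rat> \<inter> {0..T}" for k using q[of k] by (simp add: less_imp_le)
    have "\<bar>q k - u\<bar> \<le> 1 / real (Suc k)" for k
      using q(2,3)[of k] by simp linarith
    then have "(\<lambda>k. q k - u) \<longlonglongrightarrow> 0"
      by (intro Lim_null_comparison[OF _ LIMSEQ_Suc[OF lim_1_over_n]]) auto
    then show "q \<longlonglongrightarrow> u" by (simp add: LIM_zero_iff)
  qed
qed

text \<open>The good events for the Euler scheme impose their bounds at rational times only, which
  makes them countable intersections and hence measurable. Continuity of the path then extends the
  bounds to all times.\<close>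

lemma continuous_bound_from_rats:
  fixes f :: "real \<Rightarrow> real"
  assumes f: "continuous_on {0..T} f" and T: "0 < T"
    and b: "\<And>q. q \<in> \<rat> \<inter> {0..T} \<Longrightarrow> \<bar>f q\<bar> \<le> K" and u: "u \<in> {0..T}"
  shows "\<bar>f u\<bar> \<le> K"
proof -
  obtain q where q: "\<And>k. q k \<in> \<rat> \<inter> {0..T}" "q \<longlonglongrightarrow> u" using ex_rat_seq[OF u T] by blast
  have "(\<lambda>k. f (q k)) \<longlonglongrightarrow> f u"
    using continuous_on_tendsto_compose[OF f q(2) u] q(1) by simp
  then have "(\<lambda>k. \<bar>f (q k)\<bar>) \<longlonglongrightarrow> \<bar>f u\<bar>" by (rule tendsto_rabs)
  then show ?thesis by (rule LIMSEQ_le_const2) (use b q(1) in blast)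
qed

text \<open>The condition \<open>\<bar>u - v\<bar> < c\<close> is open, so rational approximations
  of \<open>u\<close> and \<open>v\<close> eventually satisfy it too.\<close>

lemma continuous_modulus_from_rats:
  fixes f :: "real \<Rightarrow> real"
  assumes f: "continuous_on {0..T} f" and T: "0 < T"
    and b: "\<And>q q'. q \<in> \<rat> \<inter> {0..T} \<Longrightarrow> q' \<in> \<rat> \<inter> {0..T} \<Longrightarrow> \<bar>q - q'\<bar> < c \<Longrightarrow> \<bar>f q - f q'\<bar> \<le> K"
    and u: "u \<in> {0..T}" and v: "v \<in> {0..T}" and uv: "\<bar>u - v\<bar> < c"
  shows "\<bar>f u - f v\<bar> \<le> K"
proof -
  obtain q where q: "\<And>k. q k \<in> \<rat> \<inter> {0..T}" "q \<longlonglongrightarrow> u" using ex_rat_seq[OF u T] by blast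
  obtain q' where q': "\<And>k. q' k \<in> \<rat> \<inter> {0..T}" "q' \<longlonglongrightarrow> v" using ex_rat_seq[OF v T] by blast
  have "(\<lambda>k. f (q k)) \<longlonglongrightarrow> f u" "(\<lambda>k. f (q' k)) \<longlonglongrightarrow> f v"
    using continuous_on_tendsto_compose[OF f q(2) u] continuous_on_tendsto_compose[OF f q'(2) v] q(1) q'(1) by auto
  then have lim: "(\<lambda>k. \<bar>f (q k) - f (q' k)\<bar>) \<longlonglongrightarrow> \<bar>f u - f v\<bar>" by (intro tendsto_intros)
  have "(\<lambda>k. \<bar>q k - q' k\<bar>) \<longlonglongrightarrow> \<bar>u - v\<bar>" using q q' by (intro tendsto_intros)
  then have "\<forall>\<^sub>F k in sequentially. \<bar>q k - q' k\<bar> < c" using uv by (rule order_tendstoD)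
  then have "\<forall>\<^sub>F k in sequentially. \<bar>f (q k) - f (q' k)\<bar> \<le> K"
    by eventually_elim (use b q(1) q'(1) in blast)
  then show ?thesis using lim by (intro tendsto_upperbound) auto
qed

section \<open>A calculus of convergence in probability\<close>

context filtered_bm
begin

text \<open>Convergence to $0$ in probability, phrased with an exceptional event so that the functions
  $X_n$ need not be measurable.\<close>

definition vanishes :: "(nat \<Rightarrow> 'a \<Rightarrow> real) \<Rightarrow> bool" where
  "vanishes X \<longleftrightarrow> (\<forall>\<epsilon>>0. \<forall>\<^sub>F n in sequentially. \<exists>A\<in>events. prob A < \<epsilon> \<and> (\<forall>\<omega>\<in>space N - A. \<bar>X n \<omega>\<bar> \<le> \<epsilon>))"

lemma vanishesD: "vanishes X \<Longrightarrow> 0 < \<epsilon> \<Longrightarrow>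
    \<forall>\<^sub>F n in sequentially. \<exists>A\<in>events. prob A < \<epsilon> \<and> (\<forall>\<omega>\<in>space N - A. \<bar>X n \<omega>\<bar> \<le> \<epsilon>)"
  by (simp add: vanishes_def)

lemma prob_Un_less:
  assumes "A \<in> events" "B \<in> events" "prob A < a" "prob B < b" shows "prob (A \<union> B) < a + b"
  using measure_Un_le[of A N B] assms by linarith

lemma prob_Un_null: "A \<in> events \<Longrightarrow> B \<in> null_sets N \<Longrightarrow> prob (A \<union> B) = prob A"
  by (simp add: measure_Un_null_set)

lemma vanishes_converges_in_prob:
  assumes "converges_in_prob N X Y"
  shows "vanishes (\<lambda>n \<omega>. X n \<omega> - Y \<omega>)"
  unfolding vanishes_def
proof (intro allI impI)
  fix \<epsilon> :: real assume \<epsilon>: "0 < \<epsilon>"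
  have [measurable]: "X n \<in> borel_measurable N" "Y \<in> borel_measurable N" for n
    using assms by (auto simp: converges_in_prob_def)
  have "(\<lambda>n. prob {\<omega> \<in> space N. \<bar>X n \<omega> - Y \<omega>\<bar> > \<epsilon>}) \<longlonglongrightarrow> 0"
    using assms \<epsilon> by (simp add: converges_in_prob_def)
  then have "\<forall>\<^sub>F n in sequentially. prob {\<omega> \<in> space N. \<bar>X n \<omega> - Y \<omega>\<bar> > \<epsilon>} < \<epsilon>"
    using \<epsilon> by (rule order_tendstoD)
  then show "\<forall>\<^sub>F n in sequentially. \<exists>A\<in>events. prob A < \<epsilon> \<and> (\<forall>\<omega>\<in>space N - A. \<bar>X n \<omega> - Y \<omega>\<bar> \<le> \<epsilon>)"
  proof eventually_elim
    case (elim n)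
    then show ?case
      by (intro bexI[of _ "{\<omega> \<in> space N. \<bar>X n \<omega> - Y \<omega>\<bar> > \<epsilon>}"]) auto
  qed
qed

lemma vanishes_dominated:
  assumes X: "vanishes X" and Y: "\<And>n. AE \<omega> in N. \<bar>Y n \<omega>\<bar> \<le> C * \<bar>X n \<omega>\<bar>" and C: "0 \<le> C"
  shows "vanishes Y"
  unfolding vanishes_def
proof (intro allI impI)
  fix \<epsilon> :: real assume \<epsilon>: "0 < \<epsilon>"
  define e where "e = \<epsilon> / (C + 1)"
  have e: "0 < e" "e \<le> \<epsilon>" "C * e \<le> \<epsilon>"
    using \<epsilon> C by (auto simp: e_def field_simps)
  from vanishesD[OF X e(1)]
  show "\<forall>\<^sub>F n in sequentially. \<exists>A\<in>events. prob A < \<epsilon> \<and> (\<forall>\<omega>\<in>space N - A. \<bar>Y n \<omega>\<bar> \<le> \<epsilon>)"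
  proof eventually_elim
    case (elim n)
    then obtain A where A: "A \<in> events" "prob A < e" "\<And>\<omega>. \<omega> \<in> space N - A \<Longrightarrow> \<bar>X n \<omega>\<bar> \<le> e" by blast
    obtain B where B: "{\<omega>\<in>space N. \<not> \<bar>Y n \<omega>\<bar> \<le> C * \<bar>X n \<omega>\<bar>} \<subseteq> B" "B \<in> null_sets N"
      using Y[of n] unfolding eventually_ae_filter by blast
    show ?case
    proof (intro bexI[of _ "A \<union> B"] conjI ballI)
      show "prob (A \<union> B) < \<epsilon>" using A B e by (simp add: prob_Un_null)
      show "A \<union> B \<in> events" using A B by blast
      fix \<omega> assume \<omega>: "\<omega> \<in> space N - (A \<union> B)"
      then have "\<bar>Y n \<omega>\<bar> \<le> C * \<bar>X n \<omega>\<bar>" using B by blast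
      also have "\<dots> \<le> C * e" using A(3)[of \<omega>] \<omega> C by (intro mult_left_mono) auto
      finally show "\<bar>Y n \<omega>\<bar> \<le> \<epsilon>" using e by simp
    qed
  qed
qed

lemma vanishes_add:
  assumes X: "vanishes X" and Y: "vanishes Y"
  shows "vanishes (\<lambda>n \<omega>. X n \<omega> + Y n \<omega>)"
  unfolding vanishes_def
proof (intro allI impI)
  fix \<epsilon> :: real assume "0 < \<epsilon>"
  then have "0 < \<epsilon> / 2" by simp
  from vanishesD[OF X this] vanishesD[OF Y this]
  show "\<forall>\<^sub>F n in sequentially. \<exists>A\<in>events. prob A < \<epsilon> \<and> (\<forall>\<omega>\<in>space N - A. \<bar>X n \<omega> + Y n \<omega>\<bar> \<le> \<epsilon>)"
  proof eventually_elim
    case (elim n)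
    from elim(1) obtain A where A: "A \<in> events" "prob A < \<epsilon> / 2" "\<And>\<omega>. \<omega> \<in> space N - A \<Longrightarrow> \<bar>X n \<omega>\<bar> \<le> \<epsilon> / 2" by blast
    from elim(2) obtain B where B: "B \<in> events" "prob B < \<epsilon> / 2" "\<And>\<omega>. \<omega> \<in> space N - B \<Longrightarrow> \<bar>Y n \<omega>\<bar> \<le> \<epsilon> / 2" by blast
    show ?case
    proof (intro bexI[of _ "A \<union> B"] conjI ballI)
      show "prob (A \<union> B) < \<epsilon>" using prob_Un_less[OF A(1) B(1) A(2) B(2)] by simp
      show "A \<union> B \<in> events" using A B by blast
      fix \<omega> assume \<omega>: "\<omega> \<in> space N - (A \<union> B)"
      then have "\<bar>X n \<omega>\<bar> \<le> \<epsilon> / 2" "\<bar>Y n \<omega>\<bar> \<le> \<epsilon> / 2" using A(3) B(3) by auto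
      then show "\<bar>X n \<omega> + Y n \<omega>\<bar> \<le> \<epsilon>" by linarith
    qed
  qed
qed

text \<open>Take exceptional sets \<open>A k\<close> for accuracies \<open>e k\<close> tending to
  \<open>0\<close>. A tail intersection has probability at most every later \<open>e k\<close>, so
  it is null; hence almost every \<omega> avoids \<open>A k\<close> for infinitely many
  \<open>k\<close>, and along these \<open>\<bar>X \<omega>\<bar> \<le> e k\<close>. Intersections
  of tails take the place of a Borel-Cantelli argument, so no summability enters.\<close>

lemma vanishes_const:
  assumes X: "vanishes (\<lambda>n. X)"
  shows "AE \<omega> in N. X \<omega> = 0"
proof -
  have ex: "\<exists>A\<in>events. prob A < \<epsilon> \<and> (\<forall>\<omega>\<in>space N - A. \<bar>X \<omega>\<bar> \<le> \<epsilon>)" if "\<epsilon> > 0" for \<epsilon>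
    using eventually_happens'[OF sequentially_bot vanishesD[OF X that]] by blast
  define e where "e = (\<lambda>k::nat. 1 / real (Suc k))"
  have e: "0 < e k" for k by (simp add: e_def)
  have "\<forall>k. \<exists>A\<in>events. prob A < e k \<and> (\<forall>\<omega>\<in>space N - A. \<bar>X \<omega>\<bar> \<le> e k)" using ex e by blast
  then obtain A where A: "\<And>k. A k \<in> events" "\<And>k. prob (A k) < e k" "\<And>k \<omega>. \<omega> \<in> space N - A k \<Longrightarrow> \<bar>X \<omega>\<bar> \<le> e k"
    by metis
  have e0: "e \<longlonglongrightarrow> 0" unfolding e_def by (rule LIMSEQ_Suc[OF lim_1_over_n])
  have null: "(\<Inter>k\<in>{j..}. A k) \<in> null_sets N" for j
  proof -
    have ev: "(\<Inter>k\<in>{j..}. A k) \<in> events" using A(1) by (intro sets.countable_INT) auto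
    have "prob (\<Inter>k\<in>{j..}. A k) \<le> e k" if "j \<le> k" for k
    proof -
      have "prob (\<Inter>k\<in>{j..}. A k) \<le> prob (A k)"
        using that by (intro finite_measure_mono A(1)) auto
      then show ?thesis using A(2)[of k] by simp
    qed
    then have "prob (\<Inter>k\<in>{j..}. A k) \<le> 0"
      by (intro LIMSEQ_le_const[OF e0]) blast
    then have "prob (\<Inter>k\<in>{j..}. A k) = 0" using measure_nonneg by (rule antisym)
    then show ?thesis using ev by (simp add: emeasure_eq_measure null_setsI)
  qed
  have "AE \<omega> in N. \<forall>j. \<omega> \<notin> (\<Inter>k\<in>{j..}. A k)"
    unfolding AE_all_countable using null AE_not_in by blast
  then show ?thesis
  proof (rule AE_mp, intro AE_I2 impI)
    fix \<omega> assume \<omega>: "\<omega> \<in> space N" "\<forall>j. \<omega> \<notin> (\<Inter>k\<in>{j..}. A k)"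
    have "\<bar>X \<omega>\<bar> \<le> \<epsilon>" if pos: "\<epsilon> > 0" for \<epsilon>
    proof -
      obtain j where j: "\<And>k. k \<ge> j \<Longrightarrow> e k < \<epsilon>"
        using order_tendstoD(2)[OF e0 pos] unfolding eventually_sequentially by blast
      obtain k where k: "k \<ge> j" "\<omega> \<notin> A k" using \<omega>(2)[rule_format, of j] by auto
      have "\<bar>X \<omega>\<bar> \<le> e k" by (rule A(3)) (use k \<omega> in blast)
      then show ?thesis using j[OF k(1)] by simp
    qed
    then have "\<bar>X \<omega>\<bar> \<le> 0" by (rule field_le_epsilon[of _ 0, simplified])
    then show "X \<omega> = 0" by simp
  qed
qed

lemma prob_square_bound:
  assumes [measurable]: "f \<in> borel_measurable N" and "integrable N (\<lambda>\<omega>. (f \<omega>)\<^sup>2)" "0 < \<epsilon>"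
  shows "prob {\<omega>\<in>space N. \<epsilon> < \<bar>f \<omega>\<bar>} \<le> expectation (\<lambda>\<omega>. (f \<omega>)\<^sup>2) / \<epsilon>\<^sup>2"
proof -
  have "prob {\<omega>\<in>space N. \<epsilon> < \<bar>f \<omega>\<bar>} \<le> prob {\<omega>\<in>space N. (f \<omega>)\<^sup>2 \<ge> \<epsilon>\<^sup>2}"
    using assms by (intro finite_measure_mono) (auto simp: abs_le_square_iff[symmetric])
  also have "\<dots> \<le> expectation (\<lambda>\<omega>. (f \<omega>)\<^sup>2) / \<epsilon>\<^sup>2"
    using assms by (intro integral_Markov_inequality_measure[where A = "space N"]) auto
  finally show ?thesis .
qed

text \<open>The energy is small only in probability, so the isometry does not apply directly. The
  truncated integral of \<open>elem_truncate\<close> has second moment at most \<delta> and agrees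
  with \<open>I n T\<close> off the event of large energy; Chebyshev's inequality handles the
  rest.\<close>

lemma vanishes_elem:
  assumes el: "\<And>k. elem (H k) (I k)" and T: "0 \<le> T"
    and v: "vanishes (\<lambda>k \<omega>. LBINT s:{0..T}. (H k s \<omega>)\<^sup>2)"
  shows "vanishes (\<lambda>k. I k T)"
  unfolding vanishes_def
proof (intro allI impI)
  fix \<epsilon> :: real assume \<epsilon>: "0 < \<epsilon>"
  \<comment> \<open>Chebyshev's inequality then costs
    \<open>\<delta> / \<epsilon>\<^sup>2 = \<epsilon> / 3\<close>, less than half of the budget
    \<epsilon>; the other half pays for the event of large energy.\<close>
  define \<delta> where "\<delta> = \<epsilon> * \<epsilon>\<^sup>2 / 3"
  have \<delta>: "0 < \<delta>" "\<delta> / \<epsilon>\<^sup>2 = \<epsilon> / 3" using \<epsilon> by (auto simp: \<delta>_def field_simps)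
  have "0 < min \<delta> (\<epsilon> / 2)" using \<delta> \<epsilon> by simp
  from vanishesD[OF v this]
  show "\<forall>\<^sub>F n in sequentially. \<exists>A\<in>events. prob A < \<epsilon> \<and> (\<forall>\<omega>\<in>space N - A. \<bar>I n T \<omega>\<bar> \<le> \<epsilon>)"
  proof eventually_elim
    case (elim n)
    then obtain A where A: "A \<in> events" "prob A < min \<delta> (\<epsilon> / 2)"
      "\<And>\<omega>. \<omega> \<in> space N - A \<Longrightarrow> \<bar>LBINT s:{0..T}. (H n s \<omega>)\<^sup>2\<bar> \<le> min \<delta> (\<epsilon> / 2)" by blast
    obtain I' where I': "I' T \<in> borel_measurable (F T)" "integrable N (\<lambda>\<omega>. (I' T \<omega>)\<^sup>2)"
      "expectation (\<lambda>\<omega>. (I' T \<omega>)\<^sup>2) \<le> \<delta>"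
      "\<And>\<omega>. (LBINT s:{0..T}. (H n s \<omega>)\<^sup>2) \<le> \<delta> \<Longrightarrow> I' T \<omega> = I n T \<omega>"
      proof -
      have *: "finite {T}" "{T} \<subseteq> {0..T}" "0 \<le> \<delta>" using T \<delta> by auto
      show thesis
      proof (rule elem_truncate[OF el[of n] T *])
        fix J assume J: "\<And>u. u \<in> {T} \<Longrightarrow> J u \<in> borel_measurable (F u)"
          "\<And>u. u \<in> {T} \<Longrightarrow> integrable N (\<lambda>\<omega>. (J u \<omega>)\<^sup>2)"
          "\<And>u. u \<in> {T} \<Longrightarrow> expectation (\<lambda>\<omega>. (J u \<omega>)\<^sup>2) \<le> \<delta>"
          "\<And>u \<omega>. u \<in> {T} \<Longrightarrow> (LBINT s:{0..T}. (H n s \<omega>)\<^sup>2) \<le> \<delta> \<Longrightarrow> J u \<omega> = I n u \<omega>"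
        show thesis using that[of J] J[OF singletonI] by blast
      qed
    qed
    have m[measurable]: "I' T \<in> borel_measurable N" using measurable_F_N[OF I'(1) T] .
    define B where "B = {\<omega>\<in>space N. \<epsilon> < \<bar>I' T \<omega>\<bar>}"
    have B: "B \<in> events" unfolding B_def by measurable
    have "prob B \<le> expectation (\<lambda>\<omega>. (I' T \<omega>)\<^sup>2) / \<epsilon>\<^sup>2"
      unfolding B_def by (rule prob_square_bound[OF m I'(2) \<epsilon>])
    also have "\<dots> \<le> \<delta> / \<epsilon>\<^sup>2" using I'(3) by (intro divide_right_mono) auto
    also have "\<dots> < \<epsilon> / 2" using \<delta> \<epsilon> by simp
    finally have PB: "prob B < \<epsilon> / 2" .
    show ?case
    proof (intro bexI[of _ "A \<union> B"] conjI ballI)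
      show "prob (A \<union> B) < \<epsilon>" using prob_Un_less[OF A(1) B _ PB, of "\<epsilon> / 2"] A(2) by simp
      show "A \<union> B \<in> events" using A B by blast
      fix \<omega> assume \<omega>: "\<omega> \<in> space N - (A \<union> B)"
      then have "(LBINT s:{0..T}. (H n s \<omega>)\<^sup>2) \<le> \<delta>" using A(3)[of \<omega>] by auto
      then have "I' T \<omega> = I n T \<omega>" by (rule I'(4))
      moreover have "\<not> \<epsilon> < \<bar>I' T \<omega>\<bar>" using \<omega> by (auto simp: B_def)
      ultimately show "\<bar>I n T \<omega>\<bar> \<le> \<epsilon>" by simp
    qed
  qed
qed

lemma elem_bounded:
  "elem H I \<Longrightarrow> (\<lambda>s. H s \<omega>) \<in> borel_measurable borel \<and> (\<exists>C. \<forall>s. \<bar>H s \<omega>\<bar> \<le> C)"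
proof (induction rule: elem.induct)
  case elem_zero
  then show ?case by auto
next
  case (elem_step H I a b \<xi> C)
  then have [measurable]: "(\<lambda>s. H s \<omega>) \<in> borel_measurable borel" by simp
  from elem_step obtain C' where C': "\<And>s. \<bar>H s \<omega>\<bar> \<le> C'" by blast
  \<comment> \<open>The bound uses \<open>\<bar>\<xi> \<omega>\<bar>\<close> rather than
    \<open>C\<close>, which is valid only on \<open>space N\<close>.\<close>
  have "\<bar>H s \<omega> + \<xi> \<omega> * indicator {a<..b} s\<bar> \<le> C' + \<bar>\<xi> \<omega>\<bar>" for s
    using C'[of s] by (cases "s \<in> {a<..b}") auto
  moreover have "(\<lambda>s. H s \<omega> + \<xi> \<omega> * indicator {a<..b} s) \<in> borel_measurable borel" by measurable
  ultimately show ?case by blast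
qed

lemma elem_simple_process:
  assumes F: "\<And>t. 0 \<le> t \<Longrightarrow> FF (ennreal t) = F t" and si: "simple_integrand N FF t n tp \<xi>"
  shows "\<exists>I. elem (simple_process n tp \<xi>) I \<and> I t = simple_ito_integral W n tp \<xi>"
proof -
  have tp: "tp 0 = 0" "tp n = t" "strict_mono_on {..n} tp" and
    xi: "\<And>i. i < n \<Longrightarrow> \<xi> i \<in> borel_measurable (FF (ennreal (tp i)))"
    "\<And>i. i < n \<Longrightarrow> \<exists>C. \<forall>\<omega>\<in>space N. \<bar>\<xi> i \<omega>\<bar> \<le> C"
    using si by (auto simp: simple_integrand_def)
  have mono: "tp i \<le> tp j" if "i \<le> j" "j \<le> n" for i j
    using strict_mono_onD[OF tp(3), of i j] that by (cases "i = j") auto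
  define I where "I = (\<lambda>u \<omega>. \<Sum>i<n. \<xi> i \<omega> * (W (min (tp (Suc i)) u) \<omega> - W (min (tp i) u) \<omega>))"
  have "elem (\<lambda>s \<omega>. \<Sum>i<n. \<xi> i \<omega> * indicator {tp i<..tp (Suc i)} s) I"
    unfolding I_def
  proof (rule elem_sum)
    fix i assume "i \<in> {..<n}"
    then have i: "i < n" by simp
    have 0: "0 \<le> tp i" using mono[of 0 i] tp i by simp
    obtain C where C: "\<And>\<omega>. \<omega> \<in> space N \<Longrightarrow> \<bar>\<xi> i \<omega>\<bar> \<le> C" using xi(2)[OF i] by blast
    show "elem (\<lambda>s \<omega>. \<xi> i \<omega> * indicator {tp i<..tp (Suc i)} s)
      (\<lambda>u \<omega>. \<xi> i \<omega> * (W (min (tp (Suc i)) u) \<omega> - W (min (tp i) u) \<omega>))"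
      by (rule elem_single[OF 0 _ _ C]) (use mono i xi(1)[OF i] F[OF 0] in auto)
  qed simp
  moreover have "(\<lambda>s \<omega>. \<Sum>i<n. \<xi> i \<omega> * indicator {tp i<..tp (Suc i)} s) = simple_process n tp \<xi>"
    by (intro ext) (simp add: simple_process_def)
  moreover have "I t = simple_ito_integral W n tp \<xi>"
  proof
    fix \<omega>
    have "tp i \<le> t" "tp (Suc i) \<le> t" if "i < n" for i using mono[of i n] mono[of "Suc i" n] tp that by auto
    then show "I t \<omega> = simple_ito_integral W n tp \<xi> \<omega>"
      unfolding I_def simple_ito_integral_def by (intro sum.cong) (auto simp: min_absorb1)
  qed
  ultimately show ?thesis by metis
qed

lemma is_ito_integral_approx:
  assumes F: "\<And>t. 0 \<le> t \<Longrightarrow> FF (ennreal t) = F t" and J: "is_ito_integral N FF W G t J"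
  obtains H I where "\<And>k. elem (H k) (I k)" "vanishes (\<lambda>k \<omega>. LBINT s:{0..t}. (H k s \<omega> - G s \<omega>)\<^sup>2)"
    "vanishes (\<lambda>k \<omega>. I k t \<omega> - J \<omega>)"
proof -
  from J obtain n tp \<xi> where s: "\<And>k. simple_integrand N FF t (n k) (tp k) (\<xi> k)"
    and c1: "converges_in_prob N (\<lambda>k \<omega>. LBINT s:{0..t}. (simple_process (n k) (tp k) (\<xi> k) s \<omega> - G s \<omega>)\<^sup>2) (\<lambda>_. 0)"
    and c2: "converges_in_prob N (\<lambda>k. simple_ito_integral W (n k) (tp k) (\<xi> k)) J"
    unfolding is_ito_integral_def by blast
  obtain I where I: "\<And>k. elem (simple_process (n k) (tp k) (\<xi> k)) (I k)" "\<And>k. I k t = simple_ito_integral W (n k) (tp k) (\<xi> k)"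
    using elem_simple_process[OF F s] by metis
  show ?thesis
    using that[of "\<lambda>k. simple_process (n k) (tp k) (\<xi> k)" I] I
      vanishes_converges_in_prob[OF c1] vanishes_converges_in_prob[OF c2] by simp
qed

text \<open>The equation provides a separate Ito integral at each time, with its own approximating
  sequence. The sequence chosen for \<open>T\<close> serves all earlier \<open>t\<close>: on the
  interval up to \<open>t\<close> it differs from the sequence for \<open>t\<close> by an elementary
  integrand of vanishing energy, so by \<open>vanishes_elem\<close> the two integrals have the same
  limit. The Euler comparison uses this common sequence at all grid points at once.\<close>

lemma sde_approx:
  assumes F: "\<And>t. 0 \<le> t \<Longrightarrow> FF (ennreal t) = F t"
    and Z: "sde_solution N FF W (\<lambda>x. m * x) (\<lambda>x. sg * x) z Z" and T: "0 \<le> T"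
  obtains H I where "\<And>k. elem (H k) (I k)"
    "vanishes (\<lambda>k \<omega>. LBINT s:{0..T}. (H k s \<omega> - sg * Z s \<omega>)\<^sup>2)"
    "\<And>t. t \<in> {0..T} \<Longrightarrow> vanishes (\<lambda>k \<omega>. I k t \<omega> - (Z t \<omega> - z - (LBINT s:{0..t}. m * Z s \<omega>)))"
proof -
  have cont: "AE \<omega> in N. continuous_on {0..} (\<lambda>t. Z t \<omega>)" using Z by (simp add: sde_solution_def)
  have ex: "\<exists>J. is_ito_integral N FF W (\<lambda>s \<omega>. sg * Z s \<omega>) t J \<and>
        (AE \<omega> in N. Z t \<omega> = z + (LBINT s:{0..t}. m * Z s \<omega>) + J \<omega>)" if "0 \<le> t" for t
    using Z that unfolding sde_solution_def by (fast elim: AE_mp)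
  obtain J where "is_ito_integral N FF W (\<lambda>s \<omega>. sg * Z s \<omega>) T J" using ex[OF T] by blast
  from is_ito_integral_approx[OF F this] obtain H I where
    HI: "\<And>k. elem (H k) (I k)" "vanishes (\<lambda>k \<omega>. LBINT s:{0..T}. (H k s \<omega> - sg * Z s \<omega>)\<^sup>2)" by blast
  show ?thesis
  proof (rule that[OF HI])
    fix t assume t: "t \<in> {0..T}"
    obtain J where J: "is_ito_integral N FF W (\<lambda>s \<omega>. sg * Z s \<omega>) t J"
        "AE \<omega> in N. Z t \<omega> = z + (LBINT s:{0..t}. m * Z s \<omega>) + J \<omega>" using ex[of t] t by auto
    obtain H' I' where
      HI': "\<And>k. elem (H' k) (I' k)" "vanishes (\<lambda>k \<omega>. LBINT s:{0..t}. (H' k s \<omega> - sg * Z s \<omega>)\<^sup>2)"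
       "vanishes (\<lambda>k \<omega>. I' k t \<omega> - J \<omega>)"
      using is_ito_integral_approx[OF F J(1)] by blast
    have int: "set_integrable lborel {0..r} (\<lambda>s. (G s \<omega> - sg * Z s \<omega>)\<^sup>2)"
      if G: "elem G K" and c: "continuous_on {0..} (\<lambda>t. Z t \<omega>)" for G K r \<omega>
    proof -
      obtain C where "(\<lambda>s. G s \<omega>) \<in> borel_measurable borel" "\<And>s. \<bar>G s \<omega>\<bar> \<le> C"
        using elem_bounded[OF G, of \<omega>] by blast
      then show ?thesis
        by (rule set_integrable_square_diff) (intro continuous_intros continuous_on_subset[OF c], auto)
    qed
    have el: "elem (\<lambda>s \<omega>. - 1 * H' k s \<omega> + H k s \<omega>) (\<lambda>u \<omega>. - 1 * I' k u \<omega> + I k u \<omega>)" for k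
      by (intro elem_add elem_cmult HI HI')
    have "vanishes (\<lambda>k \<omega>. - 1 * I' k t \<omega> + I k t \<omega>)"
    proof (rule vanishes_elem[OF el])
      show "0 \<le> t" using t by simp
      have "vanishes (\<lambda>k \<omega>. \<bar>LBINT s:{0..T}. (H k s \<omega> - sg * Z s \<omega>)\<^sup>2\<bar> + \<bar>LBINT s:{0..t}. (H' k s \<omega> - sg * Z s \<omega>)\<^sup>2\<bar>)"
        by (intro vanishes_add vanishes_dominated[OF HI(2), of _ 1] vanishes_dominated[OF HI'(2), of _ 1]) auto
      then show "vanishes (\<lambda>k \<omega>. LBINT s:{0..t}. (- 1 * H' k s \<omega> + H k s \<omega>)\<^sup>2)"
      proof (rule vanishes_dominated[where C = 2])
        fix k
        show "AE \<omega> in N. \<bar>LBINT s:{0..t}. (- 1 * H' k s \<omega> + H k s \<omega>)\<^sup>2\<bar> \<le>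
          2 * \<bar>\<bar>LBINT s:{0..T}. (H k s \<omega> - sg * Z s \<omega>)\<^sup>2\<bar> + \<bar>LBINT s:{0..t}. (H' k s \<omega> - sg * Z s \<omega>)\<^sup>2\<bar>\<bar>"
          using cont
        proof eventually_elim
          case (elim \<omega>)
          have i3: "set_integrable lborel {0..t} (\<lambda>s. (H k s \<omega> - H' k s \<omega>)\<^sup>2)"
          proof -
            obtain C where C: "(\<lambda>s. - 1 * H' k s \<omega> + H k s \<omega>) \<in> borel_measurable borel" "\<And>s. \<bar>- 1 * H' k s \<omega> + H k s \<omega>\<bar> \<le> C"
              using elem_bounded[OF el[of k], of \<omega>] by blast
            from set_integrable_square_diff[OF C, of t "\<lambda>_. 0"] show ?thesis by simp
          qed
          have "(LBINT s:{0..t}. (H k s \<omega> - H' k s \<omega>)\<^sup>2) \<le>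
            2 * (LBINT s:{0..t}. (H k s \<omega> - sg * Z s \<omega>)\<^sup>2) + 2 * (LBINT s:{0..t}. (H' k s \<omega> - sg * Z s \<omega>)\<^sup>2)"
            by (rule set_integral_square_triangle[OF int[OF HI(1) elim] int[OF HI'(1) elim] i3])
          moreover have "(LBINT s:{0..t}. (H k s \<omega> - sg * Z s \<omega>)\<^sup>2) \<le> (LBINT s:{0..T}. (H k s \<omega> - sg * Z s \<omega>)\<^sup>2)"
            using int[OF HI(1)[of k] elim, of t] int[OF HI(1)[of k] elim, of T] t
            unfolding set_lebesgue_integral_def set_integrable_def
            by (intro integral_mono) (auto simp: indicator_def)
          moreover have "0 \<le> (LBINT s:{0..t}. (H k s \<omega> - H' k s \<omega>)\<^sup>2)"
            unfolding set_lebesgue_integral_def by (intro integral_nonneg_AE) auto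
          ultimately show ?case by simp
        qed
      qed simp
    qed
    from vanishes_add[OF this HI'(3)] have "vanishes (\<lambda>k \<omega>. I k t \<omega> - J \<omega>)" by (simp add: algebra_simps)
    then show "vanishes (\<lambda>k \<omega>. I k t \<omega> - (Z t \<omega> - z - (LBINT s:{0..t}. m * Z s \<omega>)))"
    proof (rule vanishes_dominated[where C = 1])
      show "AE \<omega> in N. \<bar>I n t \<omega> - (Z t \<omega> - z - (LBINT s:{0..t}. m * Z s \<omega>))\<bar> \<le> 1 * \<bar>I n t \<omega> - J \<omega>\<bar>" for n
        using J(2) by eventually_elim simp
    qed simp
  qed
qed

end

section \<open>The Euler scheme for the linear equation\<close>

lemma discrete_gronwall:
  fixes a :: "nat \<Rightarrow> real"
  assumes "\<And>i. i \<le> n \<Longrightarrow> a i \<le> A + b * (\<Sum>j<i. a j)" and "0 \<le> b" "i \<le> n"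
  shows "a i \<le> A * (1 + b) ^ i"
proof -
  \<comment> \<open>Bounding the right-hand side of the hypothesis instead of \<open>a\<close> makes
    the induction one-step and independent of the sign of \<open>a\<close>.\<close>
  have "A + b * (\<Sum>j<i. a j) \<le> A * (1 + b) ^ i"
    using assms(3)
  proof (induction i)
    case (Suc i)
    define s where "s = A + b * (\<Sum>j<i. a j)"
    have "A + b * (\<Sum>j<Suc i. a j) = s + b * a i" by (simp add: s_def algebra_simps)
    also have "b * a i \<le> b * s" using assms(1)[of i] Suc.prems assms(2) unfolding s_def by (intro mult_left_mono) auto
    also have "s + b * s = s * (1 + b)" by (simp add: algebra_simps)
    also have "\<dots> \<le> A * (1 + b) ^ i * (1 + b)"
      using Suc assms(2) unfolding s_def by (intro mult_right_mono) auto
    finally show ?case by (simp add: algebra_simps)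
  qed simp
  then show ?thesis using assms(1)[OF assms(3)] by linarith
qed

lemma step_sum_eq:
  fixes t :: "nat \<Rightarrow> real" and c :: "nat \<Rightarrow> real"
  assumes mono: "\<And>i j. i \<le> j \<Longrightarrow> t i \<le> t j" and j: "j < n" "t j < s" "s \<le> t (Suc j)"
  shows "(\<Sum>i<n. c i * indicator {t i<..t (Suc i)} s) = c j"
proof -
  have "indicator {t i<..t (Suc i)} s = (if i = j then 1 else 0 :: real)" for i
    using mono[of "Suc i" j] mono[of "Suc j" i] j by (cases i j rule: linorder_cases) (auto simp: indicator_def)
  then have "(\<Sum>i<n. c i * indicator {t i<..t (Suc i)} s) = (\<Sum>i<n. if i = j then c i else 0)"
    by (intro sum.cong) auto
  then show ?thesis using j(1) by simp
qed

lemma square_sum3_le: "(x + y + w)\<^sup>2 \<le> 3 * x\<^sup>2 + 3 * y\<^sup>2 + 3 * w\<^sup>2" for x y w :: real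
proof -
  have "3 * x\<^sup>2 + 3 * y\<^sup>2 + 3 * w\<^sup>2 - (x + y + w)\<^sup>2 = (x - y)\<^sup>2 + (y - w)\<^sup>2 + (x - w)\<^sup>2"
    by (simp add: power2_eq_square algebra_simps)
  moreover have "0 \<le> (x - y)\<^sup>2 + (y - w)\<^sup>2 + (x - w)\<^sup>2" by simp
  ultimately show ?thesis by linarith
qed

lemma square_sum2_le: "(x + y)\<^sup>2 \<le> 2 * x\<^sup>2 + 2 * y\<^sup>2" for x y :: real
  using zero_le_power2[of "x - y"] by (simp add: power2_eq_square algebra_simps)

context filtered_bm
begin

text \<open>The error of the scheme solves the recursion of the scheme with a forcing term
  \<open>x\<close>. Its square is split into forcing, drift and martingale part; the drift is
  bounded by the Cauchy-Schwarz inequality, the martingale part is evaluated by the isometry, and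
  after the discrete Gronwall inequality the bound depends on the mesh only through the final time
  \<open>real n * \<delta>\<close>.\<close>

lemma euler_recursion_bound:
  fixes x :: "nat \<Rightarrow> 'a \<Rightarrow> real" and \<delta> m sg A :: real
  assumes \<delta>: "0 \<le> \<delta>"
    and x: "\<And>i. i \<le> n \<Longrightarrow> x i \<in> borel_measurable (F (real i * \<delta>))"
      "\<And>i. i \<le> n \<Longrightarrow> integrable N (\<lambda>\<omega>. (x i \<omega>)\<^sup>2)" "\<And>i. i \<le> n \<Longrightarrow> expectation (\<lambda>\<omega>. (x i \<omega>)\<^sup>2) \<le> A"
  defines "\<Delta> \<equiv> \<lambda>i \<omega>. W (real (Suc i) * \<delta>) \<omega> - W (real i * \<delta>) \<omega>"
  obtains D where "\<And>i \<omega>. i \<le> n \<Longrightarrow> D i \<omega> = x i \<omega> + (\<Sum>j<i. (m * \<delta> + sg * \<Delta> j \<omega>) * D j \<omega>)"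
    "D n \<in> borel_measurable N" "integrable N (\<lambda>\<omega>. (D n \<omega>)\<^sup>2)"
    "expectation (\<lambda>\<omega>. (D n \<omega>)\<^sup>2) \<le> 3 * A * exp (3 * (m\<^sup>2 * (real n * \<delta>) + sg\<^sup>2) * (real n * \<delta>))"
proof -
  \<comment> \<open>\<open>D i\<close> depends on all earlier values. Carrying the partial sum
    \<open>S\<close> as the state turns this into a primitive recursion, with
    \<open>D = x + S\<close>.\<close>
  define S where "S = rec_nat (\<lambda>\<omega>. 0) (\<lambda>i f \<omega>. f \<omega> + (m * \<delta> + sg * \<Delta> i \<omega>) * (x i \<omega> + f \<omega>))"
  have S0: "S 0 = (\<lambda>\<omega>. 0)" and S1: "S (Suc i) = (\<lambda>\<omega>. S i \<omega> + (m * \<delta> + sg * \<Delta> i \<omega>) * (x i \<omega> + S i \<omega>))" for i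
    by (simp_all add: S_def)
  define D where "D = (\<lambda>i \<omega>. x i \<omega> + S i \<omega>)"
  have S: "S i \<omega> = (\<Sum>j<i. (m * \<delta> + sg * \<Delta> j \<omega>) * D j \<omega>)" for i \<omega>
    by (induction i) (simp_all add: S0 S1 D_def)
  have pos: "0 \<le> real i * \<delta>" and le: "real i * \<delta> \<le> real (Suc i) * \<delta>" for i
    using \<delta> by (auto intro: mult_right_mono)
  have xN: "x i \<in> borel_measurable N" if "i \<le> n" for i using measurable_F_N[OF x(1)[OF that] pos] .
  have SM: "S i \<in> borel_measurable (F (real i * \<delta>)) \<and> integrable N (\<lambda>\<omega>. (S i \<omega>)\<^sup>2)" if "i \<le> n" for i
    using that
  proof (induction i)
    case 0
    then show ?case by (simp add: S0)
  next
    case (Suc i)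
    then have i: "i \<le> n" and IH: "S i \<in> borel_measurable (F (real i * \<delta>))" "integrable N (\<lambda>\<omega>. (S i \<omega>)\<^sup>2)" by auto
    have IHN: "S i \<in> borel_measurable N" using measurable_F_N[OF IH(1) pos] .
    have Dm: "D i \<in> borel_measurable (F (real i * \<delta>))" using IH(1) x(1)[OF i] unfolding D_def by measurable
    have Di: "integrable N (\<lambda>\<omega>. (D i \<omega>)\<^sup>2)" unfolding D_def by (rule integrable_square_add[OF xN[OF i] IHN x(2)[OF i] IH(2)])
    have DN: "D i \<in> borel_measurable N" using measurable_F_N[OF Dm pos] .
    have [measurable]: "\<Delta> i \<in> borel_measurable N" using W_measurable[OF pos] unfolding \<Delta>_def by measurable
    note DN[measurable]
    have DD: "integrable N (\<lambda>\<omega>. (D i \<omega> * \<Delta> i \<omega>)\<^sup>2)"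
      using has_bochner_integral_increment_square[OF pos le Dm Di] by (auto simp: has_bochner_integral_iff \<Delta>_def)
    have "integrable N (\<lambda>\<omega>. (m * \<delta> * D i \<omega> + sg * (D i \<omega> * \<Delta> i \<omega>))\<^sup>2)"
      using Di DD by (intro integrable_square_add) (auto simp: power_mult_distrib)
    from integrable_square_add[OF IHN _ IH(2) this]
    have "integrable N (\<lambda>\<omega>. (S i \<omega> + (m * \<delta> * D i \<omega> + sg * (D i \<omega> * \<Delta> i \<omega>)))\<^sup>2)"
      by measurable
    moreover have "S (Suc i) \<omega> = S i \<omega> + (m * \<delta> * D i \<omega> + sg * (D i \<omega> * \<Delta> i \<omega>))" for \<omega>
      by (simp add: S1 D_def algebra_simps)
    moreover have "S i \<in> borel_measurable (F (real (Suc i) * \<delta>))" "D i \<in> borel_measurable (F (real (Suc i) * \<delta>))"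
      "\<Delta> i \<in> borel_measurable (F (real (Suc i) * \<delta>))"
    proof -
      have "W (real (Suc i) * \<delta>) \<in> borel_measurable (F (real (Suc i) * \<delta>))"
        "W (real i * \<delta>) \<in> borel_measurable (F (real (Suc i) * \<delta>))"
        using W_adapted[OF pos] measurable_F_mono[OF W_adapted[OF pos] pos le] by blast+
      then show "\<Delta> i \<in> borel_measurable (F (real (Suc i) * \<delta>))" unfolding \<Delta>_def by (rule borel_measurable_diff)
    qed (rule measurable_F_mono[OF _ pos le], fact)+
    then have **: "(\<lambda>\<omega>. S i \<omega> + (m * \<delta> + sg * \<Delta> i \<omega>) * D i \<omega>) \<in> borel_measurable (F (real (Suc i) * \<delta>))"
      by measurable
    have "S (Suc i) \<in> borel_measurable (F (real (Suc i) * \<delta>))"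
    proof -
      have "S (Suc i) = (\<lambda>\<omega>. S i \<omega> + (m * \<delta> + sg * \<Delta> i \<omega>) * D i \<omega>)" by (simp add: S1 D_def)
      then show ?thesis using ** by simp
    qed
    ultimately show ?case by presburger
  qed
  have DM: "D i \<in> borel_measurable (F (real i * \<delta>))" "integrable N (\<lambda>\<omega>. (D i \<omega>)\<^sup>2)" if "i \<le> n" for i
  proof -
    show "D i \<in> borel_measurable (F (real i * \<delta>))"
      using SM[OF that, THEN conjunct1] x(1)[OF that] unfolding D_def by measurable
    show "integrable N (\<lambda>\<omega>. (D i \<omega>)\<^sup>2)" unfolding D_def
      using SM[OF that] by (intro integrable_square_add xN x that measurable_F_N[OF _ pos]) auto
  qed
  have DN: "D i \<in> borel_measurable N" if "i \<le> n" for i using measurable_F_N[OF DM(1)[OF that] pos] .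
  define a where "a = (\<lambda>i. expectation (\<lambda>\<omega>. (D i \<omega>)\<^sup>2))"
  \<comment> \<open>The two summands come from the Cauchy-Schwarz bound for the drift,
    \<open>m\<^sup>2 * \<delta>\<^sup>2 * n\<close>, and from the isometry,
    \<open>sg\<^sup>2 * \<delta>\<close>; the factor 3 is that of
    \<open>square_sum3_le\<close>.\<close>
  define b where "b = 3 * (m\<^sup>2 * (real n * \<delta>) + sg\<^sup>2) * \<delta>"
  have b: "0 \<le> b" using \<delta> by (auto simp: b_def intro!: mult_nonneg_nonneg add_nonneg_nonneg)
  have "a i \<le> 3 * A + b * (\<Sum>j<i. a j)" if i: "i \<le> n" for i
  proof -
    have iso: "has_bochner_integral N (\<lambda>\<omega>. (\<Sum>j<i. D j \<omega> * \<Delta> j \<omega>)\<^sup>2) (\<Sum>j<i. a j * \<delta>)"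
      using has_bochner_integral_isometry[of "\<lambda>i. real i * \<delta>" i D] pos le DM i
      unfolding \<Delta>_def a_def by (simp add: algebra_simps)
    have "a i \<le> expectation (\<lambda>\<omega>. 3 * (x i \<omega>)\<^sup>2 + 3 * (m * \<delta>)\<^sup>2 * real n * (\<Sum>j<i. (D j \<omega>)\<^sup>2) + 3 * sg\<^sup>2 * (\<Sum>j<i. D j \<omega> * \<Delta> j \<omega>)\<^sup>2)"
      unfolding a_def
    proof (rule integral_mono)
      show "integrable N (\<lambda>\<omega>. 3 * (x i \<omega>)\<^sup>2 + 3 * (m * \<delta>)\<^sup>2 * real n * (\<Sum>j<i. (D j \<omega>)\<^sup>2) + 3 * sg\<^sup>2 * (\<Sum>j<i. D j \<omega> * \<Delta> j \<omega>)\<^sup>2)"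
        using x(2)[OF i] DM(2) i iso
        by (intro Bochner_Integration.integrable_add integrable_mult_right Bochner_Integration.integrable_sum) (auto simp: has_bochner_integral_iff)
      fix \<omega>
      have "(\<Sum>j<i. (m * \<delta> + sg * \<Delta> j \<omega>) * D j \<omega>) = m * \<delta> * (\<Sum>j<i. D j \<omega>) + sg * (\<Sum>j<i. D j \<omega> * \<Delta> j \<omega>)"
        unfolding sum_distrib_left sum.distrib[symmetric] by (intro sum.cong refl) (simp add: algebra_simps)
      moreover have "D i \<omega> = x i \<omega> + S i \<omega>" by (simp add: D_def)
      ultimately have "D i \<omega> = x i \<omega> + m * \<delta> * (\<Sum>j<i. D j \<omega>) + sg * (\<Sum>j<i. D j \<omega> * \<Delta> j \<omega>)"
        by (simp only: S add.assoc)
      then have "(D i \<omega>)\<^sup>2 \<le> 3 * (x i \<omega>)\<^sup>2 + 3 * (m * \<delta> * (\<Sum>j<i. D j \<omega>))\<^sup>2 + 3 * (sg * (\<Sum>j<i. D j \<omega> * \<Delta> j \<omega>))\<^sup>2"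
        using square_sum3_le by metis
      also have "3 * (m * \<delta> * (\<Sum>j<i. D j \<omega>))\<^sup>2 \<le> 3 * (m * \<delta>)\<^sup>2 * real n * (\<Sum>j<i. (D j \<omega>)\<^sup>2)"
      proof -
        have "(\<Sum>j<i. D j \<omega>)\<^sup>2 \<le> (\<Sum>j<i. (D j \<omega>)\<^sup>2) * card {..<i}"
          by (rule sum_squared_le_sum_of_squares)
        also have "\<dots> \<le> (\<Sum>j<i. (D j \<omega>)\<^sup>2) * real n"
          using i by (intro mult_left_mono sum_nonneg) auto
        finally have "(\<Sum>j<i. D j \<omega>)\<^sup>2 \<le> (\<Sum>j<i. (D j \<omega>)\<^sup>2) * real n" .
        from mult_left_mono[OF this, of "3 * (m * \<delta>)\<^sup>2"] show ?thesis
          by (simp add: power_mult_distrib mult_ac)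
      qed
      finally show "(D i \<omega>)\<^sup>2 \<le> 3 * (x i \<omega>)\<^sup>2 + 3 * (m * \<delta>)\<^sup>2 * real n * (\<Sum>j<i. (D j \<omega>)\<^sup>2) + 3 * sg\<^sup>2 * (\<Sum>j<i. D j \<omega> * \<Delta> j \<omega>)\<^sup>2"
        by (simp add: power_mult_distrib)
    qed (rule DM(2)[OF i])
    also have "\<dots> = 3 * expectation (\<lambda>\<omega>. (x i \<omega>)\<^sup>2) + 3 * (m * \<delta>)\<^sup>2 * real n * (\<Sum>j<i. a j) + 3 * sg\<^sup>2 * (\<Sum>j<i. a j * \<delta>)"
    proof -
      have "has_bochner_integral N (\<lambda>\<omega>. 3 * (x i \<omega>)\<^sup>2 + 3 * (m * \<delta>)\<^sup>2 * real n * (\<Sum>j<i. (D j \<omega>)\<^sup>2) + 3 * sg\<^sup>2 * (\<Sum>j<i. D j \<omega> * \<Delta> j \<omega>)\<^sup>2)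
         (3 * expectation (\<lambda>\<omega>. (x i \<omega>)\<^sup>2) + 3 * (m * \<delta>)\<^sup>2 * real n * (\<Sum>j<i. a j) + 3 * sg\<^sup>2 * (\<Sum>j<i. a j * \<delta>))"
        using x(2)[OF i] DM(2) i iso unfolding a_def
        by (intro has_bochner_integral_add has_bochner_integral_mult_right has_bochner_integral_sum has_bochner_integral_integrable) auto
      then show ?thesis by (rule has_bochner_integral_integral_eq)
    qed
    also have "\<dots> \<le> 3 * A + 3 * (m * \<delta>)\<^sup>2 * real n * (\<Sum>j<i. a j) + 3 * sg\<^sup>2 * (\<Sum>j<i. a j * \<delta>)"
      using x(3)[OF i] by simp
    also have "\<dots> = 3 * A + b * (\<Sum>j<i. a j)"
      unfolding sum_distrib_right[symmetric] b_def by (simp add: power2_eq_square algebra_simps)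
    finally show ?thesis .
  qed
  from discrete_gronwall[OF this b, of n n] have "a n \<le> 3 * A * (1 + b) ^ n" by simp
  also have "\<dots> \<le> 3 * A * exp b ^ n"
  proof (rule mult_left_mono)
    show "(1 + b) ^ n \<le> exp b ^ n" using b exp_ge_add_one_self[of b] by (intro power_mono) auto
    have "0 \<le> expectation (\<lambda>\<omega>. (x 0 \<omega>)\<^sup>2)" by (rule integral_nonneg_AE) simp
    then show "0 \<le> 3 * A" using order_trans[OF _ x(3)[of 0]] by simp
  qed
  also have "exp b ^ n = exp (3 * (m\<^sup>2 * (real n * \<delta>) + sg\<^sup>2) * (real n * \<delta>))"
    by (simp add: exp_of_nat_mult[symmetric] b_def mult_ac)
  finally have "a n \<le> 3 * A * exp (3 * (m\<^sup>2 * (real n * \<delta>) + sg\<^sup>2) * (real n * \<delta>))" .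
  note bound = this
  show ?thesis
  proof (rule that[of D])
    show "D i \<omega> = x i \<omega> + (\<Sum>j<i. (m * \<delta> + sg * \<Delta> j \<omega>) * D j \<omega>)" for i \<omega>
      unfolding S[symmetric] by (simp add: D_def)
  qed (use DN[of n] DM(2)[of n] bound in \<open>simp_all add: a_def\<close>)
qed

text \<open>On the good event the Euler error obeys the recursion of the scheme up to an integral with
  small energy, which elem_truncate controls and the discrete Gronwall inequality propagates.\<close>

lemma euler_error:
  fixes Z :: "real \<Rightarrow> 'a \<Rightarrow> real" and z m sg K \<epsilon> \<epsilon>1 \<delta>1 T :: real and n :: nat
  assumes Z: "\<And>t. 0 \<le> t \<Longrightarrow> Z t \<in> borel_measurable (F t)" and el: "elem H I"
    and T: "0 < T" and n: "0 < n" and pos: "0 < \<epsilon>" "0 \<le> \<epsilon>1" "0 \<le> \<delta>1"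
  defines "\<delta> \<equiv> T / real n"
  defines "\<Delta> \<equiv> \<lambda>j \<omega>. W (real (Suc j) * \<delta>) \<omega> - W (real j * \<delta>) \<omega>"
  shows "\<exists>B\<in>events. prob B \<le> 6 * (\<delta>1 + \<epsilon>1\<^sup>2) * exp (3 * (m\<^sup>2 * T + sg\<^sup>2) * T) / \<epsilon>\<^sup>2 \<and>
    (\<forall>\<omega>\<in>space N - B. (\<forall>j<n. \<bar>Z (real j * \<delta>) \<omega>\<bar> \<le> K) \<longrightarrow>
      (LBINT s:{0..T}. (H s \<omega> - (\<Sum>j<n. sg * Z (real j * \<delta>) \<omega> * indicator {real j * \<delta><..real (Suc j) * \<delta>} s))\<^sup>2) \<le> \<delta>1 \<longrightarrow>
      (\<forall>i\<le>n. \<bar>Z (real i * \<delta>) \<omega> - z - I (real i * \<delta>) \<omega> - m * \<delta> * (\<Sum>j<i. Z (real j * \<delta>) \<omega>)\<bar> \<le> \<epsilon>1) \<longrightarrow>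
      \<bar>Z T \<omega> - z * (\<Prod>j<n. 1 + m * \<delta> + sg * \<Delta> j \<omega>)\<bar> \<le> \<epsilon>)"
proof -
  have \<delta>: "0 \<le> \<delta>" "real n * \<delta> = T" using T n by (auto simp: \<delta>_def)
  define t where "t = (\<lambda>j::nat. real j * \<delta>)"
  have t0: "0 \<le> t j" and tmono: "i \<le> j \<Longrightarrow> t i \<le> t j" for i j
    using \<delta> by (auto simp: t_def intro: mult_right_mono)
  have tn: "t n = T" using \<delta> by (simp add: t_def)
  \<comment> \<open>Elementary integrands have to be bounded, so the path is cut off at level
    \<open>K\<close>; on the good event the cut is invisible.\<close>
  define Y where "Y = (\<lambda>j \<omega>. if \<bar>Z (t j) \<omega>\<bar> \<le> K then Z (t j) \<omega> else 0)"
  \<comment> \<open>The difference between \<open>H\<close> and the integrand that the Euler scheme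
    freezes at the left end of each cell. Its energy is small on the good event, where
    \<open>elem_truncate\<close> leaves its integral unchanged.\<close>
  define R where "R = (\<lambda>s \<omega>. - 1 * (\<Sum>j<n. sg * Y j \<omega> * indicator {t j<..t (Suc j)} s) + H s \<omega>)"
  define IR where "IR = (\<lambda>u \<omega>. - 1 * (\<Sum>j<n. sg * Y j \<omega> * (W (min (t (Suc j)) u) \<omega> - W (min (t j) u) \<omega>)) + I u \<omega>)"
  have "elem R IR" unfolding R_def IR_def
  proof (intro elem_add[OF el] elem_cmult elem_sum elem_single)
    fix j show "(\<lambda>\<omega>. sg * Y j \<omega>) \<in> borel_measurable (F (t j))"
      using Z[OF t0[of j]] unfolding Y_def by measurable
    show "\<bar>sg * Y j \<omega>\<bar> \<le> \<bar>sg\<bar> * \<bar>K\<bar>" for \<omega>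
      unfolding abs_mult Y_def by (intro mult_left_mono) auto
  qed (use t0 tmono in auto)
  moreover have "0 \<le> T" "finite (t ` {..n})" "t ` {..n} \<subseteq> {0..T}"
    using T t0 tmono by (auto simp flip: tn)
  ultimately obtain I' where I': "\<And>u. u \<in> t ` {..n} \<Longrightarrow> I' u \<in> borel_measurable (F u)"
    "\<And>u. u \<in> t ` {..n} \<Longrightarrow> integrable N (\<lambda>\<omega>. (I' u \<omega>)\<^sup>2)"
    "\<And>u. u \<in> t ` {..n} \<Longrightarrow> expectation (\<lambda>\<omega>. (I' u \<omega>)\<^sup>2) \<le> \<delta>1"
    "\<And>u \<omega>. u \<in> t ` {..n} \<Longrightarrow> (LBINT s:{0..T}. (R s \<omega>)\<^sup>2) \<le> \<delta>1 \<Longrightarrow> I' u \<omega> = IR u \<omega>"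
    using elem_truncate[OF _ _ _ _ pos(3), where H = R and I = IR and T = T and E = "t ` {..n}"] by metis
  define rest where "rest = (\<lambda>i \<omega>. Z (t i) \<omega> - z - I (t i) \<omega> - m * \<delta> * (\<Sum>j<i. Z (t j) \<omega>))"
  \<comment> \<open>The residual of the equation is small only on the good event; clipping makes its
    square integrable with a known bound.\<close>
  define b where "b = (\<lambda>i \<omega>. max (- \<epsilon>1) (min \<epsilon>1 (rest i \<omega>)))"
  define x where "x = (\<lambda>i \<omega>. I' (t i) \<omega> + b i \<omega>)"
  have Im: "I u \<in> borel_measurable (F u)" if "0 \<le> u" for u
    using el
  proof (induction rule: elem.induct)
    case (elem_step H I a b' \<xi> C)
    have W: "W (min c u) \<in> borel_measurable (F u)" if "0 \<le> c" for c
      using that \<open>0 \<le> u\<close> by (intro measurable_F_mono[OF W_adapted]) auto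
    show ?case
    proof (cases "a \<le> u")
      case True
      have "\<xi> \<in> borel_measurable (F u)" by (rule measurable_F_mono[OF elem_step(4) elem_step(2) True])
      moreover have "W (min b' u) \<in> borel_measurable (F u)" "W (min a u) \<in> borel_measurable (F u)"
        using W elem_step by auto
      ultimately show ?thesis using elem_step(6) by measurable
    next
      case False
      then have "min b' u = u" "min a u = u" using elem_step(3) by auto
      then show ?thesis using elem_step(6) by simp
    qed
  qed simp
  have bm: "b i \<in> borel_measurable (F (t i))" for i
  proof -
    have "Z (t j) \<in> borel_measurable (F (t i))" if "j \<le> i" for j
      by (rule measurable_F_mono[OF Z[OF t0] t0 tmono[OF that]])
    then have "(\<lambda>\<omega>. \<Sum>j<i. Z (t j) \<omega>) \<in> borel_measurable (F (t i))" by (intro borel_measurable_sum) auto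
    then show ?thesis using Z[OF t0[of i]] Im[OF t0[of i]] unfolding b_def rest_def by measurable
  qed
  have bN: "b i \<in> borel_measurable N" for i by (rule measurable_F_N[OF bm t0])
  have b2: "(b i \<omega>)\<^sup>2 \<le> \<epsilon>1\<^sup>2" for i \<omega>
  proof -
    have "\<bar>b i \<omega>\<bar> \<le> \<epsilon>1" using pos(2) by (auto simp: b_def)
    from power_mono[OF this, of 2] show ?thesis by simp
  qed
  have bi: "integrable N (\<lambda>\<omega>. (b i \<omega>)\<^sup>2)" for i
    using b2 bN by (intro integrable_const_bound[where B = "\<epsilon>1\<^sup>2"]) auto
  have x: "x i \<in> borel_measurable (F (real i * \<delta>))" "integrable N (\<lambda>\<omega>. (x i \<omega>)\<^sup>2)"
    "expectation (\<lambda>\<omega>. (x i \<omega>)\<^sup>2) \<le> 2 * (\<delta>1 + \<epsilon>1\<^sup>2)" if "i \<le> n" for i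
  proof -
    have ti: "t i \<in> t ` {..n}" using that by simp
    show "x i \<in> borel_measurable (F (real i * \<delta>))"
      using I'(1)[OF ti] bm[of i] unfolding x_def t_def[symmetric] by (intro borel_measurable_add) (auto simp: t_def)
    have IN: "I' (t i) \<in> borel_measurable N" by (rule measurable_F_N[OF I'(1)[OF ti] t0])
    show xi: "integrable N (\<lambda>\<omega>. (x i \<omega>)\<^sup>2)" unfolding x_def
      by (rule integrable_square_add[OF IN bN I'(2)[OF ti] bi])
    have "expectation (\<lambda>\<omega>. (x i \<omega>)\<^sup>2) \<le> expectation (\<lambda>\<omega>. 2 * (I' (t i) \<omega>)\<^sup>2 + 2 * \<epsilon>1\<^sup>2)"
    proof (rule integral_mono[OF xi])
      show "integrable N (\<lambda>\<omega>. 2 * (I' (t i) \<omega>)\<^sup>2 + 2 * \<epsilon>1\<^sup>2)" using I'(2)[OF ti] by simp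
      show "(x i \<omega>)\<^sup>2 \<le> 2 * (I' (t i) \<omega>)\<^sup>2 + 2 * \<epsilon>1\<^sup>2" for \<omega>
        using square_sum2_le[of "I' (t i) \<omega>" "b i \<omega>"] b2[of i \<omega>] unfolding x_def by linarith
    qed
    also have "\<dots> = 2 * expectation (\<lambda>\<omega>. (I' (t i) \<omega>)\<^sup>2) + 2 * \<epsilon>1\<^sup>2"
      using I'(2)[OF ti] by (simp add: prob_space)
    finally show "expectation (\<lambda>\<omega>. (x i \<omega>)\<^sup>2) \<le> 2 * (\<delta>1 + \<epsilon>1\<^sup>2)" using I'(3)[OF ti] by simp
  qed
  obtain D where D: "\<And>i \<omega>. i \<le> n \<Longrightarrow> D i \<omega> = x i \<omega> + (\<Sum>j<i. (m * \<delta> + sg * (W (real (Suc j) * \<delta>) \<omega> - W (real j * \<delta>) \<omega>)) * D j \<omega>)"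
    "D n \<in> borel_measurable N" "integrable N (\<lambda>\<omega>. (D n \<omega>)\<^sup>2)"
    "expectation (\<lambda>\<omega>. (D n \<omega>)\<^sup>2) \<le> 3 * (2 * (\<delta>1 + \<epsilon>1\<^sup>2)) * exp (3 * (m\<^sup>2 * (real n * \<delta>) + sg\<^sup>2) * (real n * \<delta>))"
    using euler_recursion_bound[OF \<delta>(1) x, of n m sg] by blast
  define B where "B = {\<omega>\<in>space N. \<epsilon> < \<bar>D n \<omega>\<bar>}"
  show ?thesis
  proof (intro bexI[of _ B] conjI ballI impI)
    show "B \<in> events" using D(2) unfolding B_def by measurable
    have "prob B \<le> expectation (\<lambda>\<omega>. (D n \<omega>)\<^sup>2) / \<epsilon>\<^sup>2"
      unfolding B_def by (rule prob_square_bound[OF D(2,3) pos(1)])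
    also have "\<dots> \<le> 6 * (\<delta>1 + \<epsilon>1\<^sup>2) * exp (3 * (m\<^sup>2 * T + sg\<^sup>2) * T) / \<epsilon>\<^sup>2"
      using D(4) by (intro divide_right_mono) (auto simp: \<delta>)
    finally show "prob B \<le> 6 * (\<delta>1 + \<epsilon>1\<^sup>2) * exp (3 * (m\<^sup>2 * T + sg\<^sup>2) * T) / \<epsilon>\<^sup>2" .
    fix \<omega> assume \<omega>: "\<omega> \<in> space N - B"
      and K: "\<forall>j<n. \<bar>Z (real j * \<delta>) \<omega>\<bar> \<le> K"
      and L: "(LBINT s:{0..T}. (H s \<omega> - (\<Sum>j<n. sg * Z (real j * \<delta>) \<omega> * indicator {real j * \<delta><..real (Suc j) * \<delta>} s))\<^sup>2) \<le> \<delta>1"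
      and r: "\<forall>i\<le>n. \<bar>Z (real i * \<delta>) \<omega> - z - I (real i * \<delta>) \<omega> - m * \<delta> * (\<Sum>j<i. Z (real j * \<delta>) \<omega>)\<bar> \<le> \<epsilon>1"
    have Y: "Y j \<omega> = Z (t j) \<omega>" if "j < n" for j using K[rule_format, OF that] by (simp add: Y_def t_def)
    have "R s \<omega> = H s \<omega> - (\<Sum>j<n. sg * Z (t j) \<omega> * indicator {t j<..t (Suc j)} s)" for s
      unfolding R_def using Y by simp
    then have "(LBINT s:{0..T}. (R s \<omega>)\<^sup>2) \<le> \<delta>1" using L by (simp add: t_def)
    then have I'IR: "I' (t i) \<omega> = IR (t i) \<omega>" if "i \<le> n" for i using I'(4)[of "t i" \<omega>] that by simp
    have IR: "IR (t i) \<omega> = I (t i) \<omega> - (\<Sum>j<i. sg * Z (t j) \<omega> * \<Delta> j \<omega>)" if i: "i \<le> n" for i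
    proof -
      have "(\<Sum>j<n. sg * Y j \<omega> * (W (min (t (Suc j)) (t i)) \<omega> - W (min (t j) (t i)) \<omega>)) = (\<Sum>j<i. sg * Z (t j) \<omega> * \<Delta> j \<omega>)"
      proof (rule sum.mono_neutral_cong_right)
        show "\<forall>j\<in>{..<n} - {..<i}. sg * Y j \<omega> * (W (min (t (Suc j)) (t i)) \<omega> - W (min (t j) (t i)) \<omega>) = 0"
        proof
          fix j assume "j \<in> {..<n} - {..<i}"
          then have "t i \<le> t (Suc j)" "t i \<le> t j" using tmono by auto
          then show "sg * Y j \<omega> * (W (min (t (Suc j)) (t i)) \<omega> - W (min (t j) (t i)) \<omega>) = 0" by (simp add: min_absorb2)
        qed
        fix j assume "j \<in> {..<i}"
        then have "t (Suc j) \<le> t i" "t j \<le> t i" "j < n" using tmono i by auto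
        then show "sg * Y j \<omega> * (W (min (t (Suc j)) (t i)) \<omega> - W (min (t j) (t i)) \<omega>) = sg * Z (t j) \<omega> * \<Delta> j \<omega>"
          by (simp add: min_absorb1 Y \<Delta>_def t_def)
      qed (use i in auto)
      then show ?thesis by (simp add: IR_def)
    qed
    have b: "b i \<omega> = rest i \<omega>" if "i \<le> n" for i
      using r[rule_format, OF that] unfolding b_def rest_def t_def by (simp add: abs_le_iff)
    \<comment> \<open>The Euler product solves the recursion with forcing \<open>1\<close>, that is,
      with initial value \<open>1\<close> and no error. Hence \<open>Z - z * E\<close> at the grid
      times obeys the recursion that characterises \<open>D\<close>, and strong induction identifies
      the two on the good event.\<close>
    define E where "E = (\<lambda>i. \<Prod>j<i. 1 + m * \<delta> + sg * \<Delta> j \<omega>)"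
    have E: "E i = 1 + (\<Sum>j<i. (m * \<delta> + sg * \<Delta> j \<omega>) * E j)" for i
      by (induction i) (simp_all add: E_def algebra_simps)
    have "Z (t i) \<omega> - z * E i = D i \<omega>" if "i \<le> n" for i
      using that
    proof (induction i rule: less_induct)
      case (less i)
      have "(\<Sum>j<i. (m * \<delta> + sg * \<Delta> j \<omega>) * D j \<omega>) = (\<Sum>j<i. (m * \<delta> + sg * \<Delta> j \<omega>) * (Z (t j) \<omega> - z * E j))"
        by (intro sum.cong refl arg_cong2[where f = "(*)"]) (use less in auto)
      also have "\<dots> = m * \<delta> * (\<Sum>j<i. Z (t j) \<omega>) + (\<Sum>j<i. sg * Z (t j) \<omega> * \<Delta> j \<omega>) - z * (\<Sum>j<i. (m * \<delta> + sg * \<Delta> j \<omega>) * E j)"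
        unfolding sum_distrib_left sum.distrib[symmetric] sum_subtractf[symmetric]
        by (intro sum.cong refl) (simp add: algebra_simps)
      finally have "D i \<omega> = x i \<omega> + (m * \<delta> * (\<Sum>j<i. Z (t j) \<omega>) + (\<Sum>j<i. sg * Z (t j) \<omega> * \<Delta> j \<omega>) - z * (E i - 1))"
        using D(1)[OF less.prems, of \<omega>] E[of i] unfolding \<Delta>_def by simp
      also have "x i \<omega> = I (t i) \<omega> - (\<Sum>j<i. sg * Z (t j) \<omega> * \<Delta> j \<omega>) + rest i \<omega>"
        using less.prems by (simp add: x_def I'IR IR b)
      finally show ?case by (simp add: rest_def algebra_simps)
    qed
    from this[of n] have "Z T \<omega> - z * E n = D n \<omega>" by (simp add: tn)
    then show "\<bar>Z T \<omega> - z * (\<Prod>j<n. 1 + m * \<delta> + sg * \<Delta> j \<omega>)\<bar> \<le> \<epsilon>"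
      using \<omega> unfolding B_def E_def by auto
  qed
qed

end

section \<open>Convergence of the Euler scheme to the solution\<close>

lemma sets_Collect_ball_countable:
  assumes X: "countable X" and P: "\<And>i. i \<in> X \<Longrightarrow> {x\<in>space M. P i x} \<in> sets M"
  shows "{x\<in>space M. \<forall>i\<in>X. P i x} \<in> sets M"
proof -
  have "{x\<in>space M. \<forall>i\<in>X. P i x} = space M - (\<Union>i\<in>X. space M - {x\<in>space M. P i x})" by auto
  also have "\<dots> \<in> sets M" using P by (intro sets.Diff sets.countable_UN' X) auto
  finally show ?thesis .
qed

context filtered_bm
begin

lemma prob_compl_tendsto_0:
  assumes E: "\<And>n. E n \<in> events" and ev: "AE \<omega> in N. \<forall>\<^sub>F n in sequentially. \<omega> \<in> E n"
  shows "(\<lambda>n. prob (space N - E n)) \<longlonglongrightarrow> 0"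
proof -
  have "(\<lambda>n. expectation (indicator (space N - E n))) \<longlonglongrightarrow> expectation (\<lambda>\<omega>. 0 :: real)"
  proof (rule integral_dominated_convergence[where w = "\<lambda>_. 1"])
    show "AE \<omega> in N. (\<lambda>n. indicator (space N - E n) \<omega>) \<longlonglongrightarrow> (0::real)"
      using ev
    proof eventually_elim
      case (elim \<omega>)
      then have "\<forall>\<^sub>F n in sequentially. indicator (space N - E n) \<omega> = (0::real)"
        by eventually_elim (auto simp: indicator_def)
      then show ?case by (rule tendsto_eventually)
    qed
  qed (use E in \<open>auto simp: indicator_def\<close>)
  then show ?thesis using E by (simp add: Int_absorb1 Diff_subset Int_Diff)
qed

text \<open>The order of choices matters: the bound \<open>K\<close> on the path and the tolerance
  \<eta> do not depend on the mesh; the number \<open>n\<close> of cells is taken large for the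
  oscillation of the path; and the index \<open>k\<close> of the elementary integrand is chosen
  last, in dependence on \<open>n\<close>.\<close>

lemma euler_vanishes:
  fixes T m sg z :: real
  assumes F: "\<And>t. 0 \<le> t \<Longrightarrow> FF (ennreal t) = F t"
    and sde: "sde_solution N FF W (\<lambda>x. m * x) (\<lambda>x. sg * x) z Z" and T: "0 < T"
  shows "vanishes (\<lambda>n \<omega>. Z T \<omega> - z * (\<Prod>j<n. 1 + m * (T / real n) + sg * (W (real (Suc j) * (T / real n)) \<omega> - W (real j * (T / real n)) \<omega>)))"
  unfolding vanishes_def
proof (intro allI impI)
  fix \<epsilon> :: real assume \<epsilon>: "0 < \<epsilon>"
  have Zm: "Z t \<in> borel_measurable (F t)" if "0 \<le> t" for t
    using sde[unfolded sde_solution_def, THEN conjunct1] that F[OF that] by metis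
  have ZN: "Z t \<in> borel_measurable N" if "0 \<le> t" for t by (rule measurable_F_N[OF Zm[OF that] that])
  have cont: "AE \<omega> in N. continuous_on {0..} (\<lambda>t. Z t \<omega>)" using sde by (simp add: sde_solution_def)
  have cT: "continuous_on {0..T} (\<lambda>t. Z t \<omega>)" if "continuous_on {0..} (\<lambda>t. Z t \<omega>)" for \<omega>
    by (rule continuous_on_subset[OF that]) auto
  define C where "C = exp (3 * (m\<^sup>2 * T + sg\<^sup>2) * T)"
  define c0 where "c0 = 2 + 2 * (sg\<^sup>2 * T) + (1 + \<bar>m\<bar> * T)\<^sup>2"
  have C: "0 < C" "0 < c0"
    using T by (auto simp: C_def c0_def intro!: add_pos_nonneg mult_nonneg_nonneg)
  \<comment> \<open>Since \<eta> is at most 1, \<open>\<delta>1 + \<epsilon>1\<^sup>2\<close> is at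
    most \<open>c0 * \<eta>\<close>; with 48 = 6 * 8 the bound of \<open>euler_error\<close> becomes
    \<epsilon> / 8, below the share \<epsilon> / 6 reserved for that event.\<close>
  define \<eta> where "\<eta> = min 1 (\<epsilon> * \<epsilon>\<^sup>2 / (48 * c0 * C))"
  have \<eta>: "0 < \<eta>" "\<eta> \<le> 1" using \<epsilon> C by (auto simp: \<eta>_def)
  define \<delta>1 where "\<delta>1 = 2 * \<eta> + 2 * (sg\<^sup>2 * T * \<eta>\<^sup>2)"
  define \<epsilon>1 where "\<epsilon>1 = \<eta> + \<bar>m\<bar> * T * \<eta>"
  have pos: "0 \<le> \<delta>1" "0 \<le> \<epsilon>1" using \<eta> T by (auto simp: \<delta>1_def \<epsilon>1_def)
  have small: "6 * (\<delta>1 + \<epsilon>1\<^sup>2) * C / \<epsilon>\<^sup>2 < \<epsilon> / 6"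
  proof -
    have e2: "\<eta>\<^sup>2 \<le> \<eta>" using \<eta> by (simp add: power2_eq_square mult_left_le)
    have "\<epsilon>1\<^sup>2 = (1 + \<bar>m\<bar> * T)\<^sup>2 * \<eta>\<^sup>2" by (simp add: \<epsilon>1_def power2_eq_square algebra_simps)
    also have "\<dots> \<le> (1 + \<bar>m\<bar> * T)\<^sup>2 * \<eta>" using e2 by (intro mult_left_mono) auto
    finally have "\<epsilon>1\<^sup>2 \<le> (1 + \<bar>m\<bar> * T)\<^sup>2 * \<eta>" .
    moreover have "\<delta>1 \<le> 2 * \<eta> + 2 * (sg\<^sup>2 * T * \<eta>)"
      unfolding \<delta>1_def using e2 T by (intro add_left_mono mult_left_mono) auto
    ultimately have "\<delta>1 + \<epsilon>1\<^sup>2 \<le> c0 * \<eta>" by (simp add: c0_def algebra_simps)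
    also have "\<dots> \<le> c0 * (\<epsilon> * \<epsilon>\<^sup>2 / (48 * c0 * C))" using C by (intro mult_left_mono) (auto simp: \<eta>_def)
    also have "\<dots> = \<epsilon> * \<epsilon>\<^sup>2 / (48 * C)" using C by simp
    finally have "6 * (\<delta>1 + \<epsilon>1\<^sup>2) * C / \<epsilon>\<^sup>2 \<le> 6 * (\<epsilon> * \<epsilon>\<^sup>2 / (48 * C)) * C / \<epsilon>\<^sup>2"
      using C by (intro divide_right_mono mult_right_mono mult_left_mono) auto
    also have "\<dots> = \<epsilon> / 8" using C \<epsilon> by simp
    finally show ?thesis using \<epsilon> by simp
  qed
  define G1 where "G1 = (\<lambda>k::nat. {\<omega>\<in>space N. \<forall>q\<in>\<rat> \<inter> {0..T}. \<bar>Z q \<omega>\<bar> \<le> real k})"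
  have cnt: "countable (\<rat> \<inter> {0..T})" by (intro countable_Int1 countable_rat)
  have G1: "G1 k \<in> events" for k
    unfolding G1_def
  proof (rule sets_Collect_ball_countable[OF cnt])
    fix q assume "q \<in> \<rat> \<inter> {0..T}"
    then have [measurable]: "Z q \<in> borel_measurable N" by (intro ZN) auto
    show "{\<omega>\<in>space N. \<bar>Z q \<omega>\<bar> \<le> real k} \<in> events" by measurable
  qed
  have "AE \<omega> in N. \<forall>\<^sub>F k in sequentially. \<omega> \<in> G1 k"
    using cont AE_space
  proof eventually_elim
    case (elim \<omega>)
    have "compact ((\<lambda>t. Z t \<omega>) ` {0..T})" by (rule compact_continuous_image[OF cT[OF elim(1)]]) simp
    then have "bounded ((\<lambda>t. Z t \<omega>) ` {0..T})" by (rule compact_imp_bounded)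
    then obtain K where K: "\<forall>x\<in>(\<lambda>t. Z t \<omega>) ` {0..T}. norm x \<le> K" unfolding bounded_iff by (rule exE)
    obtain k0 :: nat where k0: "K \<le> real k0" using real_arch_simple by blast
    show ?case
      unfolding eventually_sequentially
    proof (intro exI allI impI)
      fix k assume "k0 \<le> k"
      then have "K \<le> real k" using k0 by simp
      then have "\<bar>Z q \<omega>\<bar> \<le> real k" if "q \<in> {0..T}" for q
        using bspec[OF K, of "Z q \<omega>"] that by simp
      then show "\<omega> \<in> G1 k" using elim(2) unfolding G1_def by simp
    qed
  qed
  from order_tendstoD(2)[OF prob_compl_tendsto_0[OF G1 this], of "\<epsilon> / 6"] \<epsilon>
  obtain K where K: "prob (space N - G1 K) < \<epsilon> / 6"
    using eventually_happens'[OF sequentially_bot] by force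
  \<comment> \<open>A point of a cell is at distance at most \<open>T / real n\<close> from its left
    end; the factor 2 turns this into a strict inequality, which survives rational
    approximation.\<close>
  define G2 where "G2 = (\<lambda>n::nat. {\<omega>\<in>space N. \<forall>q\<in>\<rat> \<inter> {0..T}. \<forall>q'\<in>\<rat> \<inter> {0..T}. \<bar>q - q'\<bar> < 2 * (T / real n) \<longrightarrow> \<bar>Z q \<omega> - Z q' \<omega>\<bar> \<le> \<eta>})"
  have G2: "G2 n \<in> events" for n
    unfolding G2_def
  proof (intro sets_Collect_ball_countable[OF cnt])
    fix q q' assume "q \<in> \<rat> \<inter> {0..T}" "q' \<in> \<rat> \<inter> {0..T}"
    then have [measurable]: "Z q \<in> borel_measurable N" "Z q' \<in> borel_measurable N" by (auto intro: ZN)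
    show "{\<omega>\<in>space N. \<bar>q - q'\<bar> < 2 * (T / real n) \<longrightarrow> \<bar>Z q \<omega> - Z q' \<omega>\<bar> \<le> \<eta>} \<in> events" by measurable
  qed
  have "AE \<omega> in N. \<forall>\<^sub>F n in sequentially. \<omega> \<in> G2 n"
    using cont AE_space
  proof eventually_elim
    case (elim \<omega>)
    have "uniformly_continuous_on {0..T} (\<lambda>t. Z t \<omega>)"
      by (rule compact_uniformly_continuous[OF cT[OF elim(1)]]) simp
    then obtain d where d: "0 < d" "\<And>u v. u \<in> {0..T} \<Longrightarrow> v \<in> {0..T} \<Longrightarrow> \<bar>v - u\<bar> < d \<Longrightarrow> \<bar>Z v \<omega> - Z u \<omega>\<bar> < \<eta>"
      using \<eta>(1) unfolding uniformly_continuous_on_def dist_real_def by metis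
    have "(\<lambda>n. 2 * (T / real n)) \<longlonglongrightarrow> 2 * 0" by (intro tendsto_intros lim_const_over_n)
    then have "\<forall>\<^sub>F n in sequentially. 2 * (T / real n) < d" using d(1) by (intro order_tendstoD) auto
    then show ?case
    proof eventually_elim
      case (elim n)
      have "\<bar>Z q \<omega> - Z q' \<omega>\<bar> \<le> \<eta>" if "q \<in> {0..T}" "q' \<in> {0..T}" "\<bar>q - q'\<bar> < 2 * (T / real n)" for q q'
        using d(2)[of q' q] that elim by simp
      then show ?case using \<open>\<omega> \<in> space N\<close> unfolding G2_def by simp
    qed
  qed
  from order_tendstoD(2)[OF prob_compl_tendsto_0[OF G2 this], of "\<epsilon> / 6"] \<epsilon>
  have evG2: "\<forall>\<^sub>F n in sequentially. prob (space N - G2 n) < \<epsilon> / 6" by simp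
  obtain H I where HI: "\<And>k. elem (H k) (I k)"
    "vanishes (\<lambda>k \<omega>. LBINT s:{0..T}. (H k s \<omega> - sg * Z s \<omega>)\<^sup>2)"
    "\<And>t. t \<in> {0..T} \<Longrightarrow> vanishes (\<lambda>k \<omega>. I k t \<omega> - (Z t \<omega> - z - (LBINT s:{0..t}. m * Z s \<omega>)))"
    using sde_approx[OF F sde less_imp_le[OF T]] by blast
  show "\<forall>\<^sub>F n in sequentially. \<exists>A\<in>events. prob A < \<epsilon> \<and> (\<forall>\<omega>\<in>space N - A. \<bar>Z T \<omega> - z * (\<Prod>j<n. 1 + m * (T / real n) + sg * (W (real (Suc j) * (T / real n)) \<omega> - W (real j * (T / real n)) \<omega>))\<bar> \<le> \<epsilon>)"
    using evG2 eventually_gt_at_top[of 0]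
  proof eventually_elim
    case (elim n)
    then have n: "0 < n" and PG2: "prob (space N - G2 n) < \<epsilon> / 6" by auto
    define \<delta> where "\<delta> = T / real n"
    have \<delta>: "0 < \<delta>" "real n * \<delta> = T" using T n by (auto simp: \<delta>_def)
    define t where "t = (\<lambda>j::nat. real j * \<delta>)"
    have t0: "0 \<le> t j" and tmono: "i \<le> j \<Longrightarrow> t i \<le> t j" for i j
      using \<delta> by (auto simp: t_def intro: mult_right_mono)
    have tn: "t n = T" using \<delta> by (simp add: t_def)
    have tin: "t i \<in> {0..T}" if "i \<le> n" for i using t0 tmono[OF that] tn by simp
    \<comment> \<open>The integral has to be close at all \<open>Suc n\<close> grid points
      simultaneously; the division by \<open>6 * real (Suc n)\<close> lets their exceptional events
      together cost at most \<epsilon> / 6.\<close>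
    define e where "e = min \<eta> (\<epsilon> / (6 * real (Suc n)))"
    have e: "0 < e" "e \<le> \<eta>" "e \<le> \<epsilon> / (6 * real (Suc n))" using \<eta> \<epsilon> by (auto simp: e_def)
    have "\<forall>\<^sub>F k in sequentially. \<forall>i\<in>{..n}. \<exists>A\<in>events. prob A < e \<and> (\<forall>\<omega>\<in>space N - A. \<bar>I k (t i) \<omega> - (Z (t i) \<omega> - z - (LBINT s:{0..t i}. m * Z s \<omega>))\<bar> \<le> e)"
      using vanishesD[OF HI(3)[OF tin] e(1)] by (intro eventually_ball_finite) auto
    from eventually_conj[OF vanishesD[OF HI(2) e(1)] this] obtain k where
      k: "\<exists>A\<in>events. prob A < e \<and> (\<forall>\<omega>\<in>space N - A. \<bar>LBINT s:{0..T}. (H k s \<omega> - sg * Z s \<omega>)\<^sup>2\<bar> \<le> e)"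
      "\<forall>i\<in>{..n}. \<exists>A\<in>events. prob A < e \<and> (\<forall>\<omega>\<in>space N - A. \<bar>I k (t i) \<omega> - (Z (t i) \<omega> - z - (LBINT s:{0..t i}. m * Z s \<omega>))\<bar> \<le> e)"
      using eventually_happens'[OF sequentially_bot] by blast
    from k(1) obtain A where A: "A \<in> events" "prob A < e"
      "\<And>\<omega>. \<omega> \<in> space N - A \<Longrightarrow> \<bar>LBINT s:{0..T}. (H k s \<omega> - sg * Z s \<omega>)\<^sup>2\<bar> \<le> e" by blast
    from bchoice[OF k(2)[unfolded Bex_def]] obtain A' where A': "\<And>i. i \<le> n \<Longrightarrow> A' i \<in> events" "\<And>i. i \<le> n \<Longrightarrow> prob (A' i) < e"
      "\<And>i \<omega>. i \<le> n \<Longrightarrow> \<omega> \<in> space N - A' i \<Longrightarrow> \<bar>I k (t i) \<omega> - (Z (t i) \<omega> - z - (LBINT s:{0..t i}. m * Z s \<omega>))\<bar> \<le> e"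
      unfolding Ball_def atMost_iff by blast
    have "\<exists>B\<in>events. prob B \<le> 6 * (\<delta>1 + \<epsilon>1\<^sup>2) * exp (3 * (m\<^sup>2 * T + sg\<^sup>2) * T) / \<epsilon>\<^sup>2 \<and>
      (\<forall>\<omega>\<in>space N - B. (\<forall>j<n. \<bar>Z (real j * (T / real n)) \<omega>\<bar> \<le> real K) \<longrightarrow>
        (LBINT s:{0..T}. (H k s \<omega> - (\<Sum>j<n. sg * Z (real j * (T / real n)) \<omega> * indicator {real j * (T / real n)<..real (Suc j) * (T / real n)} s))\<^sup>2) \<le> \<delta>1 \<longrightarrow>
        (\<forall>i\<le>n. \<bar>Z (real i * (T / real n)) \<omega> - z - I k (real i * (T / real n)) \<omega> - m * (T / real n) * (\<Sum>j<i. Z (real j * (T / real n)) \<omega>)\<bar> \<le> \<epsilon>1) \<longrightarrow>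
        \<bar>Z T \<omega> - z * (\<Prod>j<n. 1 + m * (T / real n) + sg * (W (real (Suc j) * (T / real n)) \<omega> - W (real j * (T / real n)) \<omega>))\<bar> \<le> \<epsilon>)"
      by (rule euler_error[OF Zm HI(1)[of k] T n \<epsilon> pos(2,1)])
    then obtain B where B: "B \<in> events" "prob B \<le> 6 * (\<delta>1 + \<epsilon>1\<^sup>2) * exp (3 * (m\<^sup>2 * T + sg\<^sup>2) * T) / \<epsilon>\<^sup>2"
      "\<forall>\<omega>\<in>space N - B. (\<forall>j<n. \<bar>Z (real j * (T / real n)) \<omega>\<bar> \<le> real K) \<longrightarrow>
        (LBINT s:{0..T}. (H k s \<omega> - (\<Sum>j<n. sg * Z (real j * (T / real n)) \<omega> * indicator {real j * (T / real n)<..real (Suc j) * (T / real n)} s))\<^sup>2) \<le> \<delta>1 \<longrightarrow>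
        (\<forall>i\<le>n. \<bar>Z (real i * (T / real n)) \<omega> - z - I k (real i * (T / real n)) \<omega> - m * (T / real n) * (\<Sum>j<i. Z (real j * (T / real n)) \<omega>)\<bar> \<le> \<epsilon>1) \<longrightarrow>
        \<bar>Z T \<omega> - z * (\<Prod>j<n. 1 + m * (T / real n) + sg * (W (real (Suc j) * (T / real n)) \<omega> - W (real j * (T / real n)) \<omega>))\<bar> \<le> \<epsilon>"
      by (elim bexE conjE)
    obtain N0 where N0: "{\<omega>\<in>space N. \<not> continuous_on {0..} (\<lambda>t. Z t \<omega>)} \<subseteq> N0" "N0 \<in> null_sets N"
      using cont unfolding eventually_ae_filter by blast
    let ?U = "\<Union>i\<in>{..n}. A' i"
    have U: "?U \<in> events" using A'(1) by blast
    have "prob ?U \<le> (\<Sum>i\<in>{..n}. prob (A' i))" by (rule measure_UNION_le) (use A'(1) in auto)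
    also have "\<dots> \<le> (\<Sum>i\<in>{..n}. e)" using A'(2) by (intro sum_mono less_imp_le) auto
    also have "\<dots> = real (Suc n) * e" by simp
    also have "\<dots> \<le> real (Suc n) * (\<epsilon> / (6 * real (Suc n)))" by (rule mult_left_mono[OF e(3)]) simp
    also have "\<dots> = \<epsilon> / 6" by (simp del: of_nat_Suc)
    finally have PU: "prob ?U \<le> \<epsilon> / 6" .
    have "e \<le> \<epsilon> / 6"
    proof (rule order_trans[OF e(3)])
      show "\<epsilon> / (6 * real (Suc n)) \<le> \<epsilon> / 6" using \<epsilon> by (intro divide_left_mono) auto
    qed
    then have PA: "prob A < \<epsilon> / 6" using A(2) by simp
    have PB: "prob B < \<epsilon> / 6" using B(2) small unfolding C_def by simp
    define X where "X = (space N - G1 K) \<union> (space N - G2 n) \<union> A \<union> ?U \<union> B \<union> N0"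
    show ?case
    proof (intro bexI[of _ X] conjI ballI)
      have N0e: "N0 \<in> events" using N0(2) by blast
      have E1: "space N - G1 K \<in> events" "space N - G2 n \<in> events" using G1 G2 by blast+
      show "X \<in> events" unfolding X_def using E1 A(1) U B(1) N0e by blast
      have "prob X = prob ((space N - G1 K) \<union> (space N - G2 n) \<union> A \<union> ?U \<union> B)"
        unfolding X_def using E1 A(1) U B(1) N0(2) by (intro prob_Un_null) blast+
      \<comment> \<open>The union over the grid points is bounded by \<epsilon> / 6 only weakly; its
        larger share \<epsilon> / 3 makes the inequality strict, and the five shares add up to
        \<epsilon>.\<close>
      also have "\<dots> < \<epsilon> / 6 + \<epsilon> / 6 + \<epsilon> / 6 + \<epsilon> / 3 + \<epsilon> / 6"
        using E1 A(1) U B(1) K PG2 PA PB PU \<epsilon> by (intro prob_Un_less sets.Un) auto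
      finally show "prob X < \<epsilon>" by simp
      fix \<omega> assume \<omega>: "\<omega> \<in> space N - X"
      have c: "continuous_on {0..T} (\<lambda>t. Z t \<omega>)" using \<omega> N0(1) by (intro cT) (auto simp: X_def)
      have ZK: "\<bar>Z u \<omega>\<bar> \<le> real K" if "u \<in> {0..T}" for u
        by (rule continuous_bound_from_rats[OF c T _ that]) (use \<omega> in \<open>auto simp: X_def G1_def\<close>)
      have Zmod: "\<bar>Z u \<omega> - Z v \<omega>\<bar> \<le> \<eta>" if "u \<in> {0..T}" "v \<in> {0..T}" "\<bar>u - v\<bar> < 2 * \<delta>" for u v
        by (rule continuous_modulus_from_rats[OF c T _ that]) (use \<omega> in \<open>auto simp: X_def G2_def \<delta>_def\<close>)
      define st where "st = (\<lambda>s. \<Sum>j<n. Z (t j) \<omega> * indicator {t j<..t (Suc j)} s)"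
      have st: "st s = Z (t j) \<omega>" if "j < n" "t j < s" "s \<le> t (Suc j)" for j s
        unfolding st_def using that by (intro step_sum_eq tmono) auto
      have stZ: "\<bar>st s - Z s \<omega>\<bar> \<le> \<eta>" if s: "0 < s" "s \<le> T" for s
      proof -
        obtain j where j: "j < n" "t j < s" "s \<le> t (Suc j)"
        proof -
          \<comment> \<open>Cells are open on the left, so the index of the cell containing
            \<open>s\<close> is a ceiling minus one.\<close>
          define i where "i = nat \<lceil>s / \<delta>\<rceil>"
          have c0: "0 < \<lceil>s / \<delta>\<rceil>" using s \<delta> by simp
          then have ri: "real i = of_int \<lceil>s / \<delta>\<rceil>" by (simp add: i_def)
          have i1: "s / \<delta> \<le> real i" "real i - 1 < s / \<delta>" unfolding ri by linarith+
          have ipos: "0 < i" using c0 by (simp add: i_def)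
          have "real i - 1 < real n"
          proof -
            have "s / \<delta> \<le> real n" using s \<delta> by (simp add: divide_le_eq)
            then show ?thesis using i1 by simp
          qed
          then have "i - 1 < n" using ipos by linarith
          moreover have "t (i - 1) < s" using i1(2) \<delta> ipos unfolding t_def by (simp add: of_nat_diff less_divide_eq)
          moreover have "s \<le> t (Suc (i - 1))" using i1(1) \<delta> ipos unfolding t_def by (simp add: divide_le_eq)
          ultimately show thesis by (rule that)
        qed
        have "\<bar>t j - s\<bar> < 2 * \<delta>" using j \<delta> by (simp add: t_def algebra_simps)
        then show ?thesis unfolding st[OF j] using tin[of j] j(1) s by (intro Zmod) auto
      qed
      have stsg: "sg * st s = (\<Sum>j<n. sg * Z (real j * (T / real n)) \<omega> * indicator {real j * (T / real n)<..real (Suc j) * (T / real n)} s)" for s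
        unfolding st_def t_def \<delta>_def sum_distrib_left by (simp only: mult.assoc)
      have stm[measurable]: "st \<in> borel_measurable borel" unfolding st_def by measurable
      have stb: "\<bar>st s\<bar> \<le> real n * real K" for s
      proof -
        have "\<bar>st s\<bar> \<le> (\<Sum>j<n. \<bar>Z (t j) \<omega> * indicator {t j<..t (Suc j)} s\<bar>)" unfolding st_def by (rule sum_abs)
        also have "\<dots> \<le> (\<Sum>j<n. real K)"
          using ZK[OF tin] by (intro sum_mono) (auto simp: indicator_def abs_mult)
        finally show ?thesis by simp
      qed
      \<comment> \<open>The point \<open>s = 0\<close> lies in no cell, so \<open>st\<close> is
        \<open>0\<close> there and need not be near the path; this one point is discarded.\<close>
      have ae0: "AE s in lborel. s \<noteq> (0::real)" by (rule AE_lborel_singleton)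
      obtain Ck where Ck: "(\<lambda>s. H k s \<omega>) \<in> borel_measurable borel" "\<And>s. \<bar>H k s \<omega>\<bar> \<le> Ck"
        using elem_bounded[OF HI(1)[of k], of \<omega>] by blast
      have csg: "continuous_on {0..T} (\<lambda>s. sg * Z s \<omega>)" by (intro continuous_intros c)
      have i1: "set_integrable lborel {0..T} (\<lambda>s. (H k s \<omega> - sg * Z s \<omega>)\<^sup>2)"
        by (rule set_integrable_square_diff[OF Ck csg])
      have i2: "set_integrable lborel {0..T} (\<lambda>s. (sg * st s - sg * Z s \<omega>)\<^sup>2)"
        by (rule set_integrable_square_diff[OF _ _ csg, where C = "\<bar>sg\<bar> * (real n * real K)"])
           (auto simp: abs_mult intro!: mult_left_mono stb)
      have i3: "set_integrable lborel {0..T} (\<lambda>s. (H k s \<omega> - sg * st s)\<^sup>2)"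
      proof -
        have "\<bar>H k s \<omega> - sg * st s\<bar> \<le> Ck + \<bar>sg\<bar> * (real n * real K)" for s
        proof -
          have "\<bar>sg * st s\<bar> \<le> \<bar>sg\<bar> * (real n * real K)" unfolding abs_mult by (intro mult_left_mono stb) auto
          then show ?thesis using Ck(2)[of s] by linarith
        qed
        from set_integrable_square_diff[OF _ this, where T = T and g = "\<lambda>_. 0"] show ?thesis using Ck(1) by simp
      qed
      show "\<bar>Z T \<omega> - z * (\<Prod>j<n. 1 + m * (T / real n) + sg * (W (real (Suc j) * (T / real n)) \<omega> - W (real j * (T / real n)) \<omega>))\<bar> \<le> \<epsilon>"
      proof (rule B(3)[rule_format])
        show "\<omega> \<in> space N - B" using \<omega> by (auto simp: X_def)
        show "\<bar>Z (real j * (T / real n)) \<omega>\<bar> \<le> real K" if "j < n" for j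
          using ZK[OF tin, of j] that by (simp add: t_def \<delta>_def)
        have "(LBINT s:{0..T}. (H k s \<omega> - sg * st s)\<^sup>2) \<le> 2 * (LBINT s:{0..T}. (H k s \<omega> - sg * Z s \<omega>)\<^sup>2) + 2 * (LBINT s:{0..T}. (sg * st s - sg * Z s \<omega>)\<^sup>2)"
          by (rule set_integral_square_triangle[OF i1 i2 i3])
        also have "\<dots> \<le> 2 * \<eta> + 2 * (sg\<^sup>2 * T * \<eta>\<^sup>2)"
        proof (intro add_mono mult_left_mono)
          show "(LBINT s:{0..T}. (H k s \<omega> - sg * Z s \<omega>)\<^sup>2) \<le> \<eta>"
            using A(3)[of \<omega>] \<omega> e(2) by (auto simp: X_def)
          have "(LBINT s:{0..T}. (sg * st s - sg * Z s \<omega>)\<^sup>2) \<le> (LBINT s:{0..T}. sg\<^sup>2 * \<eta>\<^sup>2)"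
            unfolding set_lebesgue_integral_def
          proof (rule integral_mono_AE)
            show "integrable lborel (\<lambda>s. indicator {0..T} s *\<^sub>R (sg * st s - sg * Z s \<omega>)\<^sup>2)"
              using i2 by (simp add: set_integrable_def)
            show "integrable lborel (\<lambda>s. indicator {0..T} s *\<^sub>R (sg\<^sup>2 * \<eta>\<^sup>2))"
              unfolding real_scaleR_def by (intro integrable_mult_left integrable_real_indicator) (auto simp: emeasure_lborel_Icc_eq)
            show "AE s in lborel. indicator {0..T} s *\<^sub>R (sg * st s - sg * Z s \<omega>)\<^sup>2 \<le> indicator {0..T} s *\<^sub>R (sg\<^sup>2 * \<eta>\<^sup>2)"
              using ae0
            proof eventually_elim
              case (elim s)
              show ?case
              proof (cases "s \<in> {0..T}")
                case True
                then have "\<bar>st s - Z s \<omega>\<bar> \<le> \<eta>" using elim by (intro stZ) auto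
                from power_mono[OF this, of 2] have "sg\<^sup>2 * (st s - Z s \<omega>)\<^sup>2 \<le> sg\<^sup>2 * \<eta>\<^sup>2" by (intro mult_left_mono) auto
                then show ?thesis using True by (simp add: right_diff_distrib[symmetric] power_mult_distrib)
              qed simp
            qed
          qed
          also have "\<dots> = sg\<^sup>2 * T * \<eta>\<^sup>2" using T by (simp add: set_lebesgue_integral_def)
          finally show "(LBINT s:{0..T}. (sg * st s - sg * Z s \<omega>)\<^sup>2) \<le> sg\<^sup>2 * T * \<eta>\<^sup>2" .
        qed auto
        finally show "(LBINT s:{0..T}. (H k s \<omega> - (\<Sum>j<n. sg * Z (real j * (T / real n)) \<omega> * indicator {real j * (T / real n)<..real (Suc j) * (T / real n)} s))\<^sup>2) \<le> \<delta>1"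
          unfolding \<delta>1_def stsg .
        fix i assume i: "i \<le> n"
        have cti: "continuous_on {0..t i} (\<lambda>s. m * Z s \<omega>)"
          using tin[OF i] by (intro continuous_intros continuous_on_subset[OF c]) auto
        have z1: "set_integrable lborel {0..t i} (\<lambda>s. m * Z s \<omega>)" by (rule borel_integrable_atLeastAtMost'[OF cti])
        have "has_bochner_integral lborel (\<lambda>s. indicator {t 0..t i} s * (m * st s)) (\<Sum>j<i. m * Z (t j) \<omega> * (t (Suc j) - t j))"
        proof (rule has_bochner_integral_step)
          fix j s assume "j < i" "t j < s" "s \<le> t (Suc j)"
          then show "m * st s = m * Z (t j) \<omega>" using st[of j s] i by simp
        qed (use tmono in auto)
        moreover have "t 0 = 0" "\<And>j. t (Suc j) - t j = \<delta>" by (simp_all add: t_def algebra_simps)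
        ultimately have hb: "has_bochner_integral lborel (\<lambda>s. indicator {0..t i} s * (m * st s)) (m * \<delta> * (\<Sum>j<i. Z (t j) \<omega>))"
          by (simp add: sum_distrib_left mult_ac)
        have z2: "set_integrable lborel {0..t i} (\<lambda>s. m * st s)" and z3: "(LBINT s:{0..t i}. m * st s) = m * \<delta> * (\<Sum>j<i. Z (t j) \<omega>)"
          using hb unfolding set_integrable_def set_lebesgue_integral_def has_bochner_integral_iff real_scaleR_def by blast+
        have "\<bar>(LBINT s:{0..t i}. m * Z s \<omega>) - m * \<delta> * (\<Sum>j<i. Z (t j) \<omega>)\<bar> = \<bar>LBINT s:{0..t i}. m * Z s \<omega> - m * st s\<bar>"
          unfolding z3[symmetric] using z1 z2 by (simp add: set_integral_diff)
        also have "\<dots> \<le> (LBINT s:{0..t i}. \<bar>m * Z s \<omega> - m * st s\<bar>)"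
        proof -
          have "(LBINT s:{0..t i}. \<bar>m * Z s \<omega> - m * st s\<bar>) = (LBINT s. \<bar>indicator {0..t i} s *\<^sub>R (m * Z s \<omega> - m * st s)\<bar>)"
            unfolding set_lebesgue_integral_def by (intro Bochner_Integration.integral_cong) (auto simp: indicator_def)
          then show ?thesis unfolding set_lebesgue_integral_def using integral_abs_bound by metis
        qed
        also have "\<dots> \<le> (LBINT s:{0..t i}. \<bar>m\<bar> * \<eta>)"
          unfolding set_lebesgue_integral_def
        proof (rule integral_mono_AE)
          have "set_integrable lborel {0..t i} (\<lambda>s. m * Z s \<omega> - m * st s)" using z1 z2 by (rule set_integral_diff(1))
          from set_integrable_abs[OF this] show "integrable lborel (\<lambda>s. indicator {0..t i} s *\<^sub>R \<bar>m * Z s \<omega> - m * st s\<bar>)"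
            by (simp add: set_integrable_def)
          show "integrable lborel (\<lambda>s. indicator {0..t i} s *\<^sub>R (\<bar>m\<bar> * \<eta>))"
            unfolding real_scaleR_def by (intro integrable_mult_left integrable_real_indicator) (auto simp: emeasure_lborel_Icc_eq)
          show "AE s in lborel. indicator {0..t i} s *\<^sub>R \<bar>m * Z s \<omega> - m * st s\<bar> \<le> indicator {0..t i} s *\<^sub>R (\<bar>m\<bar> * \<eta>)"
            using ae0
          proof eventually_elim
            case (elim s)
            show ?case
            proof (cases "s \<in> {0..t i}")
              case True
              then have "\<bar>st s - Z s \<omega>\<bar> \<le> \<eta>" using elim tin[OF i] by (intro stZ) auto
              then have "\<bar>m\<bar> * \<bar>Z s \<omega> - st s\<bar> \<le> \<bar>m\<bar> * \<eta>" by (intro mult_left_mono) auto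
              then show ?thesis using True by (simp add: right_diff_distrib[symmetric] abs_mult)
            qed simp
          qed
        qed
        also have "\<dots> = \<bar>m\<bar> * \<eta> * t i" using t0[of i] by (simp add: set_lebesgue_integral_def)
        also have "\<dots> \<le> \<bar>m\<bar> * \<eta> * T" using tin[OF i] \<eta> by (intro mult_left_mono) auto
        finally have "\<bar>(LBINT s:{0..t i}. m * Z s \<omega>) - m * \<delta> * (\<Sum>j<i. Z (t j) \<omega>)\<bar> \<le> \<bar>m\<bar> * \<eta> * T" .
        moreover have "\<bar>I k (t i) \<omega> - (Z (t i) \<omega> - z - (LBINT s:{0..t i}. m * Z s \<omega>))\<bar> \<le> \<eta>"
        proof -
          have "\<omega> \<in> space N - A' i" using \<omega> i by (auto simp: X_def)
          then show ?thesis using A'(3)[OF i] e(2) by fastforce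
        qed
        ultimately have "\<bar>Z (t i) \<omega> - z - I k (t i) \<omega> - m * \<delta> * (\<Sum>j<i. Z (t j) \<omega>)\<bar> \<le> \<eta> + \<bar>m\<bar> * \<eta> * T"
          by linarith
        then show "\<bar>Z (real i * (T / real n)) \<omega> - z - I k (real i * (T / real n)) \<omega> - m * (T / real n) * (\<Sum>j<i. Z (real j * (T / real n)) \<omega>)\<bar> \<le> \<epsilon>1"
          by (simp add: \<epsilon>1_def t_def \<delta>_def mult_ac)
      qed
    qed
  qed
qed

end

section \<open>The explicit solution\<close>

text \<open>With \<open>v = sg\<^sup>2\<close>, the three terms are a bound for the second moment of
  the Euler product, its mixed moment with the product of exponentials, and the second moment of the
  latter. Apart from the coefficients 1, -2, 1 each tends to
  \<open>exp ((2 * m + v) * T)\<close>.\<close>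

lemma tendsto_moments:
  fixes T m v :: real
  shows "(\<lambda>n. exp ((2 * m + v) * T + m\<^sup>2 * T\<^sup>2 / real (Suc n)) - 2 * (exp (m * (T / real (Suc n))) * (1 + m * (T / real (Suc n)) + v * (T / real (Suc n)))) ^ Suc n
     + exp ((2 * m + v) * T)) \<longlonglongrightarrow> 0"
proof -
  have e: "exp (m * (T / real (Suc n))) ^ Suc n = exp (m * T)" for n
    by (simp add: exp_of_nat_mult[symmetric] del: of_nat_Suc power_Suc)
  have "(\<lambda>n. (1 + ((m + v) * T) / real n) ^ n) \<longlonglongrightarrow> exp ((m + v) * T)"
    by (rule tendsto_exp_limit_sequentially)
  from LIMSEQ_Suc[OF this]
  have l: "(\<lambda>n. (1 + m * (T / real (Suc n)) + v * (T / real (Suc n))) ^ Suc n) \<longlonglongrightarrow> exp ((m + v) * T)"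
    by (simp add: algebra_simps add_divide_distrib del: power_Suc of_nat_Suc)
  have "(\<lambda>n. m\<^sup>2 * T\<^sup>2 / real (Suc n)) \<longlonglongrightarrow> 0"
    by (rule LIMSEQ_Suc[OF lim_const_over_n])
  then have "(\<lambda>n. exp ((2 * m + v) * T + m\<^sup>2 * T\<^sup>2 / real (Suc n)) - 2 * (exp (m * T) * (1 + m * (T / real (Suc n)) + v * (T / real (Suc n))) ^ Suc n)
     + exp ((2 * m + v) * T)) \<longlonglongrightarrow> exp ((2 * m + v) * T + 0) - 2 * (exp (m * T) * exp ((m + v) * T)) + exp ((2 * m + v) * T)"
    by (intro tendsto_intros l)
  moreover have "exp ((2 * m + v) * T + 0) - 2 * (exp (m * T) * exp ((m + v) * T)) + exp ((2 * m + v) * T) = 0"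
    by (simp add: exp_add[symmetric] algebra_simps)
  ultimately show ?thesis by (simp only: power_mult_distrib e)
qed

context filtered_bm
begin

text \<open>Adaptedness of the product is part of the induction, since the next factor has to be
  independent of it.\<close>

lemma has_bochner_integral_prod_increments:
  fixes h :: "real \<Rightarrow> real"
  assumes \<delta>: "0 \<le> \<delta>" and h[measurable]: "h \<in> borel_measurable borel"
    and I: "has_bochner_integral gauss (\<lambda>y. h (sqrt \<delta> * y)) c"
  shows "has_bochner_integral N (\<lambda>\<omega>. \<Prod>j<n. h (W (real (Suc j) * \<delta>) \<omega> - W (real j * \<delta>) \<omega>)) (c ^ n) \<and>
    (\<lambda>\<omega>. \<Prod>j<n. h (W (real (Suc j) * \<delta>) \<omega> - W (real j * \<delta>) \<omega>)) \<in> borel_measurable (F (real n * \<delta>))"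
proof (induction n)
  case 0
  then show ?case by (simp add: has_bochner_integral_iff prob_space)
next
  case (Suc n)
  define U where "U = (\<lambda>\<omega>. \<Prod>j<n. h (W (real (Suc j) * \<delta>) \<omega> - W (real j * \<delta>) \<omega>))"
  have IH: "has_bochner_integral N U (c ^ n)" "U \<in> borel_measurable (F (real n * \<delta>))"
    using Suc unfolding U_def by auto
  have pos: "0 \<le> real n * \<delta>" and pos': "0 \<le> real (Suc n) * \<delta>" and le: "real n * \<delta> \<le> real (Suc n) * \<delta>"
    using \<delta> by (auto intro: mult_right_mono)
  have "real (Suc n) * \<delta> - real n * \<delta> = \<delta>" by (simp add: algebra_simps)
  then have I': "has_bochner_integral gauss (\<lambda>y. h (sqrt (real (Suc n) * \<delta> - real n * \<delta>) * y)) c" using I by simp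
  have "has_bochner_integral N (\<lambda>\<omega>. U \<omega> * h (W (real (Suc n) * \<delta>) \<omega> - W (real n * \<delta>) \<omega>)) (expectation U * c)"
    using IH by (intro has_bochner_integral_increment[OF pos le _ _ h I']) (auto simp: has_bochner_integral_iff)
  moreover have "expectation U = c ^ n" using IH(1) by (simp add: has_bochner_integral_iff)
  moreover have "U \<in> borel_measurable (F (real (Suc n) * \<delta>))" "W (real n * \<delta>) \<in> borel_measurable (F (real (Suc n) * \<delta>))"
    "W (real (Suc n) * \<delta>) \<in> borel_measurable (F (real (Suc n) * \<delta>))"
    using measurable_F_mono[OF IH(2) pos le] measurable_F_mono[OF W_adapted[OF pos] pos le] W_adapted[OF pos'] by auto
  then have "(\<lambda>\<omega>. U \<omega> * h (W (real (Suc n) * \<delta>) \<omega> - W (real n * \<delta>) \<omega>)) \<in> borel_measurable (F (real (Suc n) * \<delta>))"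
    by measurable
  ultimately show ?case
    unfolding prod.lessThan_Suc U_def power_Suc2 by (intro conjI) (simp_all only:)
qed

lemma vanishes_L2:
  assumes m: "\<And>n. f n \<in> borel_measurable N" and i: "\<And>n. integrable N (\<lambda>\<omega>. (f n \<omega>)\<^sup>2)"
    and le: "\<And>n. expectation (\<lambda>\<omega>. (f n \<omega>)\<^sup>2) \<le> e n" and e: "e \<longlonglongrightarrow> 0"
  shows "vanishes f"
  unfolding vanishes_def
proof (intro allI impI)
  fix \<epsilon> :: real assume \<epsilon>: "0 < \<epsilon>"
  then have "0 < \<epsilon> * \<epsilon>\<^sup>2" by simp
  from order_tendstoD(2)[OF e this]
  show "\<forall>\<^sub>F n in sequentially. \<exists>A\<in>events. prob A < \<epsilon> \<and> (\<forall>\<omega>\<in>space N - A. \<bar>f n \<omega>\<bar> \<le> \<epsilon>)"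
  proof eventually_elim
    case (elim n)
    have [measurable]: "f n \<in> borel_measurable N" by (rule m)
    have "prob {\<omega>\<in>space N. \<epsilon> < \<bar>f n \<omega>\<bar>} \<le> expectation (\<lambda>\<omega>. (f n \<omega>)\<^sup>2) / \<epsilon>\<^sup>2"
      by (rule prob_square_bound[OF m i \<epsilon>])
    also have "\<dots> \<le> e n / \<epsilon>\<^sup>2" by (rule divide_right_mono[OF le]) simp
    also have "\<dots> < \<epsilon>" using elim \<epsilon> by (simp add: divide_less_eq)
    finally show ?case by (intro bexI[of _ "{\<omega>\<in>space N. \<epsilon> < \<bar>f n \<omega>\<bar>}"]) auto
  qed
qed

text \<open>Both products have independent factors with a common law, so the two squares and the
  mixed product have expectations that are powers of single Gaussian integrals, and the mean square
  distance is explicit. The drift \<open>m - sg\<^sup>2 / 2\<close> in the exponent is the one for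
  which all three limits agree.\<close>

lemma euler_product_vanishes:
  fixes T m sg :: real
  assumes T: "0 \<le> T"
  defines "\<Delta> \<equiv> \<lambda>n j \<omega>. W (real (Suc j) * (T / real (Suc n))) \<omega> - W (real j * (T / real (Suc n))) \<omega>"
  shows "vanishes (\<lambda>n \<omega>. (\<Prod>j<Suc n. 1 + m * (T / real (Suc n)) + sg * \<Delta> n j \<omega>)
     - (\<Prod>j<Suc n. exp ((m - sg\<^sup>2 / 2) * (T / real (Suc n)) + sg * \<Delta> n j \<omega>)))"
proof (rule vanishes_L2)
  fix n
  define \<delta> where "\<delta> = T / real (Suc n)"
  have \<delta>: "0 \<le> \<delta>" "real (Suc n) * \<delta> = T" using T by (auto simp: \<delta>_def)
  define P where "P = (\<lambda>\<omega>. \<Prod>j<Suc n. 1 + m * \<delta> + sg * \<Delta> n j \<omega>)"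
  define E where "E = (\<lambda>\<omega>. \<Prod>j<Suc n. exp ((m - sg\<^sup>2 / 2) * \<delta> + sg * \<Delta> n j \<omega>))"
  have D: "\<Delta> n j \<omega> = W (real (Suc j) * \<delta>) \<omega> - W (real j * \<delta>) \<omega>" for j \<omega> by (simp add: \<Delta>_def \<delta>_def)
  have g1: "has_bochner_integral gauss (\<lambda>y. (1 + m * \<delta> + sg * (sqrt \<delta> * y))\<^sup>2) ((1 + m * \<delta>)\<^sup>2 + sg\<^sup>2 * \<delta>)"
  proof -
    have "has_bochner_integral gauss (\<lambda>y. (1 + m * \<delta>)\<^sup>2 + (2 * (1 + m * \<delta>) * sg * sqrt \<delta>) * y + (sg\<^sup>2 * \<delta>) * y\<^sup>2)
       ((1 + m * \<delta>)\<^sup>2 + (2 * (1 + m * \<delta>) * sg * sqrt \<delta>) * 0 + (sg\<^sup>2 * \<delta>) * 1)"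
      by (intro has_bochner_integral_add has_bochner_integral_mult_right has_bochner_integral_gauss_const
          has_bochner_integral_gauss_id has_bochner_integral_gauss_square)
    moreover have "(1 + m * \<delta>)\<^sup>2 + (2 * (1 + m * \<delta>) * sg * sqrt \<delta>) * y + (sg\<^sup>2 * \<delta>) * y\<^sup>2 = (1 + m * \<delta> + sg * (sqrt \<delta> * y))\<^sup>2" for y
    proof -
      have "sg\<^sup>2 * \<delta> * y\<^sup>2 = (sg * (sqrt \<delta> * y))\<^sup>2" using \<delta> by (simp add: power_mult_distrib)
      then show ?thesis unfolding power2_sum[of "1 + m * \<delta>"] by (simp add: mult_ac)
    qed
    ultimately show ?thesis by simp
  qed
  have g2: "has_bochner_integral gauss (\<lambda>y. (1 + m * \<delta> + sg * (sqrt \<delta> * y)) * exp ((m - sg\<^sup>2 / 2) * \<delta> + sg * (sqrt \<delta> * y)))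
     (exp (m * \<delta>) * (1 + m * \<delta> + sg\<^sup>2 * \<delta>))"
  proof -
    have "has_bochner_integral gauss (\<lambda>y. exp ((m - sg\<^sup>2 / 2) * \<delta>) * ((1 + m * \<delta> + (sg * sqrt \<delta>) * y) * exp ((sg * sqrt \<delta>) * y)))
      (exp ((m - sg\<^sup>2 / 2) * \<delta>) * (exp ((sg * sqrt \<delta>)\<^sup>2 / 2) * (1 + m * \<delta> + sg * sqrt \<delta> * (sg * sqrt \<delta>))))"
      by (intro has_bochner_integral_mult_right has_bochner_integral_gauss_affine_exp)
    moreover have "exp ((m - sg\<^sup>2 / 2) * \<delta>) * (exp ((sg * sqrt \<delta>)\<^sup>2 / 2) * (1 + m * \<delta> + sg * sqrt \<delta> * (sg * sqrt \<delta>))) = exp (m * \<delta>) * (1 + m * \<delta> + sg\<^sup>2 * \<delta>)"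
    proof -
      have "sg * sqrt \<delta> * (sg * sqrt \<delta>) = sg\<^sup>2 * \<delta>" using \<delta> by (simp add: power2_eq_square)
      moreover have "exp ((m - sg\<^sup>2 / 2) * \<delta>) * exp ((sg * sqrt \<delta>)\<^sup>2 / 2) = exp (m * \<delta>)"
        using \<delta> by (simp add: exp_add[symmetric] power_mult_distrib algebra_simps)
      ultimately show ?thesis by (simp add: mult.assoc[symmetric])
    qed
    moreover have "exp ((m - sg\<^sup>2 / 2) * \<delta>) * ((1 + m * \<delta> + (sg * sqrt \<delta>) * y) * exp ((sg * sqrt \<delta>) * y)) =
       (1 + m * \<delta> + sg * (sqrt \<delta> * y)) * exp ((m - sg\<^sup>2 / 2) * \<delta> + sg * (sqrt \<delta> * y))" for y
      by (simp add: exp_add mult_ac)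
    ultimately show ?thesis by simp
  qed
  have g3: "has_bochner_integral gauss (\<lambda>y. (exp ((m - sg\<^sup>2 / 2) * \<delta> + sg * (sqrt \<delta> * y)))\<^sup>2) (exp ((2 * m + sg\<^sup>2) * \<delta>))"
  proof -
    have "has_bochner_integral gauss (\<lambda>y. exp (2 * (m - sg\<^sup>2 / 2) * \<delta>) * exp ((2 * sg * sqrt \<delta>) * y))
      (exp (2 * (m - sg\<^sup>2 / 2) * \<delta>) * exp ((2 * sg * sqrt \<delta>)\<^sup>2 / 2))"
      by (intro has_bochner_integral_mult_right has_bochner_integral_gauss_exp)
    moreover have "exp (2 * (m - sg\<^sup>2 / 2) * \<delta>) * exp ((2 * sg * sqrt \<delta>)\<^sup>2 / 2) = exp ((2 * m + sg\<^sup>2) * \<delta>)"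
      using \<delta> by (simp add: exp_add[symmetric] power_mult_distrib algebra_simps)
    moreover have "exp (2 * (m - sg\<^sup>2 / 2) * \<delta>) * exp ((2 * sg * sqrt \<delta>) * y) = (exp ((m - sg\<^sup>2 / 2) * \<delta> + sg * (sqrt \<delta> * y)))\<^sup>2" for y
      by (simp add: exp_double[symmetric] exp_add[symmetric] algebra_simps)
    ultimately show ?thesis by simp
  qed
  have p1: "has_bochner_integral N (\<lambda>\<omega>. (P \<omega>)\<^sup>2) (((1 + m * \<delta>)\<^sup>2 + sg\<^sup>2 * \<delta>) ^ Suc n)"
    using has_bochner_integral_prod_increments[OF \<delta>(1) _ g1, of "Suc n"] unfolding P_def D prod_power_distrib by simp
  have p2: "has_bochner_integral N (\<lambda>\<omega>. P \<omega> * E \<omega>) ((exp (m * \<delta>) * (1 + m * \<delta> + sg\<^sup>2 * \<delta>)) ^ Suc n)"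
    using has_bochner_integral_prod_increments[OF \<delta>(1) _ g2, of "Suc n"] unfolding P_def E_def D prod.distrib[symmetric] by simp
  have p3: "has_bochner_integral N (\<lambda>\<omega>. (E \<omega>)\<^sup>2) (exp ((2 * m + sg\<^sup>2) * \<delta>) ^ Suc n)"
    using has_bochner_integral_prod_increments[OF \<delta>(1) _ g3, of "Suc n"] unfolding E_def D prod_power_distrib by simp
  have "has_bochner_integral N (\<lambda>\<omega>. (P \<omega>)\<^sup>2 - 2 * (P \<omega> * E \<omega>) + (E \<omega>)\<^sup>2)
    (((1 + m * \<delta>)\<^sup>2 + sg\<^sup>2 * \<delta>) ^ Suc n - 2 * (exp (m * \<delta>) * (1 + m * \<delta> + sg\<^sup>2 * \<delta>)) ^ Suc n + exp ((2 * m + sg\<^sup>2) * \<delta>) ^ Suc n)"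
    by (intro has_bochner_integral_add has_bochner_integral_diff has_bochner_integral_mult_right p1 p2 p3)
  moreover have "(P \<omega>)\<^sup>2 - 2 * (P \<omega> * E \<omega>) + (E \<omega>)\<^sup>2 = (P \<omega> - E \<omega>)\<^sup>2" for \<omega>
    by (simp add: power2_diff)
  ultimately have p: "has_bochner_integral N (\<lambda>\<omega>. (P \<omega> - E \<omega>)\<^sup>2)
    (((1 + m * \<delta>)\<^sup>2 + sg\<^sup>2 * \<delta>) ^ Suc n - 2 * (exp (m * \<delta>) * (1 + m * \<delta> + sg\<^sup>2 * \<delta>)) ^ Suc n + exp ((2 * m + sg\<^sup>2) * \<delta>) ^ Suc n)"
    by simp
  have "0 \<le> real j * \<delta>" for j using \<delta> by simp
  then have [measurable]: "W (real j * \<delta>) \<in> borel_measurable N" for j by (rule W_measurable)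
  have PE: "(\<Prod>j<Suc n. 1 + m * (T / real (Suc n)) + sg * \<Delta> n j \<omega>)
     - (\<Prod>j<Suc n. exp ((m - sg\<^sup>2 / 2) * (T / real (Suc n)) + sg * \<Delta> n j \<omega>)) = P \<omega> - E \<omega>" for \<omega>
    by (simp only: P_def E_def \<delta>_def)
  show "(\<lambda>\<omega>. (\<Prod>j<Suc n. 1 + m * (T / real (Suc n)) + sg * \<Delta> n j \<omega>)
     - (\<Prod>j<Suc n. exp ((m - sg\<^sup>2 / 2) * (T / real (Suc n)) + sg * \<Delta> n j \<omega>))) \<in> borel_measurable N"
    unfolding PE P_def E_def D by measurable
  show "integrable N (\<lambda>\<omega>. ((\<Prod>j<Suc n. 1 + m * (T / real (Suc n)) + sg * \<Delta> n j \<omega>)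
     - (\<Prod>j<Suc n. exp ((m - sg\<^sup>2 / 2) * (T / real (Suc n)) + sg * \<Delta> n j \<omega>)))\<^sup>2)"
    unfolding PE using p by (simp only: has_bochner_integral_iff)
  have "expectation (\<lambda>\<omega>. (P \<omega> - E \<omega>)\<^sup>2) =
    ((1 + m * \<delta>)\<^sup>2 + sg\<^sup>2 * \<delta>) ^ Suc n - 2 * (exp (m * \<delta>) * (1 + m * \<delta> + sg\<^sup>2 * \<delta>)) ^ Suc n + exp ((2 * m + sg\<^sup>2) * \<delta>) ^ Suc n"
    using p by (simp only: has_bochner_integral_iff)
  \<comment> \<open>For this term an upper bound suffices: \<open>1 + x \<le> exp x\<close> replaces
    the power by its limit up to a factor
    \<open>exp (m\<^sup>2 * T\<^sup>2 / real (Suc n))\<close>.\<close>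
  also have "((1 + m * \<delta>)\<^sup>2 + sg\<^sup>2 * \<delta>) ^ Suc n \<le> exp ((2 * m + sg\<^sup>2) * T + m\<^sup>2 * T\<^sup>2 / real (Suc n))"
  proof -
    have "(1 + m * \<delta>)\<^sup>2 + sg\<^sup>2 * \<delta> = 1 + ((2 * m + sg\<^sup>2) * \<delta> + m\<^sup>2 * \<delta>\<^sup>2)"
      by (simp add: power2_eq_square algebra_simps)
    also have "\<dots> \<le> exp ((2 * m + sg\<^sup>2) * \<delta> + m\<^sup>2 * \<delta>\<^sup>2)" by (rule exp_ge_add_one_self)
    finally have "((1 + m * \<delta>)\<^sup>2 + sg\<^sup>2 * \<delta>) ^ Suc n \<le> exp ((2 * m + sg\<^sup>2) * \<delta> + m\<^sup>2 * \<delta>\<^sup>2) ^ Suc n"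
      using \<delta> by (intro power_mono) (auto intro!: add_nonneg_nonneg)
    also have "\<dots> = exp (real (Suc n) * ((2 * m + sg\<^sup>2) * \<delta> + m\<^sup>2 * \<delta>\<^sup>2))" by (simp only: exp_of_nat_mult)
    also have "real (Suc n) * ((2 * m + sg\<^sup>2) * \<delta> + m\<^sup>2 * \<delta>\<^sup>2) = (2 * m + sg\<^sup>2) * T + m\<^sup>2 * T\<^sup>2 / real (Suc n)"
      unfolding \<delta>_def by (simp add: power2_eq_square distrib_left del: of_nat_Suc)
    finally show ?thesis .
  qed
  also have "exp ((2 * m + sg\<^sup>2) * \<delta>) ^ Suc n = exp ((2 * m + sg\<^sup>2) * T)"
    unfolding exp_of_nat_mult[symmetric] \<delta>(2)[symmetric] by (simp only: mult_ac)
  finally show "expectation (\<lambda>\<omega>. ((\<Prod>j<Suc n. 1 + m * (T / real (Suc n)) + sg * \<Delta> n j \<omega>)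
     - (\<Prod>j<Suc n. exp ((m - sg\<^sup>2 / 2) * (T / real (Suc n)) + sg * \<Delta> n j \<omega>)))\<^sup>2) \<le>
    exp ((2 * m + sg\<^sup>2) * T + m\<^sup>2 * T\<^sup>2 / real (Suc n)) - 2 * (exp (m * (T / real (Suc n))) * (1 + m * (T / real (Suc n)) + sg\<^sup>2 * (T / real (Suc n)))) ^ Suc n
     + exp ((2 * m + sg\<^sup>2) * T)"
    unfolding PE by (simp only: \<delta>_def)
qed (rule tendsto_moments)

text \<open>The Euler product is close both to the solution and to the product of exponentials. In
  the latter the exponents add up and the increments of \<open>W\<close> telescope, whatever the
  mesh. The difference of the two limits thus does not depend on \<open>n\<close>, and
  \<open>vanishes_const\<close> turns smallness in probability into almost sure equality.\<close>

theorem linear_sde_solution_AE: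
  fixes m sg z t :: real
  assumes F: "\<And>t. 0 \<le> t \<Longrightarrow> FF (ennreal t) = F t"
    and sde: "sde_solution N FF W (\<lambda>x. m * x) (\<lambda>x. sg * x) z Z" and t: "0 \<le> t"
  shows "AE \<omega> in N. Z t \<omega> = z * exp ((m - sg\<^sup>2 / 2) * t + sg * W t \<omega>)"
proof (cases "t = 0")
  case True
  have "AE \<omega> in N. Z 0 \<omega> = z" using sde by (simp add: sde_solution_def)
  with W_0 have "AE \<omega> in N. Z 0 \<omega> = z * exp ((m - sg\<^sup>2 / 2) * 0 + sg * W 0 \<omega>)" by eventually_elim simp
  with True show ?thesis by simp
next
  case False
  then have t0: "0 < t" using t by simp
  define P where "P = (\<lambda>n \<omega>. \<Prod>j<n. 1 + m * (t / real n) + sg * (W (real (Suc j) * (t / real n)) \<omega> - W (real j * (t / real n)) \<omega>))"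
  define E where "E = (\<lambda>n \<omega>. \<Prod>j<n. exp ((m - sg\<^sup>2 / 2) * (t / real n) + sg * (W (real (Suc j) * (t / real n)) \<omega> - W (real j * (t / real n)) \<omega>)))"
  have "vanishes (\<lambda>n \<omega>. Z t \<omega> - z * P n \<omega>)" unfolding P_def by (rule euler_vanishes[OF F sde t0])
  then have v1: "vanishes (\<lambda>n \<omega>. Z t \<omega> - z * P (Suc n) \<omega>)"
    unfolding vanishes_def by (intro allI impI) (subst eventually_sequentially_Suc, blast)
  have "vanishes (\<lambda>n \<omega>. P (Suc n) \<omega> - E (Suc n) \<omega>)" unfolding P_def E_def by (rule euler_product_vanishes[OF t])
  then have v2: "vanishes (\<lambda>n \<omega>. z * (P (Suc n) \<omega> - E (Suc n) \<omega>))"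
    by (rule vanishes_dominated[where C = "\<bar>z\<bar>"]) (auto simp: abs_mult)
  have "vanishes (\<lambda>n \<omega>. Z t \<omega> - z * exp ((m - sg\<^sup>2 / 2) * t + sg * W t \<omega>))"
  proof (rule vanishes_dominated[OF vanishes_add[OF v1 v2], where C = 1])
    fix n
    show "AE \<omega> in N. \<bar>Z t \<omega> - z * exp ((m - sg\<^sup>2 / 2) * t + sg * W t \<omega>)\<bar> \<le>
      1 * \<bar>Z t \<omega> - z * P (Suc n) \<omega> + z * (P (Suc n) \<omega> - E (Suc n) \<omega>)\<bar>"
      using W_0
    proof eventually_elim
      case (elim \<omega>)
      have "E (Suc n) \<omega> = exp (\<Sum>j<Suc n. (m - sg\<^sup>2 / 2) * (t / real (Suc n)) + sg * (W (real (Suc j) * (t / real (Suc n))) \<omega> - W (real j * (t / real (Suc n))) \<omega>))"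
        unfolding E_def by (rule exp_sum[symmetric]) simp
      also have "(\<Sum>j<Suc n. (m - sg\<^sup>2 / 2) * (t / real (Suc n)) + sg * (W (real (Suc j) * (t / real (Suc n))) \<omega> - W (real j * (t / real (Suc n))) \<omega>))
        = real (Suc n) * ((m - sg\<^sup>2 / 2) * (t / real (Suc n))) + sg * (\<Sum>j<Suc n. W (real (Suc j) * (t / real (Suc n))) \<omega> - W (real j * (t / real (Suc n))) \<omega>)"
        unfolding sum.distrib sum_distrib_left by (simp del: of_nat_Suc sum.lessThan_Suc)
      also have "(\<Sum>j<Suc n. W (real (Suc j) * (t / real (Suc n))) \<omega> - W (real j * (t / real (Suc n))) \<omega>) = W t \<omega>"
        unfolding sum_lessThan_telescope[of "\<lambda>j. W (real j * (t / real (Suc n))) \<omega>"] using elim by (simp del: of_nat_Suc)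
      also have "real (Suc n) * ((m - sg\<^sup>2 / 2) * (t / real (Suc n))) = (m - sg\<^sup>2 / 2) * t" by (simp del: of_nat_Suc)
      finally show ?case by (simp add: algebra_simps)
    qed
  qed simp
  from vanishes_const[OF this] show ?thesis by eventually_elim simp
qed

end

section \<open>Linear combinations of Brownian motions in the completed filtration\<close>

lemma measure_gauss_scale:
  assumes "0 < \<sigma>" and C[measurable]: "C \<in> sets borel"
  shows "measure gauss {y. \<sigma> * y \<in> C} = measure (density lborel (normal_density 0 \<sigma>)) C"
proof -
  interpret g: prob_space gauss by (rule prob_space_gauss)
  have "distributed gauss lborel (\<lambda>y. y) (normal_density 0 1)"
    unfolding distributed_def by (auto intro!: distr_id2)
  from g.normal_density_affine[OF this, of \<sigma> 0] assms
  have "distributed gauss lborel (\<lambda>y. \<sigma> * y) (normal_density 0 \<sigma>)" by simp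
  then have "density lborel (normal_density 0 \<sigma>) = distr gauss lborel (\<lambda>y. \<sigma> * y)"
    by (simp add: distributed_distr_eq_density)
  then show ?thesis by (simp add: measure_distr vimage_def)
qed

lemma (in prob_space) measure_distributed_normal:
  assumes D: "distributed M lborel X (normal_density 0 \<sigma>)" and "0 < \<sigma>" and C[measurable]: "C \<in> sets borel"
  shows "prob {\<omega>\<in>space M. X \<omega> \<in> C} = measure gauss {y. \<sigma> * y \<in> C}"
proof -
  have [measurable]: "X \<in> borel_measurable M" using distributed_measurable[OF D] by simp
  have "prob {\<omega>\<in>space M. X \<omega> \<in> C} = measure (distr M lborel X) C"
    by (subst measure_distr) (auto simp: vimage_def Int_def conj_commute)
  then show ?thesis
    using assms by (simp add: measure_gauss_scale distributed_distr_eq_density)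
qed

text \<open>For finite \<open>U\<close> these are the cylinder events. Intersections of one for each
  Brownian motion form a class closed under intersection which, with the null sets, generates the
  completed natural filtration.\<close>

definition path_event :: "'a measure \<Rightarrow> (real \<Rightarrow> 'a \<Rightarrow> real) \<Rightarrow> real set \<Rightarrow> (real \<Rightarrow> real set) \<Rightarrow> 'a set" where
  "path_event M B U A = {\<omega>\<in>space M. \<forall>u\<in>U. B u \<omega> \<in> A u}"

lemma path_event_Int:
  "path_event M B U A \<inter> path_event M B U' A' =
   path_event M B (U \<union> U') (\<lambda>u. (if u \<in> U then A u else UNIV) \<inter> (if u \<in> U' then A' u else UNIV))"
  unfolding path_event_def by auto

lemma path_event_sets:
  assumes "finite U" "\<And>u. u \<in> U \<Longrightarrow> B u \<in> borel_measurable M" "\<And>u. A u \<in> sets borel"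
  shows "path_event M B U A \<in> sets M"
  unfolding path_event_def
  using assms measurable_sets[of "B _" M borel "A _"]
  by (intro sets_Collect_ball_countable countable_finite) (auto simp: vimage_def Int_def conj_commute)

text \<open>Along a grid through \<open>U\<close> the values of \<open>B\<close> are, up to the null
  set where \<open>B 0\<close> differs from \<open>0\<close>, partial sums of increments;
  independence of the increments then separates the last one, from \<open>s\<close> to
  \<open>t\<close>, from all earlier ones.\<close>

lemma (in prob_space) brownian_increment_indep:
  assumes bm: "brownian_motion M B" and U: "finite U" "U \<subseteq> {0..s}" and s: "0 \<le> s" "s < t"
    and A[measurable]: "\<And>u. A u \<in> sets borel" and C[measurable]: "C \<in> sets borel"
  shows "prob (path_event M B U A \<inter> {\<omega>\<in>space M. B t \<omega> - B s \<omega> \<in> C}) =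
         prob (path_event M B U A) * prob {\<omega>\<in>space M. B t \<omega> - B s \<omega> \<in> C}"
proof -
  have Bm: "B u \<in> borel_measurable M" if "0 \<le> u" for u using bm that by (simp add: brownian_motion_def)
  have B0: "AE \<omega> in M. B 0 \<omega> = 0" using bm by (simp add: brownian_motion_def)
  obtain t' :: "nat \<Rightarrow> real" and n where t': "t' 0 = 0" "t' n = s" "\<And>i. i < n \<Longrightarrow> t' i < t' (Suc i)"
    and tU: "\<And>d. d \<in> U \<Longrightarrow> 0 \<le> d \<Longrightarrow> d \<le> s \<Longrightarrow> d \<in> t' ` {..n}"
    using ex_grid[OF U(1) s(1)] by metis
  have "\<forall>u\<in>U. \<exists>i. i \<le> n \<and> t' i = u" using tU U(2) by (fastforce simp: image_iff)
  then obtain idx where idx: "\<And>u. u \<in> U \<Longrightarrow> idx u \<le> n" "\<And>u. u \<in> U \<Longrightarrow> t' (idx u) = u" by metis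
  \<comment> \<open>The grid up to \<open>s\<close> is prolonged by the single time
    \<open>t\<close>, so the increment with index \<open>n\<close> is the one from \<open>s\<close>
    to \<open>t\<close>.\<close>
  define tp where "tp = (\<lambda>i. if i \<le> n then t' i else t)"
  have inc: "tp i < tp (Suc i)" if "i < Suc n" for i
    using that t'(2,3) s(2) by (cases "i = n") (auto simp: tp_def)
  have sm: "strict_mono_on {..Suc n} tp"
  proof (rule strict_mono_onI)
    fix i j assume "i \<in> {..Suc n}" "j \<in> {..Suc n}" "i < j"
    then show "tp i < tp j"
    proof (induction j)
      case (Suc j)
      then show ?case using inc[of j] by (cases "i = j") (auto intro: less_trans)
    qed simp
  qed
  define X where "X = (\<lambda>i \<omega>. B (tp (Suc i)) \<omega> - B (tp i) \<omega>)"
  have "0 \<le> tp 0" using t' by (simp add: tp_def)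
  then have "indep_vars (\<lambda>_. borel) X {..<Suc n}"
    using bm sm unfolding brownian_motion_def X_def by blast
  from indep_var_restrict[OF this, of "{..<n}" "{n}"]
  have iv: "indep_var (PiM {..<n} (\<lambda>_. borel)) (\<lambda>\<omega>. restrict (\<lambda>i. X i \<omega>) {..<n}) (PiM {n} (\<lambda>_. borel)) (\<lambda>\<omega>. restrict (\<lambda>i. X i \<omega>) {n})"
    by auto
  define SA where "SA = {x\<in>space (PiM {..<n} (\<lambda>_. borel :: real measure)). \<forall>u\<in>U. (\<Sum>j<idx u. x j) \<in> A u}"
  define SC where "SC = {x\<in>space (PiM {n} (\<lambda>_. borel :: real measure)). x n \<in> C}"
  have SA: "SA \<in> sets (PiM {..<n} (\<lambda>_. borel))"
    unfolding SA_def
  proof (rule sets_Collect_ball_countable[OF countable_finite[OF U(1)]])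
    fix u assume u: "u \<in> U"
    have "(\<lambda>x. \<Sum>j<idx u. x j) \<in> borel_measurable (PiM {..<n} (\<lambda>_. borel :: real measure))"
      using idx(1)[OF u] by (intro borel_measurable_sum measurable_component_singleton) auto
    from measurable_sets[OF this A[of u]]
    show "{x\<in>space (PiM {..<n} (\<lambda>_. borel)). (\<Sum>j<idx u. x j) \<in> A u} \<in> sets (PiM {..<n} (\<lambda>_. borel))"
      by (simp add: vimage_def Int_def conj_commute)
  qed
  have SC: "SC \<in> sets (PiM {n} (\<lambda>_. borel))"
    unfolding SC_def by measurable
  have XSA: "(\<lambda>\<omega>. restrict (\<lambda>i. X i \<omega>) {..<n}) -` SA \<inter> space M = {\<omega>\<in>space M. \<forall>u\<in>U. (\<Sum>j<idx u. X j \<omega>) \<in> A u}"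
  proof -
    have "(\<Sum>j<idx u. restrict (\<lambda>i. X i \<omega>) {..<n} j) = (\<Sum>j<idx u. X j \<omega>)" if "u \<in> U" for u \<omega>
      using idx(1)[OF that] by (intro sum.cong) auto
    then show ?thesis unfolding SA_def by (auto simp: space_PiM)
  qed
  have tp2: "tp (Suc n) = t" "tp n = s" using t'(2) by (auto simp: tp_def)
  have XSC: "(\<lambda>\<omega>. restrict (\<lambda>i. X i \<omega>) {n}) -` SC \<inter> space M = {\<omega>\<in>space M. B t \<omega> - B s \<omega> \<in> C}"
    unfolding SC_def X_def by (auto simp: space_PiM tp2)
  \<comment> \<open>Where \<open>B 0\<close> is \<open>0\<close> the partial sums telescope to the
    values of \<open>B\<close>; elsewhere the two events may differ, so only their probabilities are
    compared.\<close>
  have AE_eq: "AE \<omega> in M. (\<forall>u\<in>U. (\<Sum>j<idx u. X j \<omega>) \<in> A u) \<longleftrightarrow> (\<forall>u\<in>U. B u \<omega> \<in> A u)"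
    using B0
  proof eventually_elim
    case (elim \<omega>)
    have "(\<Sum>j<idx u. X j \<omega>) = B u \<omega>" if "u \<in> U" for u
    proof -
      have "(\<Sum>j<idx u. X j \<omega>) = B (tp (idx u)) \<omega> - B (tp 0) \<omega>"
        unfolding X_def by (rule sum_lessThan_telescope[of "\<lambda>j. B (tp j) \<omega>"])
      then show ?thesis using idx[OF that] t'(1) elim by (simp add: tp_def)
    qed
    then show ?case by simp
  qed
  have [measurable]: "B t \<in> borel_measurable M" "B s \<in> borel_measurable M"
    using Bm s by auto
  have [measurable]: "{\<omega>\<in>space M. B t \<omega> - B s \<omega> \<in> C} \<in> events"
    by measurable
  have e1: "path_event M B U A \<in> events" using U by (intro path_event_sets Bm A) auto
  have e2: "{\<omega>\<in>space M. \<forall>u\<in>U. (\<Sum>j<idx u. X j \<omega>) \<in> A u} \<in> events"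
    using measurable_sets[OF indep_var_rv1[OF iv] SA] unfolding XSA .
  have "prob (path_event M B U A) = prob {\<omega>\<in>space M. \<forall>u\<in>U. (\<Sum>j<idx u. X j \<omega>) \<in> A u}"
    using AE_eq e1 e2 by (intro finite_measure_eq_AE) (auto simp: path_event_def)
  moreover have "prob (path_event M B U A \<inter> {\<omega>\<in>space M. B t \<omega> - B s \<omega> \<in> C}) =
     prob ({\<omega>\<in>space M. \<forall>u\<in>U. (\<Sum>j<idx u. X j \<omega>) \<in> A u} \<inter> {\<omega>\<in>space M. B t \<omega> - B s \<omega> \<in> C})"
    using AE_eq e1 e2 by (intro finite_measure_eq_AE) (auto simp: path_event_def)
  moreover have "{\<omega>\<in>space M. \<forall>u\<in>U. (\<Sum>j<idx u. X j \<omega>) \<in> A u} \<inter> {\<omega>\<in>space M. B t \<omega> - B s \<omega> \<in> C} =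
     (\<lambda>\<omega>. (restrict (\<lambda>i. X i \<omega>) {..<n}, restrict (\<lambda>i. X i \<omega>) {n})) -` (SA \<times> SC) \<inter> space M"
    using XSA XSC by blast
  ultimately show ?thesis using indep_varD[OF iv SA SC] unfolding XSA XSC by simp
qed

text \<open>Independence of the processes splits the event into one for each process, and each
  process separates its own past from its increment. The same splitting with \<open>UNIV\<close> as
  the target of both increments recombines the two pasts.\<close>

lemma (in prob_space) two_brownian_indep:
  assumes bm: "brownian_motion M B1" "brownian_motion M B2" and ip: "indep_processes M B1 B2"
    and U: "finite U1" "U1 \<subseteq> {0..s}" "finite U2" "U2 \<subseteq> {0..s}" and s: "0 \<le> s" "s < t"
    and A[measurable]: "\<And>u. A1 u \<in> sets borel" "\<And>u. A2 u \<in> sets borel"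
    and C[measurable]: "C1 \<in> sets borel" "C2 \<in> sets borel"
  shows "prob (path_event M B1 U1 A1 \<inter> path_event M B2 U2 A2 \<inter> {\<omega>\<in>space M. B1 t \<omega> - B1 s \<omega> \<in> C1 \<and> B2 t \<omega> - B2 s \<omega> \<in> C2}) =
    prob (path_event M B1 U1 A1 \<inter> path_event M B2 U2 A2) *
    (prob {\<omega>\<in>space M. B1 t \<omega> - B1 s \<omega> \<in> C1} * prob {\<omega>\<in>space M. B2 t \<omega> - B2 s \<omega> \<in> C2})"
proof -
  have prod: "prob ((path_event M B1 U1 A1 \<inter> {\<omega>\<in>space M. B1 t \<omega> - B1 s \<omega> \<in> D1}) \<inter> (path_event M B2 U2 A2 \<inter> {\<omega>\<in>space M. B2 t \<omega> - B2 s \<omega> \<in> D2}))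
    = prob (path_event M B1 U1 A1 \<inter> {\<omega>\<in>space M. B1 t \<omega> - B1 s \<omega> \<in> D1}) * prob (path_event M B2 U2 A2 \<inter> {\<omega>\<in>space M. B2 t \<omega> - B2 s \<omega> \<in> D2})"
    if D: "D1 \<in> sets borel" "D2 \<in> sets borel" for D1 D2
  proof -
    define P where "P = (\<lambda>U A (D::real set). {x\<in>space (PiM {0..} (\<lambda>_::real. borel :: real measure)). (\<forall>u\<in>U. x u \<in> A u) \<and> x t - x s \<in> D})"
    have P: "P U A D \<in> sets (PiM {0..} (\<lambda>_. borel))" if "finite U" "U \<subseteq> {0..s}" "\<And>u. A u \<in> sets borel" "D \<in> sets borel" for U A D
    proof -
      have [measurable]: "(\<lambda>x. x u) \<in> borel_measurable (PiM {0..} (\<lambda>_. borel :: real measure))" if "0 \<le> u" for u :: real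
        by (rule measurable_component_singleton) (use that in auto)
      have "{x\<in>space (PiM {0..} (\<lambda>_. borel :: real measure)). \<forall>u\<in>U. x u \<in> A u} \<in> sets (PiM {0..} (\<lambda>_. borel))"
      proof (rule sets_Collect_ball_countable[OF countable_finite[OF that(1)]])
        fix u assume "u \<in> U"
        then have "0 \<le> u" using that(2) by auto
        from measurable_sets[OF measurable_component_singleton[of u "{0..}" "\<lambda>_. borel :: real measure"] that(3)[of u]] this
        show "{x\<in>space (PiM {0..} (\<lambda>_. borel :: real measure)). x u \<in> A u} \<in> sets (PiM {0..} (\<lambda>_. borel))"
          by (simp add: vimage_def Int_def conj_commute)
      qed
      moreover have "{x\<in>space (PiM {0..} (\<lambda>_. borel :: real measure)). x t - x s \<in> D} \<in> sets (PiM {0..} (\<lambda>_. borel))"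
      proof -
        have "(\<lambda>x. x t - x s) \<in> borel_measurable (PiM {0..} (\<lambda>_. borel :: real measure))"
          using s by (intro borel_measurable_diff measurable_component_singleton) auto
        from measurable_sets[OF this that(4)] show ?thesis by (simp add: vimage_def Int_def conj_commute)
      qed
      ultimately have "{x\<in>space (PiM {0..} (\<lambda>_. borel :: real measure)). \<forall>u\<in>U. x u \<in> A u} \<inter> {x\<in>space (PiM {0..} (\<lambda>_. borel :: real measure)). x t - x s \<in> D} \<in> sets (PiM {0..} (\<lambda>_. borel))"
        by (rule sets.Int)
      moreover have "{x\<in>space (PiM {0..} (\<lambda>_. borel :: real measure)). \<forall>u\<in>U. x u \<in> A u} \<inter> {x\<in>space (PiM {0..} (\<lambda>_. borel :: real measure)). x t - x s \<in> D} = P U A D"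
        unfolding P_def by auto
      ultimately show ?thesis by simp
    qed
    have V: "(\<lambda>\<omega>. \<lambda>t\<in>{0..}. B t \<omega>) -` P U A D \<inter> space M = path_event M B U A \<inter> {\<omega>\<in>space M. B t \<omega> - B s \<omega> \<in> D}"
      if "U \<subseteq> {0..s}" for B U A D
    proof -
      have "restrict (\<lambda>t. B t \<omega>) {0..} u = B u \<omega>" if "u \<in> U" for u \<omega>
        using that \<open>U \<subseteq> {0..s}\<close> by auto
      then show ?thesis using s unfolding P_def path_event_def by (auto simp: space_PiM)
    qed
    have eq: "(\<lambda>x. (\<lambda>t\<in>{0..}. B1 t x, \<lambda>t\<in>{0..}. B2 t x)) -` (P U1 A1 D1 \<times> P U2 A2 D2) \<inter> space M =
      ((\<lambda>\<omega>. \<lambda>t\<in>{0..}. B1 t \<omega>) -` P U1 A1 D1 \<inter> space M) \<inter> ((\<lambda>\<omega>. \<lambda>t\<in>{0..}. B2 t \<omega>) -` P U2 A2 D2 \<inter> space M)"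
      by auto
    show ?thesis
      using indep_varD[OF ip[unfolded indep_processes_def] P[of U1 A1 D1, OF U(1,2) A(1) D(1)] P[of U2 A2 D2, OF U(3,4) A(2) D(2)]]
      unfolding eq V[OF U(2)] V[OF U(4)] .
  qed
  have i1: "prob (path_event M B1 U1 A1 \<inter> {\<omega>\<in>space M. B1 t \<omega> - B1 s \<omega> \<in> C1}) = prob (path_event M B1 U1 A1) * prob {\<omega>\<in>space M. B1 t \<omega> - B1 s \<omega> \<in> C1}"
    by (rule brownian_increment_indep[OF bm(1) U(1,2) s A(1) C(1)])
  have i2: "prob (path_event M B2 U2 A2 \<inter> {\<omega>\<in>space M. B2 t \<omega> - B2 s \<omega> \<in> C2}) = prob (path_event M B2 U2 A2) * prob {\<omega>\<in>space M. B2 t \<omega> - B2 s \<omega> \<in> C2}"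
    by (rule brownian_increment_indep[OF bm(2) U(3,4) s A(2) C(2)])
  have "path_event M B U A \<inter> {\<omega>\<in>space M. B t \<omega> - B s \<omega> \<in> UNIV} = path_event M B U A" for B U A
    unfolding path_event_def by auto
  then have i3: "prob (path_event M B1 U1 A1 \<inter> path_event M B2 U2 A2) = prob (path_event M B1 U1 A1) * prob (path_event M B2 U2 A2)"
    using prod[of UNIV UNIV] by simp
  have "path_event M B1 U1 A1 \<inter> path_event M B2 U2 A2 \<inter> {\<omega>\<in>space M. B1 t \<omega> - B1 s \<omega> \<in> C1 \<and> B2 t \<omega> - B2 s \<omega> \<in> C2} =
    (path_event M B1 U1 A1 \<inter> {\<omega>\<in>space M. B1 t \<omega> - B1 s \<omega> \<in> C1}) \<inter> (path_event M B2 U2 A2 \<inter> {\<omega>\<in>space M. B2 t \<omega> - B2 s \<omega> \<in> C2})"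
    by auto
  then show ?thesis using prod[OF C] i1 i2 i3 by simp
qed

text \<open>The increment of \<open>W\<close> depends on both increments at once, so product events
  are not enough: the joint law of the pair has to be known on each event of the past. It is a
  product measure, determined on rectangles by \<open>two_brownian_indep\<close>. The combination is
  then a sum of independent normal variables, rescaled to variance \<open>t - s\<close>.\<close>

lemma (in prob_space) brownian_combination_increment:
  fixes b1 b2 :: real
  assumes bm: "brownian_motion M B1" "brownian_motion M B2" and ip: "indep_processes M B1 B2"
    and U: "finite U1" "U1 \<subseteq> {0..s}" "finite U2" "U2 \<subseteq> {0..s}" and s: "0 \<le> s" "s < t"
    and A: "\<And>u. A1 u \<in> sets borel" "\<And>u. A2 u \<in> sets borel" and C[measurable]: "C \<in> sets borel"
    and b: "b1\<^sup>2 + b2\<^sup>2 > 0"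
  defines "W \<equiv> \<lambda>t \<omega>. (b1 * B1 t \<omega> + b2 * B2 t \<omega>) / sqrt (b1\<^sup>2 + b2\<^sup>2)"
  shows "prob (path_event M B1 U1 A1 \<inter> path_event M B2 U2 A2 \<inter> {\<omega>\<in>space M. W t \<omega> - W s \<omega> \<in> C}) =
    prob (path_event M B1 U1 A1 \<inter> path_event M B2 U2 A2) * measure gauss {y. sqrt (t - s) * y \<in> C}"
proof -
  have m[measurable]: "B1 t \<in> borel_measurable M" "B1 s \<in> borel_measurable M" "B2 t \<in> borel_measurable M" "B2 s \<in> borel_measurable M"
    using bm s by (auto simp: brownian_motion_def)
  define D1 where "D1 = (\<lambda>\<omega>. B1 t \<omega> - B1 s \<omega>)"
  define D2 where "D2 = (\<lambda>\<omega>. B2 t \<omega> - B2 s \<omega>)"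
  have Dm[measurable]: "D1 \<in> borel_measurable M" "D2 \<in> borel_measurable M" unfolding D1_def D2_def by measurable
  define L where "L = distr M borel D1 \<Otimes>\<^sub>M distr M borel D2"
  interpret P1: prob_space "distr M borel D1" by (rule prob_space_distr) simp
  interpret P2: prob_space "distr M borel D2" by (rule prob_space_distr) simp
  have sL: "sets L = sets (borel \<Otimes>\<^sub>M borel)" unfolding L_def by (rule sets_pair_measure_cong) auto
  have key: "emeasure M (E \<inter> {\<omega>\<in>space M. (D1 \<omega>, D2 \<omega>) \<in> S}) = emeasure M E * emeasure L S"
    if S: "S \<in> sets (borel \<Otimes>\<^sub>M borel)" and E: "E = path_event M B1 V1 A1 \<inter> path_event M B2 V2 A2" and V: "finite V1" "V1 \<subseteq> {0..s}" "finite V2" "V2 \<subseteq> {0..s}"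
    for S E V1 V2
  proof (cases "emeasure M E = 0")
    case True
    have "emeasure M (E \<inter> {\<omega>\<in>space M. (D1 \<omega>, D2 \<omega>) \<in> S}) \<le> emeasure M E"
    proof (rule emeasure_mono)
      show "E \<in> events" unfolding E using bm A V by (intro sets.Int path_event_sets) (auto simp: brownian_motion_def)
    qed auto
    then show ?thesis using True by simp
  next
    case False
    have Ee: "E \<in> events" unfolding E using bm A V by (intro sets.Int path_event_sets) (auto simp: brownian_motion_def)
    \<comment> \<open>Conditioning on \<open>E\<close> turns the claim into an equality of two
      probability measures, which is checked on rectangles; this is why null events \<open>E\<close>
      are treated apart.\<close>
    let ?Q = "uniform_measure M E"
    have Dm': "(\<lambda>\<omega>. (D1 \<omega>, D2 \<omega>)) \<in> ?Q \<rightarrow>\<^sub>M borel \<Otimes>\<^sub>M borel" by measurable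
    have "L = distr ?Q (borel \<Otimes>\<^sub>M borel) (\<lambda>\<omega>. (D1 \<omega>, D2 \<omega>))"
      unfolding L_def
    proof (rule pair_measure_eqI)
      show "sigma_finite_measure (distr M borel D1)" "sigma_finite_measure (distr M borel D2)" ..
      fix X Y assume "X \<in> sets (distr M borel D1)" "Y \<in> sets (distr M borel D2)"
      then have X[measurable]: "X \<in> sets borel" and Y[measurable]: "Y \<in> sets borel" by auto
      have "emeasure (distr ?Q (borel \<Otimes>\<^sub>M borel) (\<lambda>\<omega>. (D1 \<omega>, D2 \<omega>))) (X \<times> Y) = emeasure ?Q ((\<lambda>\<omega>. (D1 \<omega>, D2 \<omega>)) -` (X \<times> Y) \<inter> space ?Q)"
        by (rule emeasure_distr[OF Dm']) auto
      also have "(\<lambda>\<omega>. (D1 \<omega>, D2 \<omega>)) -` (X \<times> Y) \<inter> space ?Q = {\<omega>\<in>space M. D1 \<omega> \<in> X \<and> D2 \<omega> \<in> Y}" by auto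
      also have "emeasure ?Q {\<omega>\<in>space M. D1 \<omega> \<in> X \<and> D2 \<omega> \<in> Y} = emeasure M (E \<inter> {\<omega>\<in>space M. D1 \<omega> \<in> X \<and> D2 \<omega> \<in> Y}) / emeasure M E"
        by (rule emeasure_uniform_measure[OF Ee]) measurable
      also have "emeasure M (E \<inter> {\<omega>\<in>space M. D1 \<omega> \<in> X \<and> D2 \<omega> \<in> Y}) = emeasure M E * (emeasure M {\<omega>\<in>space M. D1 \<omega> \<in> X} * emeasure M {\<omega>\<in>space M. D2 \<omega> \<in> Y})"
        using two_brownian_indep[OF bm ip V s A X Y] unfolding E D1_def D2_def
        by (simp add: emeasure_eq_measure ennreal_mult)
      also have "\<dots> / emeasure M E = emeasure M {\<omega>\<in>space M. D1 \<omega> \<in> X} * emeasure M {\<omega>\<in>space M. D2 \<omega> \<in> Y}"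
      proof -
        have "0 < prob E" using False by (simp add: emeasure_eq_measure zero_less_measure_iff)
        then show ?thesis by (simp add: emeasure_eq_measure ennreal_mult[symmetric] divide_ennreal)
      qed
      also have "\<dots> = emeasure (distr M borel D1) X * emeasure (distr M borel D2) Y"
        by (simp add: emeasure_distr vimage_def Int_def conj_commute)
      finally show "emeasure (distr M borel D1) X * emeasure (distr M borel D2) Y = emeasure (distr ?Q (borel \<Otimes>\<^sub>M borel) (\<lambda>\<omega>. (D1 \<omega>, D2 \<omega>))) (X \<times> Y)" ..
    qed (use sL in \<open>simp add: L_def\<close>)
    then have "emeasure L S = emeasure ?Q ((\<lambda>\<omega>. (D1 \<omega>, D2 \<omega>)) -` S \<inter> space ?Q)"
      using emeasure_distr[OF Dm' S] by simp
    also have "(\<lambda>\<omega>. (D1 \<omega>, D2 \<omega>)) -` S \<inter> space ?Q = {\<omega>\<in>space M. (D1 \<omega>, D2 \<omega>) \<in> S}" by auto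
    also have "emeasure ?Q {\<omega>\<in>space M. (D1 \<omega>, D2 \<omega>) \<in> S} = emeasure M (E \<inter> {\<omega>\<in>space M. (D1 \<omega>, D2 \<omega>) \<in> S}) / emeasure M E"
      by (rule emeasure_uniform_measure[OF Ee]) (use S in measurable)
    finally have "emeasure M E * emeasure L S = emeasure M (E \<inter> {\<omega>\<in>space M. (D1 \<omega>, D2 \<omega>) \<in> S}) * (emeasure M E / emeasure M E)"
      by (metis ennreal_divide_times mult.commute)
    also have "emeasure M E / emeasure M E = 1"
      using False by (intro ennreal_divide_self) (auto simp: emeasure_eq_measure)
    finally show ?thesis by simp
  qed
  have sp: "space M = path_event M B1 {} A1 \<inter> path_event M B2 {} A2" by (simp add: path_event_def)
  have L: "emeasure L S = emeasure M {\<omega>\<in>space M. (D1 \<omega>, D2 \<omega>) \<in> S}" if "S \<in> sets (borel \<Otimes>\<^sub>M borel)" for S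
    using key[OF that sp] by (simp add: emeasure_space_1 Int_def)
  have ind: "indep_var borel D1 borel D2"
    unfolding indep_var_distribution_eq
  proof (intro conjI Dm measure_eqI)
    show "sets (distr M borel D1 \<Otimes>\<^sub>M distr M borel D2) = sets (distr M (borel \<Otimes>\<^sub>M borel) (\<lambda>x. (D1 x, D2 x)))"
      using sL by (simp add: L_def)
    fix S assume "S \<in> sets (distr M borel D1 \<Otimes>\<^sub>M distr M borel D2)"
    then have S: "S \<in> sets (borel \<Otimes>\<^sub>M borel)" using sL by (simp add: L_def)
    show "emeasure (distr M borel D1 \<Otimes>\<^sub>M distr M borel D2) S = emeasure (distr M (borel \<Otimes>\<^sub>M borel) (\<lambda>x. (D1 x, D2 x))) S"
      using L[OF S] S unfolding L_def[symmetric]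
      by (subst emeasure_distr) (auto simp: vimage_def Int_def conj_commute)
  qed
  have st: "0 < sqrt (t - s)" using s by simp
  have n: "distributed M lborel D1 (normal_density 0 (sqrt (t - s)))" "distributed M lborel D2 (normal_density 0 (sqrt (t - s)))"
    using bm s by (auto simp: brownian_motion_def D1_def D2_def)
  have nsum: "distributed M lborel (\<lambda>\<omega>. b1 * D1 \<omega> + b2 * D2 \<omega>) (normal_density 0 (sqrt (b1\<^sup>2 + b2\<^sup>2) * sqrt (t - s)))"
  \<comment> \<open>A vanishing coefficient gives a degenerate summand, which has no normal density;
    in that case the other summand is merely rescaled.\<close>
  proof (cases "b1 = 0 \<or> b2 = 0")
    case True
    have aff: "distributed M lborel (\<lambda>\<omega>. c * X \<omega>) (normal_density 0 (\<bar>c\<bar> * sqrt (t - s)))"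
      if "c \<noteq> 0" "distributed M lborel X (normal_density 0 (sqrt (t - s)))" for c X
      using normal_density_affine[OF that(2) st that(1), of 0] by simp
    from True show ?thesis using b aff[OF _ n(1), of b1] aff[OF _ n(2), of b2] by auto
  next
    case False
    have a1: "distributed M lborel (\<lambda>\<omega>. b1 * D1 \<omega>) (normal_density 0 (\<bar>b1\<bar> * sqrt (t - s)))"
      using normal_density_affine[OF n(1) st, of b1 0] False by simp
    have a2: "distributed M lborel (\<lambda>\<omega>. b2 * D2 \<omega>) (normal_density 0 (\<bar>b2\<bar> * sqrt (t - s)))"
      using normal_density_affine[OF n(2) st, of b2 0] False by simp
    have "indep_var borel ((\<lambda>x. b1 * x) \<circ> D1) borel ((\<lambda>x. b2 * x) \<circ> D2)"
      by (rule indep_var_compose[OF ind]) auto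
    then have ic: "indep_var borel (\<lambda>\<omega>. b1 * D1 \<omega>) borel (\<lambda>\<omega>. b2 * D2 \<omega>)" by (simp add: comp_def)
    have "distributed M lborel (\<lambda>\<omega>. b1 * D1 \<omega> + b2 * D2 \<omega>) (normal_density (0 + 0) (sqrt ((\<bar>b1\<bar> * sqrt (t - s))\<^sup>2 + (\<bar>b2\<bar> * sqrt (t - s))\<^sup>2)))"
      using False st by (intro add_indep_normal[OF ic _ _ a1 a2]) auto
    moreover have "(\<bar>b1\<bar> * sqrt (t - s))\<^sup>2 + (\<bar>b2\<bar> * sqrt (t - s))\<^sup>2 = (b1\<^sup>2 + b2\<^sup>2) * (t - s)"
      using s by (simp add: power_mult_distrib algebra_simps)
    ultimately show ?thesis by (simp add: real_sqrt_mult)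
  qed
  have bs: "0 < sqrt (b1\<^sup>2 + b2\<^sup>2)" using b by simp
  have nz: "\<not> (b1 = 0 \<and> b2 = 0)" using b by auto
  have "distributed M lborel (\<lambda>\<omega>. 0 + (1 / sqrt (b1\<^sup>2 + b2\<^sup>2)) * (b1 * D1 \<omega> + b2 * D2 \<omega>))
     (normal_density (0 + (1 / sqrt (b1\<^sup>2 + b2\<^sup>2)) * 0) (\<bar>1 / sqrt (b1\<^sup>2 + b2\<^sup>2)\<bar> * (sqrt (b1\<^sup>2 + b2\<^sup>2) * sqrt (t - s))))"
    by (rule normal_density_affine[OF nsum]) (use bs st in auto)
  then have nW: "distributed M lborel (\<lambda>\<omega>. (b1 * D1 \<omega> + b2 * D2 \<omega>) / sqrt (b1\<^sup>2 + b2\<^sup>2)) (normal_density 0 (sqrt (t - s)))"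
    using bs nz by simp
  define f where "f = (\<lambda>(x, y). (b1 * x + b2 * y) / sqrt (b1\<^sup>2 + b2\<^sup>2))"
  have f[measurable]: "f \<in> borel_measurable (borel \<Otimes>\<^sub>M borel)" unfolding f_def by measurable
  define S where "S = f -` C \<inter> space (borel \<Otimes>\<^sub>M borel)"
  have S: "S \<in> sets (borel \<Otimes>\<^sub>M borel)" unfolding S_def by measurable
  have inS: "(D1 \<omega>, D2 \<omega>) \<in> S \<longleftrightarrow> W t \<omega> - W s \<omega> \<in> C" for \<omega>
    unfolding S_def f_def W_def D1_def D2_def by (simp add: space_pair_measure diff_divide_distrib[symmetric] algebra_simps)
  have "prob {\<omega>\<in>space M. W t \<omega> - W s \<omega> \<in> C} = measure gauss {y. sqrt (t - s) * y \<in> C}"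
    using measure_distributed_normal[OF nW st C] unfolding inS[symmetric] S_def f_def by (simp add: space_pair_measure)
  moreover have "emeasure L S = emeasure M {\<omega>\<in>space M. W t \<omega> - W s \<omega> \<in> C}" using L[OF S] by (simp add: inS)
  moreover have "emeasure M (path_event M B1 U1 A1 \<inter> path_event M B2 U2 A2 \<inter> {\<omega>\<in>space M. W t \<omega> - W s \<omega> \<in> C}) =
     emeasure M (path_event M B1 U1 A1 \<inter> path_event M B2 U2 A2) * emeasure L S"
    using key[OF S refl U] by (simp add: inS)
  ultimately show ?thesis by (simp add: emeasure_eq_measure ennreal_mult[symmetric] del: ennreal_mult)
qed

text \<open>A Dynkin class argument. The generator of the completed filtration is not closed under
  intersection, so it is enlarged to \<open>G\<close>, the sets that agree with a cylinder of the
  two processes up to a null set; on \<open>G\<close> the product formula reduces to the one for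
  cylinders.\<close>

lemma filtration_increment_indep:
  fixes b1 b2 :: real
  assumes M: "prob_space M" and bm: "brownian_motion M B1" "brownian_motion M B2" and ip: "indep_processes M B1 B2"
    and s: "0 \<le> s" "s < t" and C[measurable]: "C \<in> sets borel" and b: "b1\<^sup>2 + b2\<^sup>2 > 0"
    and E: "E \<in> sets (completed_natural_filtration M B1 B2 (ennreal s))"
  defines "W \<equiv> \<lambda>t \<omega>. (b1 * B1 t \<omega> + b2 * B2 t \<omega>) / sqrt (b1\<^sup>2 + b2\<^sup>2)"
  shows "E \<in> sets (completion M) \<and> measure (completion M) (E \<inter> {\<omega>\<in>space M. W t \<omega> - W s \<omega> \<in> C}) =
    measure (completion M) E * measure gauss {y. sqrt (t - s) * y \<in> C}"
proof -
  interpret M: prob_space M by (rule M)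
  let ?N = "completion M"
  interpret N: prob_space ?N by (rule M.prob_space_completion)
  have Bm: "B1 u \<in> borel_measurable M" "B2 u \<in> borel_measurable M" if "0 \<le> u" for u
    using bm that by (auto simp: brownian_motion_def)
  define D where "D = {\<omega>\<in>space M. W t \<omega> - W s \<omega> \<in> C}"
  have D: "D \<in> sets M"
  proof -
    have [measurable]: "B1 t \<in> borel_measurable M" "B1 s \<in> borel_measurable M" "B2 t \<in> borel_measurable M" "B2 s \<in> borel_measurable M"
      using Bm s by auto
    show ?thesis unfolding D_def W_def by measurable
  qed
  define c where "c = measure gauss {y. sqrt (t - s) * y \<in> C}"
  define R where "R = {path_event M B1 U1 A1 \<inter> path_event M B2 U2 A2 | U1 A1 U2 A2. finite U1 \<and> U1 \<subseteq> {0..s} \<and> finite U2 \<and> U2 \<subseteq> {0..s} \<and>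
     (\<forall>u. A1 u \<in> sets borel) \<and> (\<forall>u. A2 u \<in> sets borel)}"
  have RM: "r \<in> sets M" if "r \<in> R" for r
    using that Bm unfolding R_def by (auto intro!: sets.Int path_event_sets)
  have Rc: "measure M (r \<inter> D) = measure M r * c" if "r \<in> R" for r
    using that M.brownian_combination_increment[OF bm ip _ _ _ _ s _ _ C b] unfolding R_def D_def W_def c_def by blast
  have RInt: "r \<inter> r' \<in> R" if rr: "r \<in> R" "r' \<in> R" for r r'
  proof -
    from rr(1) obtain U1 A1 U2 A2 where 1: "r = path_event M B1 U1 A1 \<inter> path_event M B2 U2 A2" "finite U1" "U1 \<subseteq> {0..s}" "finite U2" "U2 \<subseteq> {0..s}"
      "\<forall>u. A1 u \<in> sets borel" "\<forall>u. A2 u \<in> sets borel" unfolding R_def by blast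
    from rr(2) obtain U1' A1' U2' A2' where 2: "r' = path_event M B1 U1' A1' \<inter> path_event M B2 U2' A2'" "finite U1'" "U1' \<subseteq> {0..s}" "finite U2'" "U2' \<subseteq> {0..s}"
      "\<forall>u. A1' u \<in> sets borel" "\<forall>u. A2' u \<in> sets borel" unfolding R_def by blast
    let ?A1 = "\<lambda>u. (if u \<in> U1 then A1 u else UNIV) \<inter> (if u \<in> U1' then A1' u else UNIV)"
    let ?A2 = "\<lambda>u. (if u \<in> U2 then A2 u else UNIV) \<inter> (if u \<in> U2' then A2' u else UNIV)"
    have "r \<inter> r' = path_event M B1 (U1 \<union> U1') ?A1 \<inter> path_event M B2 (U2 \<union> U2') ?A2"
      unfolding 1 2 path_event_Int[symmetric] by blast
    moreover have "\<forall>u. ?A1 u \<in> sets borel" "\<forall>u. ?A2 u \<in> sets borel" using 1 2 by auto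
    moreover have "finite (U1 \<union> U1')" "U1 \<union> U1' \<subseteq> {0..s}" "finite (U2 \<union> U2')" "U2 \<union> U2' \<subseteq> {0..s}" using 1 2 by auto
    ultimately show ?thesis unfolding R_def by blast
  qed
  define G where "G = {A \<in> sets ?N. \<exists>r\<in>R. (A - r) \<union> (r - A) \<in> null_sets ?N}"
  have "Int_stable G"
  proof (rule Int_stableI)
    fix A A' assume "A \<in> G" "A' \<in> G"
    then obtain r r' where rr: "A \<in> sets ?N" "A' \<in> sets ?N" "r \<in> R" "r' \<in> R" "(A - r) \<union> (r - A) \<in> null_sets ?N" "(A' - r') \<union> (r' - A') \<in> null_sets ?N"
      unfolding G_def by blast
    have "(A \<inter> A' - r \<inter> r') \<union> (r \<inter> r' - A \<inter> A') \<subseteq> ((A - r) \<union> (r - A)) \<union> ((A' - r') \<union> (r' - A'))" by blast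
    from completion.complete2[OF this null_sets.Un[OF rr(5,6)]]
    show "A \<inter> A' \<in> G" using rr RInt unfolding G_def by blast
  qed
  moreover have GP: "G \<subseteq> Pow (space M)" unfolding G_def using sets.sets_into_space[of _ ?N] by auto
  moreover have "E \<in> sigma_sets (space M) G"
  proof -
    have gen: "{B1 u -` A \<inter> space M | u A. 0 \<le> u \<and> ennreal u \<le> ennreal s \<and> A \<in> sets borel} \<union>
        {B2 u -` A \<inter> space M | u A. 0 \<le> u \<and> ennreal u \<le> ennreal s \<and> A \<in> sets borel} \<union>
        null_sets ?N \<subseteq> G" (is "?g1 \<union> ?g2 \<union> ?g3 \<subseteq> G")
    proof (intro Un_least subsetI)
      have RG: "r \<in> G" if "r \<in> R" for r
        using that RM[OF that] unfolding G_def by (auto intro!: bexI[of _ r])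
      fix x
      {
        assume "x \<in> ?g1"
        then obtain u A where u: "x = B1 u -` A \<inter> space M" "0 \<le> u" "ennreal u \<le> ennreal s" "A \<in> sets borel" by blast
        then have "u \<le> s" using s by simp
        then have "path_event M B1 {u} (\<lambda>_. A) \<inter> path_event M B2 {} (\<lambda>_. UNIV) \<in> R" using u unfolding R_def by fastforce
        moreover have "path_event M B1 {u} (\<lambda>_. A) \<inter> path_event M B2 {} (\<lambda>_. UNIV) = x" unfolding u path_event_def by auto
        ultimately show "x \<in> G" using RG by blast
      next
        assume "x \<in> ?g2"
        then obtain u A where u: "x = B2 u -` A \<inter> space M" "0 \<le> u" "ennreal u \<le> ennreal s" "A \<in> sets borel" by blast
        then have "u \<le> s" using s by simp
        then have "path_event M B1 {} (\<lambda>_. UNIV) \<inter> path_event M B2 {u} (\<lambda>_. A) \<in> R" using u unfolding R_def by fastforce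
        moreover have "path_event M B1 {} (\<lambda>_. UNIV) \<inter> path_event M B2 {u} (\<lambda>_. A) = x" unfolding u path_event_def by auto
        ultimately show "x \<in> G" using RG by blast
      next
        assume x: "x \<in> ?g3"
        \<comment> \<open>The empty set is a cylinder, with empty target at time \<open>0\<close>;
          hence null sets lie in \<open>G\<close>.\<close>
        have "path_event M B1 {0} (\<lambda>_. {}) \<inter> path_event M B2 {} (\<lambda>_. UNIV) \<in> R" using s unfolding R_def by fastforce
        moreover have "path_event M B1 {0} (\<lambda>_. {}) \<inter> path_event M B2 {} (\<lambda>_. UNIV) = {}" unfolding path_event_def by auto
        ultimately show "x \<in> G" using x unfolding G_def by auto
      }
    qed
    have "sets (completed_natural_filtration M B1 B2 (ennreal s)) = sigma_sets (space M) (?g1 \<union> ?g2 \<union> ?g3)"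
      unfolding completed_natural_filtration_def
      by (intro sets_measure_of order_trans[OF gen GP])
    then show ?thesis using E sigma_sets_mono'[OF gen] by blast
  qed
  ultimately have "E \<in> sets ?N \<and> measure ?N (E \<inter> D) = measure ?N E * c"
  proof (induction rule: sigma_sets_induct_disjoint)
    case (basic A)
    then obtain r where r: "A \<in> sets ?N" "r \<in> R" "(A - r) \<union> (r - A) \<in> null_sets ?N" unfolding G_def by blast
    have ae: "AE \<omega> in ?N. \<omega> \<in> A \<longleftrightarrow> \<omega> \<in> r" using AE_not_in[OF r(3)] by eventually_elim auto
    have DN: "D \<in> sets ?N" "r \<in> sets ?N" using D RM[OF r(2)] by auto
    have "measure ?N (A \<inter> D) = measure ?N (r \<inter> D)"
      using ae r(1) DN by (intro N.finite_measure_eq_AE) auto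
    also have "\<dots> = measure M r * c" using Rc[OF r(2)] RM[OF r(2)] D by simp
    also have "measure M r = measure ?N r" using RM[OF r(2)] by simp
    also have "measure ?N r = measure ?N A" using ae r(1) DN by (intro N.finite_measure_eq_AE) auto
    finally show ?case using r(1) by simp
  next
    case empty
    then show ?case by simp
  next
    case (compl A)
    then have A: "A \<in> sets ?N" "measure ?N (A \<inter> D) = measure ?N A * c" by auto
    have DN: "D \<in> sets ?N" using D by auto
    have "measure ?N ((space M - A) \<inter> D) = measure ?N (D - A \<inter> D)"
      using sets.sets_into_space[OF DN] by (intro arg_cong[where f = "measure ?N"]) auto
    also have "\<dots> = measure ?N D - measure ?N (A \<inter> D)"
      using A DN by (intro N.finite_measure_Diff) auto
    also have "measure ?N D = c"
    proof -
      have "path_event M B1 {} (\<lambda>_. UNIV) \<inter> path_event M B2 {} (\<lambda>_. UNIV) \<in> R" unfolding R_def by fastforce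
      moreover have "path_event M B1 {} (\<lambda>_. UNIV) \<inter> path_event M B2 {} (\<lambda>_. UNIV) = space M" by (simp add: path_event_def)
      ultimately have "measure M (space M \<inter> D) = measure M (space M) * c" using Rc by metis
      moreover have "space M \<inter> D = D" unfolding D_def by auto
      ultimately show ?thesis using D by (simp add: M.prob_space)
    qed
    finally have "measure ?N ((space M - A) \<inter> D) = (1 - measure ?N A) * c" using A by (simp add: algebra_simps)
    moreover have "measure ?N (space M - A) = 1 - measure ?N A" using N.prob_compl[OF A(1)] by simp
    moreover have "space M - A \<in> sets ?N" using sets.compl_sets[OF A(1)] by simp
    ultimately show ?case by simp
  next
    case (union A)
    have DN: "D \<in> sets ?N" using D by auto
    have A: "A i \<in> sets ?N" "measure ?N (A i \<inter> D) = measure ?N (A i) * c" for i using union(3)[of i] by auto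
    have "disjoint_family (\<lambda>i. A i \<inter> D)" using union(1) by (auto simp: disjoint_family_on_def)
    then have "(\<lambda>i. measure ?N (A i \<inter> D)) sums measure ?N (\<Union>i. A i \<inter> D)"
      using A DN by (intro N.finite_measure_UNION) auto
    moreover have "(\<lambda>i. measure ?N (A i) * c) sums (measure ?N (\<Union>i. A i) * c)"
      using A union(1) by (intro sums_mult2 N.finite_measure_UNION) auto
    ultimately have "measure ?N (\<Union>i. A i \<inter> D) = measure ?N (\<Union>i. A i) * c"
      using A by (simp add: sums_unique2)
    then show ?case using A by auto
  qed
  then show ?thesis unfolding D_def c_def .
qed

theorem filtered_bm_combination:
  fixes b1 b2 :: real
  assumes M: "prob_space M" and bm: "brownian_motion M B1" "brownian_motion M B2" and ip: "indep_processes M B1 B2"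
    and b: "b1\<^sup>2 + b2\<^sup>2 > 0"
  shows "filtered_bm (completion M) (\<lambda>t. completed_natural_filtration M B1 B2 (ennreal t))
     (\<lambda>t \<omega>. (b1 * B1 t \<omega> + b2 * B2 t \<omega>) / sqrt (b1\<^sup>2 + b2\<^sup>2))"
proof -
  interpret M: prob_space M by (rule M)
  let ?N = "completion M" and ?F = "\<lambda>t. completed_natural_filtration M B1 B2 (ennreal t)"
  let ?W = "\<lambda>t \<omega>. (b1 * B1 t \<omega> + b2 * B2 t \<omega>) / sqrt (b1\<^sup>2 + b2\<^sup>2)"
  interpret N: prob_space ?N by (rule M.prob_space_completion)
  define G where "G = (\<lambda>t. {B1 u -` A \<inter> space M | u A. 0 \<le> u \<and> ennreal u \<le> ennreal t \<and> A \<in> sets borel} \<union>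
        {B2 u -` A \<inter> space M | u A. 0 \<le> u \<and> ennreal u \<le> ennreal t \<and> A \<in> sets borel} \<union> null_sets ?N)"
  have Bm: "B1 u \<in> borel_measurable M" "B2 u \<in> borel_measurable M" if "0 \<le> u" for u
    using bm that by (auto simp: brownian_motion_def)
  have GN: "G t \<subseteq> sets ?N" for t
    unfolding G_def using measurable_sets[OF Bm(1)] measurable_sets[OF Bm(2)] by blast
  have Gsp: "G t \<subseteq> Pow (space M)" for t
    using GN[of t] sets.sets_into_space[of _ ?N] by auto
  have FG: "?F t = sigma (space M) (G t)" for t by (simp add: completed_natural_filtration_def G_def)
  have sF: "space (?F t) = space M" "sets (?F t) = sigma_sets (space M) (G t)" for t
    unfolding FG using Gsp by (auto simp: space_measure_of sets_measure_of)
  have GF: "A \<in> G t \<Longrightarrow> A \<in> sets (?F t)" for A t unfolding sF by (rule sigma_sets.Basic)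
  have Bad: "B1 t \<in> borel_measurable (?F t)" "B2 t \<in> borel_measurable (?F t)" if "0 \<le> t" for t
  proof -
    have "B1 t -` A \<inter> space M \<in> G t" "B2 t -` A \<inter> space M \<in> G t" if "A \<in> sets borel" for A
      unfolding G_def using that \<open>0 \<le> t\<close> by blast+
    then show "B1 t \<in> borel_measurable (?F t)" "B2 t \<in> borel_measurable (?F t)"
      by (auto intro!: measurableI GF simp: sF(1))
  qed
  show ?thesis
  proof (unfold_locales)
    fix t s :: real
    show "subalgebra ?N (?F t)"
      unfolding subalgebra_def sF using sets.sigma_sets_subset[OF GN[of t]] by simp
    show "sets (?F s) \<subseteq> sets (?F t)" if "s \<le> t"
      unfolding sF
    proof (rule sigma_sets_mono')
      have "ennreal s \<le> ennreal t" using that by (rule ennreal_leI)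
      then show "G s \<subseteq> G t" unfolding G_def by (blast intro: order_trans)
    qed
    show "A \<in> sets (?F t)" if "A \<in> null_sets ?N" for A
      using that by (intro GF) (auto simp: G_def)
    show "?W t \<in> borel_measurable (?F t)" if "0 \<le> t"
      using Bad[OF that] by measurable
  next
    show "AE \<omega> in ?N. ?W 0 \<omega> = 0"
    proof (rule AE_completion)
      have "AE \<omega> in M. B1 0 \<omega> = 0" "AE \<omega> in M. B2 0 \<omega> = 0" using bm by (auto simp: brownian_motion_def)
      then show "AE \<omega> in M. ?W 0 \<omega> = 0" by eventually_elim simp
    qed
    show "AE \<omega> in ?N. continuous_on {0..} (\<lambda>t. ?W t \<omega>)"
    proof (rule AE_completion)
      have "AE \<omega> in M. continuous_on {0..} (\<lambda>t. B1 t \<omega>)" "AE \<omega> in M. continuous_on {0..} (\<lambda>t. B2 t \<omega>)"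
        using bm by (auto simp: brownian_motion_def)
      then show "AE \<omega> in M. continuous_on {0..} (\<lambda>t. ?W t \<omega>)"
        by eventually_elim (use b in \<open>auto intro!: continuous_intros\<close>)
    qed
  next
    fix s t :: real and A and C :: "real set" assume st: "0 \<le> s" "s \<le> t" and A: "A \<in> sets (?F s)" and C: "C \<in> sets borel"
    show "N.prob (A \<inter> {\<omega>\<in>space ?N. ?W t \<omega> - ?W s \<omega> \<in> C}) = N.prob A * measure gauss {y. sqrt (t - s) * y \<in> C}"
    proof (cases "s = t")
      \<comment> \<open>At \<open>s = t\<close> both sides ask only whether \<open>0\<close> lies in
        \<open>C\<close>.\<close>
      case True
      interpret g: prob_space gauss by (rule prob_space_gauss)
      have "A \<subseteq> space M" using sets.sets_into_space[OF A] by (simp add: sF)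
      then show ?thesis using True g.prob_space by (cases "0 \<in> C") (auto simp: Int_absorb2)
    next
      case False
      then have "s < t" using st by simp
      from filtration_increment_indep[OF M bm ip st(1) this C b A] show ?thesis by simp
    qed
  qed
qed

section \<open>The discretised stopping problem\<close>

text \<open>The conditions on \<rho> say that the constant \<open>1\<close> and the identity are
  superharmonic for the discounted process. Their sum is the weight that controls all errors of
  convexity.\<close>

locale gbm = filtered_bm N F W for N :: "'a measure" and F and W +
  fixes m sg \<rho> :: real
  assumes sg: "0 < sg" and \<rho>: "0 \<le> \<rho>" "m \<le> \<rho>"
begin

text \<open>$X$ is the geometric Brownian motion and $Q$ the same variable written as a function of a
  standard Gaussian $y$; $P_t$ is the transition operator.\<close>

definition Q :: "real \<Rightarrow> real \<Rightarrow> real \<Rightarrow> real" where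
  "Q z t y = z * exp ((m - sg\<^sup>2 / 2) * t + sg * (sqrt t * y))"

definition X :: "real \<Rightarrow> real \<Rightarrow> 'a \<Rightarrow> real" where
  "X z t \<omega> = z * exp ((m - sg\<^sup>2 / 2) * t + sg * W t \<omega>)"

definition P :: "real \<Rightarrow> (real \<Rightarrow> ennreal) \<Rightarrow> real \<Rightarrow> ennreal" where
  "P t f z = (\<integral>\<^sup>+y. f (Q z t y) \<partial>gauss)"

section \<open>Markov property and semigroup\<close>

lemma Q_pos: "0 < z \<Longrightarrow> 0 < Q z t y" by (simp add: Q_def)

lemma X_pos: "0 < z \<Longrightarrow> 0 < X z t \<omega>" by (simp add: X_def)

lemma Q_measurable[measurable]: "Q z t \<in> borel_measurable borel"
  unfolding Q_def by measurable

lemma X_adapted: "0 \<le> t \<Longrightarrow> X z t \<in> borel_measurable (F t)"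
  using W_adapted[of t] unfolding X_def by measurable

lemma X_measurable: "0 \<le> t \<Longrightarrow> X z t \<in> borel_measurable N"
  by (rule measurable_F_N[OF X_adapted])

lemma X_0: "AE \<omega> in N. X z 0 \<omega> = z"
  using W_0 by eventually_elim (simp add: X_def)

lemma P_measurable[measurable]:
  assumes [measurable]: "f \<in> borel_measurable borel"
  shows "P t f \<in> borel_measurable borel"
proof -
  interpret g: prob_space gauss by (rule prob_space_gauss)
  have "(\<lambda>(z, y). f (z * exp ((m - sg\<^sup>2 / 2) * t + sg * (sqrt t * y)))) \<in> borel_measurable (borel \<Otimes>\<^sub>M gauss)"
  proof -
    have "sets (borel \<Otimes>\<^sub>M gauss) = sets (borel \<Otimes>\<^sub>M (borel :: real measure))" by (rule sets_pair_measure_cong) auto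
    then show ?thesis by (subst measurable_cong_sets[OF _ refl]) measurable
  qed
  from g.borel_measurable_nn_integral[OF this] show ?thesis
    unfolding P_def Q_def by simp
qed

lemma P_mono: "(\<And>x. f x \<le> g x) \<Longrightarrow> P t f z \<le> P t g z"
  unfolding P_def by (intro nn_integral_mono) auto

text \<open>\<open>X z (s + \<delta>)\<close> is \<open>X z s\<close> times a function of the
  increment, so the past can be frozen and the increment integrated out. Testing against events
  \<open>A\<close> of \<open>F s\<close> takes the place of conditional expectation.\<close>

lemma markov:
  assumes s: "0 \<le> s" "0 \<le> \<delta>" and A[measurable]: "A \<in> sets (F s)" and f[measurable]: "f \<in> borel_measurable borel"
  shows "(\<integral>\<^sup>+\<omega>. indicator A \<omega> * f (X z (s + \<delta>) \<omega>) \<partial>N) = (\<integral>\<^sup>+\<omega>. indicator A \<omega> * P \<delta> f (X z s \<omega>) \<partial>N)"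
proof -
  interpret g: prob_space gauss by (rule prob_space_gauss)
  define h where "h = (\<lambda>(\<omega>, y). indicator A \<omega> * f (X z s \<omega> * exp ((m - sg\<^sup>2 / 2) * \<delta> + sg * y)))"
  have [measurable]: "X z s \<in> borel_measurable (F s)" using s X_adapted by simp
  have hm: "h \<in> borel_measurable (F s \<Otimes>\<^sub>M borel)" unfolding h_def by measurable
  have "(\<integral>\<^sup>+\<omega>. indicator A \<omega> * f (X z (s + \<delta>) \<omega>) \<partial>N) = (\<integral>\<^sup>+\<omega>. h (\<omega>, W (s + \<delta>) \<omega> - W s \<omega>) \<partial>N)"
    by (intro nn_integral_cong) (simp add: h_def X_def exp_add[symmetric] algebra_simps add_divide_distrib)
  also have "\<dots> = (\<integral>\<^sup>+\<omega>. \<integral>\<^sup>+y. h (\<omega>, sqrt \<delta> * y) \<partial>gauss \<partial>N)"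
    using nn_integral_freeze[OF s(1) _ hm, of "s + \<delta>"] s by simp
  also have "\<dots> = (\<integral>\<^sup>+\<omega>. indicator A \<omega> * P \<delta> f (X z s \<omega>) \<partial>N)"
    unfolding h_def P_def Q_def prod.case by (intro nn_integral_cong nn_integral_cmult) measurable
  finally show ?thesis .
qed

lemma nn_integral_X:
  assumes t: "0 \<le> t" and f[measurable]: "f \<in> borel_measurable borel"
  shows "(\<integral>\<^sup>+\<omega>. f (X z t \<omega>) \<partial>N) = P t f z"
proof -
  have sp: "space N \<in> sets (F 0)" using sets.top[of "F 0"] by (simp add: space_F)
  have "(\<integral>\<^sup>+\<omega>. f (X z t \<omega>) \<partial>N) = (\<integral>\<^sup>+\<omega>. indicator (space N) \<omega> * f (X z (0 + t) \<omega>) \<partial>N)"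
    by (intro nn_integral_cong) simp
  also have "\<dots> = (\<integral>\<^sup>+\<omega>. indicator (space N) \<omega> * P t f (X z 0 \<omega>) \<partial>N)"
    by (rule markov[OF _ t sp f]) simp
  also have "\<dots> = (\<integral>\<^sup>+\<omega>. P t f z \<partial>N)"
    by (rule nn_integral_cong_AE) (use X_0[of z] AE_space in eventually_elim, simp)
  finally show ?thesis by (simp add: emeasure_space_1)
qed

text \<open>Read off from the Markov property, instead of convolving Gaussian densities.\<close>

lemma P_semigroup:
  assumes t: "0 \<le> s" "0 \<le> t" and f[measurable]: "f \<in> borel_measurable borel"
  shows "P (s + t) f z = P s (P t f) z"
proof -
  have sp: "space N \<in> sets (F s)" using sets.top[of "F s"] t by (simp add: space_F)
  have "P (s + t) f z = (\<integral>\<^sup>+\<omega>. f (X z (s + t) \<omega>) \<partial>N)" using t by (intro nn_integral_X[symmetric]) auto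
  also have "\<dots> = (\<integral>\<^sup>+\<omega>. indicator (space N) \<omega> * f (X z (s + t) \<omega>) \<partial>N)" by (intro nn_integral_cong) simp
  also have "\<dots> = (\<integral>\<^sup>+\<omega>. indicator (space N) \<omega> * P t f (X z s \<omega>) \<partial>N)" by (rule markov[OF t sp f])
  also have "\<dots> = (\<integral>\<^sup>+\<omega>. P t f (X z s \<omega>) \<partial>N)" by (intro nn_integral_cong) simp
  also have "\<dots> = P s (P t f) z" by (rule nn_integral_X[OF t(1)]) simp
  finally show ?thesis .
qed

section \<open>Bellman iteration and superharmonicity on a grid\<close>

definition bellman :: "(real \<Rightarrow> ennreal) \<Rightarrow> real \<Rightarrow> (real \<Rightarrow> ennreal) \<Rightarrow> real \<Rightarrow> ennreal" where
  "bellman G \<delta> g x = max (G x) (ennreal (exp (- \<rho> * \<delta>)) * P \<delta> g x)"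

text \<open>\<open>(bellman G \<delta> ^^ n) G\<close> is the value of stopping at one of the first
  \<open>n + 1\<close> multiples of \<delta>, counted from \<open>0\<close>; the iterates increase
  in \<open>n\<close>, and the supremum removes the horizon.\<close>

definition H :: "(real \<Rightarrow> ennreal) \<Rightarrow> real \<Rightarrow> real \<Rightarrow> ennreal" where
  "H G \<delta> x = (SUP n. (bellman G \<delta> ^^ n) G x)"

lemma bellman_measurable[measurable]:
  assumes [measurable]: "G \<in> borel_measurable borel" "g \<in> borel_measurable borel"
  shows "bellman G \<delta> g \<in> borel_measurable borel"
  unfolding bellman_def by measurable

lemma bellman_iterate_measurable[measurable]:
  assumes [measurable]: "G \<in> borel_measurable borel"
  shows "(bellman G \<delta> ^^ n) G \<in> borel_measurable borel"
  by (induction n) auto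

lemma bellman_iterate_mono: "(bellman G \<delta> ^^ n) G x \<le> (bellman G \<delta> ^^ Suc n) G x"
proof (induction n arbitrary: x)
  case 0
  then show ?case by (simp add: bellman_def)
next
  case (Suc n)
  have "P \<delta> ((bellman G \<delta> ^^ n) G) x \<le> P \<delta> ((bellman G \<delta> ^^ Suc n) G) x" by (intro P_mono Suc)
  then have "bellman G \<delta> ((bellman G \<delta> ^^ n) G) x \<le> bellman G \<delta> ((bellman G \<delta> ^^ Suc n) G) x"
    unfolding bellman_def[of G \<delta> "(bellman G \<delta> ^^ n) G"] bellman_def[of G \<delta> "(bellman G \<delta> ^^ Suc n) G"]
    by (intro max.mono order_refl mult_left_mono) auto
  then show ?case by simp
qed

lemma H_measurable[measurable]:
  assumes [measurable]: "G \<in> borel_measurable borel"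
  shows "H G \<delta> \<in> borel_measurable borel"
  unfolding H_def by measurable

lemma G_le_H: "G x \<le> H G \<delta> x"
  unfolding H_def by (rule SUP_upper2[of 0]) auto

text \<open>The iterates increase, so monotone convergence carries \<open>P\<close> through the
  supremum; each resulting term is dominated by one further Bellman step, which only raises the
  index.\<close>

lemma H_superharmonic:
  assumes [measurable]: "G \<in> borel_measurable borel"
  shows "ennreal (exp (- \<rho> * \<delta>)) * P \<delta> (H G \<delta>) x \<le> H G \<delta> x"
proof -
  have eq: "P \<delta> (H G \<delta>) x = (SUP n. P \<delta> ((bellman G \<delta> ^^ n) G) x)"
    unfolding P_def H_def
  proof (rule nn_integral_monotone_convergence_SUP)
    show "incseq (\<lambda>n y. (bellman G \<delta> ^^ n) G (Q x \<delta> y))"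
      by (intro incseq_SucI le_funI bellman_iterate_mono)
  qed measurable
  have "ennreal (exp (- \<rho> * \<delta>)) * P \<delta> (H G \<delta>) x = (SUP n. ennreal (exp (- \<rho> * \<delta>)) * P \<delta> ((bellman G \<delta> ^^ n) G) x)"
    unfolding eq by (rule SUP_mult_left_ennreal)
  also have "\<dots> \<le> H G \<delta> x"
  proof (rule SUP_least)
    fix n
    have "ennreal (exp (- \<rho> * \<delta>)) * P \<delta> ((bellman G \<delta> ^^ n) G) x \<le> bellman G \<delta> ((bellman G \<delta> ^^ n) G) x"
      unfolding bellman_def[of G \<delta> "(bellman G \<delta> ^^ n) G" x] by (rule max.cobounded2)
    also have "\<dots> = (bellman G \<delta> ^^ Suc n) G x" by simp
    also have "\<dots> \<le> H G \<delta> x" unfolding H_def by (rule SUP_upper) simp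
    finally show "ennreal (exp (- \<rho> * \<delta>)) * P \<delta> ((bellman G \<delta> ^^ n) G) x \<le> H G \<delta> x" .
  qed
  finally show ?thesis .
qed

text \<open>It serves to compare grids: a coarse dyadic step is a multiple of a fine one, and
  superharmonicity for the fine step passes to it by iteration and the semigroup law.\<close>

lemma H_superharmonic_multiple:
  assumes [measurable]: "G \<in> borel_measurable borel" and \<delta>: "0 \<le> \<delta>"
  shows "ennreal (exp (- \<rho> * (real n * \<delta>))) * P (real n * \<delta>) (H G \<delta>) x \<le> H G \<delta> x"
proof (induction n arbitrary: x)
  case 0
  interpret g: prob_space gauss by (rule prob_space_gauss)
  have "emeasure gauss UNIV = 1" using g.emeasure_space_1 by simp
  then show ?case by (simp add: P_def Q_def)
next
  case (Suc n)
  let ?e = "ennreal (exp (- \<rho> * \<delta>))" and ?en = "ennreal (exp (- \<rho> * (real n * \<delta>)))"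
  have "P (real (Suc n) * \<delta>) (H G \<delta>) x = P \<delta> (P (real n * \<delta>) (H G \<delta>)) x"
    using P_semigroup[OF \<delta>, of "real n * \<delta>" "H G \<delta>" x] \<delta> by (simp add: algebra_simps)
  moreover have "ennreal (exp (- \<rho> * (real (Suc n) * \<delta>))) = ?e * ?en"
    by (simp add: ennreal_mult[symmetric] exp_add[symmetric] algebra_simps)
  moreover have "?en * P \<delta> (P (real n * \<delta>) (H G \<delta>)) x = P \<delta> (\<lambda>x. ?en * P (real n * \<delta>) (H G \<delta>) x) x"
    unfolding P_def[of \<delta>] by (rule nn_integral_cmult[symmetric]) measurable
  ultimately have "ennreal (exp (- \<rho> * (real (Suc n) * \<delta>))) * P (real (Suc n) * \<delta>) (H G \<delta>) x =
      ?e * P \<delta> (\<lambda>x. ?en * P (real n * \<delta>) (H G \<delta>) x) x"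
    by (simp add: mult.assoc)
  also have "\<dots> \<le> ?e * P \<delta> (H G \<delta>) x" by (intro mult_left_mono P_mono Suc.IH) simp
  also have "\<dots> \<le> H G \<delta> x" by (rule H_superharmonic) simp
  finally show ?case .
qed

section \<open>Stopping rules on a grid\<close>

abbreviation disc :: "real \<Rightarrow> ennreal" where "disc t \<equiv> ennreal (exp (- \<rho> * t))"

lemma markov_disc:
  assumes \<delta>: "0 \<le> \<delta>" and A: "A \<in> sets (F (real i * \<delta>))" and f[measurable]: "f \<in> borel_measurable borel"
  shows "(\<integral>\<^sup>+\<omega>. indicator A \<omega> * (disc (real (Suc i) * \<delta>) * f (X z (real (Suc i) * \<delta>) \<omega>)) \<partial>N) =
    (\<integral>\<^sup>+\<omega>. indicator A \<omega> * (disc (real i * \<delta>) * (disc \<delta> * P \<delta> f (X z (real i * \<delta>) \<omega>))) \<partial>N)"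
proof -
  have pos: "0 \<le> real i * \<delta>" "0 \<le> real (Suc i) * \<delta>" using \<delta> by auto
  have [measurable]: "A \<in> sets N" by (rule sets_F[OF pos(1) A])
  have [measurable]: "X z (real i * \<delta>) \<in> borel_measurable N" "X z (real (Suc i) * \<delta>) \<in> borel_measurable N" by (intro X_measurable pos)+
  have e: "disc (real (Suc i) * \<delta>) = disc (real i * \<delta>) * disc \<delta>"
    by (simp add: ennreal_mult[symmetric] exp_add[symmetric] algebra_simps)
  have "(\<integral>\<^sup>+\<omega>. indicator A \<omega> * (disc (real (Suc i) * \<delta>) * f (X z (real (Suc i) * \<delta>) \<omega>)) \<partial>N) =
    (\<integral>\<^sup>+\<omega>. disc (real (Suc i) * \<delta>) * (indicator A \<omega> * f (X z (real (Suc i) * \<delta>) \<omega>)) \<partial>N)"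
    by (intro nn_integral_cong) (simp only: mult_ac)
  also have "\<dots> = disc (real (Suc i) * \<delta>) * (\<integral>\<^sup>+\<omega>. indicator A \<omega> * f (X z (real (Suc i) * \<delta>) \<omega>) \<partial>N)"
    by (rule nn_integral_cmult) measurable
  also have "(\<integral>\<^sup>+\<omega>. indicator A \<omega> * f (X z (real (Suc i) * \<delta>) \<omega>) \<partial>N) = (\<integral>\<^sup>+\<omega>. indicator A \<omega> * P \<delta> f (X z (real i * \<delta>) \<omega>) \<partial>N)"
    using markov[OF pos(1) \<delta> A f, of z] by (simp add: algebra_simps)
  also have "disc (real (Suc i) * \<delta>) * \<dots> = (\<integral>\<^sup>+\<omega>. disc (real (Suc i) * \<delta>) * (indicator A \<omega> * P \<delta> f (X z (real i * \<delta>) \<omega>)) \<partial>N)"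
    by (rule nn_integral_cmult[symmetric]) measurable
  also have "\<dots> = (\<integral>\<^sup>+\<omega>. indicator A \<omega> * (disc (real i * \<delta>) * (disc \<delta> * P \<delta> f (X z (real i * \<delta>) \<omega>))) \<partial>N)"
    unfolding e by (intro nn_integral_cong) (simp only: mult_ac)
  finally show ?thesis .
qed

text \<open>Optional stopping for a supermartingale, with the rule given by the events
  \<open>A j\<close> of stopping at step \<open>j\<close>. The induction keeps a second term, the
  discounted value on the set \<open>R i\<close> of paths not stopped before step \<open>i\<close>.
  Since \<open>R (Suc i)\<close> is already known at step \<open>i\<close>, the Markov property
  advances this term by one step.\<close>

lemma superharmonic_stopped_le:
  assumes \<delta>: "0 \<le> \<delta>" and [measurable]: "f \<in> borel_measurable borel"
    and sup: "\<And>x. disc \<delta> * P \<delta> f x \<le> f x"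
    and A: "\<And>j. A j \<in> sets (F (real j * \<delta>))" and dj: "disjoint_family A"
  shows "(\<Sum>j<i. \<integral>\<^sup>+\<omega>. indicator (A j) \<omega> * (disc (real j * \<delta>) * f (X z (real j * \<delta>) \<omega>)) \<partial>N) \<le> f z"
proof -
  have pos: "0 \<le> real j * \<delta>" for j using \<delta> by simp
  have le: "i \<le> j \<Longrightarrow> real i * \<delta> \<le> real j * \<delta>" for i j using \<delta> by (simp add: mult_right_mono)
  have AN[measurable]: "A j \<in> sets N" for j by (rule sets_F[OF pos A])
  have XN[measurable]: "X z (real j * \<delta>) \<in> borel_measurable N" for j by (rule X_measurable[OF pos])
  define R where "R = (\<lambda>i. space N - (\<Union>j<i. A j))"
  have RF: "R i \<in> sets (F (real j * \<delta>))" if "i \<le> Suc j" for i j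
  proof -
    have "A k \<in> sets (F (real j * \<delta>))" if "k < i" for k
      using A[of k] F_mono[OF pos le, of k j] that \<open>i \<le> Suc j\<close> by auto
    then have "(\<Union>k<i. A k) \<in> sets (F (real j * \<delta>))" by auto
    then show ?thesis unfolding R_def using sets.compl_sets[of _ "F (real j * \<delta>)"] pos by (simp add: space_F)
  qed
  have RN[measurable]: "R i \<in> sets N" for i unfolding R_def by measurable
  define h where "h = (\<lambda>j \<omega>. disc (real j * \<delta>) * f (X z (real j * \<delta>) \<omega>))"
  have hN[measurable]: "h j \<in> borel_measurable N" for j unfolding h_def by measurable
  have "(\<Sum>j<i. \<integral>\<^sup>+\<omega>. indicator (A j) \<omega> * h j \<omega> \<partial>N) + (\<integral>\<^sup>+\<omega>. indicator (R i) \<omega> * h i \<omega> \<partial>N) \<le> f z"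
  proof (induction i)
    case 0
    have "(\<integral>\<^sup>+\<omega>. indicator (R 0) \<omega> * h 0 \<omega> \<partial>N) = (\<integral>\<^sup>+\<omega>. f z \<partial>N)"
      by (rule nn_integral_cong_AE) (use X_0[of z] AE_space in eventually_elim, simp add: R_def h_def)
    then show ?case by (simp add: emeasure_space_1)
  next
    case (Suc i)
    have split: "indicator (R i) \<omega> * h i \<omega> = indicator (A i) \<omega> * h i \<omega> + indicator (R (Suc i)) \<omega> * h i \<omega>" if "\<omega> \<in> space N" for \<omega>
    proof (cases "\<omega> \<in> A i")
      case True
      then have "\<omega> \<notin> A j" if "j < i" for j
        using disjoint_family_onD[OF dj UNIV_I UNIV_I, of i j] that by auto
      then show ?thesis using True that by (auto simp: R_def lessThan_Suc indicator_def)
    next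
      case False
      then show ?thesis by (auto simp: R_def indicator_def less_Suc_eq)
    qed
    have "(\<integral>\<^sup>+\<omega>. indicator (R i) \<omega> * h i \<omega> \<partial>N) = (\<integral>\<^sup>+\<omega>. indicator (A i) \<omega> * h i \<omega> + indicator (R (Suc i)) \<omega> * h i \<omega> \<partial>N)"
      using split by (intro nn_integral_cong) auto
    also have "\<dots> = (\<integral>\<^sup>+\<omega>. indicator (A i) \<omega> * h i \<omega> \<partial>N) + (\<integral>\<^sup>+\<omega>. indicator (R (Suc i)) \<omega> * h i \<omega> \<partial>N)"
      by (rule nn_integral_add) measurable
    finally have eq: "(\<integral>\<^sup>+\<omega>. indicator (R i) \<omega> * h i \<omega> \<partial>N) = (\<integral>\<^sup>+\<omega>. indicator (A i) \<omega> * h i \<omega> \<partial>N) + (\<integral>\<^sup>+\<omega>. indicator (R (Suc i)) \<omega> * h i \<omega> \<partial>N)" .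
    have "(\<integral>\<^sup>+\<omega>. indicator (R (Suc i)) \<omega> * h (Suc i) \<omega> \<partial>N) =
        (\<integral>\<^sup>+\<omega>. indicator (R (Suc i)) \<omega> * (disc (real i * \<delta>) * (disc \<delta> * P \<delta> f (X z (real i * \<delta>) \<omega>))) \<partial>N)"
      unfolding h_def by (rule markov_disc[OF \<delta> RF]) auto
    also have "\<dots> \<le> (\<integral>\<^sup>+\<omega>. indicator (R (Suc i)) \<omega> * h i \<omega> \<partial>N)"
      unfolding h_def by (intro nn_integral_mono mult_left_mono sup) auto
    finally have "(\<Sum>j<Suc i. \<integral>\<^sup>+\<omega>. indicator (A j) \<omega> * h j \<omega> \<partial>N) + (\<integral>\<^sup>+\<omega>. indicator (R (Suc i)) \<omega> * h (Suc i) \<omega> \<partial>N)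
      \<le> (\<Sum>j<i. \<integral>\<^sup>+\<omega>. indicator (A j) \<omega> * h j \<omega> \<partial>N) + (\<integral>\<^sup>+\<omega>. indicator (A i) \<omega> * h i \<omega> \<partial>N) + (\<integral>\<^sup>+\<omega>. indicator (R (Suc i)) \<omega> * h i \<omega> \<partial>N)"
      by (simp add: add_left_mono)
    also have "\<dots> = (\<Sum>j<i. \<integral>\<^sup>+\<omega>. indicator (A j) \<omega> * h j \<omega> \<partial>N) + (\<integral>\<^sup>+\<omega>. indicator (R i) \<omega> * h i \<omega> \<partial>N)"
      unfolding eq by (simp add: add.assoc)
    finally show ?case using Suc.IH by (rule order_trans)
  qed
  then have "(\<Sum>j<i. \<integral>\<^sup>+\<omega>. indicator (A j) \<omega> * h j \<omega> \<partial>N) \<le> f z"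
    by (rule order_trans[rotated]) simp
  then show ?thesis by (simp add: h_def)
qed

text \<open>Stop at the earliest \<open>j\<close> at which the remaining value \<open>g j\<close>
  does not exceed the payoff. This happens at \<open>n\<close> at the latest, as
  \<open>g n = G\<close>. While the rule continues, the maximum in the Bellman equation is its
  second argument, so the inequalities of the supermartingale argument become equalities.\<close>

lemma optimal_rule:
  assumes \<delta>: "0 \<le> \<delta>" and G[measurable]: "G \<in> borel_measurable borel"
  shows "\<exists>D. (\<forall>j\<le>n. D j \<in> sets (F (real j * \<delta>))) \<and> disjoint_family_on D {..n} \<and> (\<Union>j\<le>n. D j) = space N \<and>
    (\<Sum>j\<le>n. \<integral>\<^sup>+\<omega>. indicator (D j) \<omega> * (disc (real j * \<delta>) * G (X z (real j * \<delta>) \<omega>)) \<partial>N) = (bellman G \<delta> ^^ n) G z"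
proof -
  have pos: "0 \<le> real j * \<delta>" for j using \<delta> by simp
  have le: "i \<le> j \<Longrightarrow> real i * \<delta> \<le> real j * \<delta>" for i j using \<delta> by (simp add: mult_right_mono)
  have XN[measurable]: "X z (real j * \<delta>) \<in> borel_measurable N" for j by (rule X_measurable[OF pos])
  define g where "g = (\<lambda>j. (bellman G \<delta> ^^ (n - j)) G)"
  have g[measurable]: "g j \<in> borel_measurable borel" for j unfolding g_def by measurable
  have gn: "g n = G" by (simp add: g_def)
  have gS: "g j x = max (G x) (disc \<delta> * P \<delta> (g (Suc j)) x)" if "j < n" for j x
  proof -
    have "n - j = Suc (n - Suc j)" using that by simp
    then show ?thesis unfolding g_def by (simp add: bellman_def)
  qed
  define S where "S = (\<lambda>j. {\<omega>\<in>space N. g j (X z (real j * \<delta>) \<omega>) \<le> G (X z (real j * \<delta>) \<omega>)})"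
  have SF: "S j \<in> sets (F (real j * \<delta>))" for j
  proof -
    have [measurable]: "X z (real j * \<delta>) \<in> borel_measurable (F (real j * \<delta>))" by (rule X_adapted[OF pos])
    have "{\<omega>\<in>space (F (real j * \<delta>)). g j (X z (real j * \<delta>) \<omega>) \<le> G (X z (real j * \<delta>) \<omega>)} \<in> sets (F (real j * \<delta>))"
      by measurable
    then show ?thesis unfolding S_def using pos by (simp add: space_F)
  qed
  define R where "R = (\<lambda>i. space N - (\<Union>j<i. S j))"
  have RF: "R i \<in> sets (F (real j * \<delta>))" if "i \<le> Suc j" for i j
  proof -
    have "S k \<in> sets (F (real j * \<delta>))" if "k < i" for k
      using SF[of k] F_mono[OF pos le, of k j] that \<open>i \<le> Suc j\<close> by auto
    then have "(\<Union>k<i. S k) \<in> sets (F (real j * \<delta>))" by auto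
    then show ?thesis unfolding R_def using sets.compl_sets[of _ "F (real j * \<delta>)"] pos by (simp add: space_F)
  qed
  define D where "D = (\<lambda>j. R j \<inter> S j)"
  have DF: "D j \<in> sets (F (real j * \<delta>))" for j unfolding D_def using RF[of j j] SF by auto
  have [measurable]: "D j \<in> sets N" "R j \<in> sets N" for j
    using sets_F[OF pos DF] sets_F[OF pos RF[of j j]] by auto
  have Sn: "S n = space N" by (simp add: S_def gn)
  have dj: "disjoint_family_on D {..n}"
    unfolding disjoint_family_on_def
  proof (intro ballI impI)
    fix i j :: nat assume "i \<noteq> j"
    then show "D i \<inter> D j = {}" unfolding D_def R_def by (cases i j rule: linorder_cases) auto
  qed
  have un: "(\<Union>j\<le>n. D j) = space N"
  proof
    show "(\<Union>j\<le>n. D j) \<subseteq> space N" by (auto simp: D_def S_def)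
    show "space N \<subseteq> (\<Union>j\<le>n. D j)"
    proof
      fix \<omega> assume \<omega>: "\<omega> \<in> space N"
      define j where "j = (LEAST j. \<omega> \<in> S j)"
      have "\<omega> \<in> S n" using \<omega> Sn by simp
      then have "\<omega> \<in> S j" "j \<le> n" unfolding j_def by (rule LeastI, rule Least_le)
      moreover have "\<omega> \<notin> S k" if "k < j" for k using not_less_Least[of k] that unfolding j_def by blast
      ultimately show "\<omega> \<in> (\<Union>j\<le>n. D j)" using \<omega> unfolding D_def R_def by blast
    qed
  qed
  define h where "h = (\<lambda>f j \<omega>. disc (real j * \<delta>) * f (X z (real j * \<delta>) \<omega>))"
  have hN[measurable]: "h f j \<in> borel_measurable N" if [measurable]: "f \<in> borel_measurable borel" for f j unfolding h_def by measurable
  have claim: "(\<Sum>j<i. \<integral>\<^sup>+\<omega>. indicator (D j) \<omega> * h G j \<omega> \<partial>N) + (\<integral>\<^sup>+\<omega>. indicator (R i) \<omega> * h (g i) i \<omega> \<partial>N) = g 0 z" if "i \<le> n" for i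
    using that
  proof (induction i)
    case 0
    have "(\<integral>\<^sup>+\<omega>. indicator (R 0) \<omega> * h (g 0) 0 \<omega> \<partial>N) = (\<integral>\<^sup>+\<omega>. g 0 z \<partial>N)"
      by (rule nn_integral_cong_AE) (use X_0[of z] AE_space in eventually_elim, simp add: R_def h_def)
    then show ?case by (simp add: emeasure_space_1)
  next
    case (Suc i)
    then have i: "i < n" by simp
    have split: "indicator (R i) \<omega> * h (g i) i \<omega> = indicator (D i) \<omega> * h G i \<omega> + indicator (R (Suc i)) \<omega> * h (\<lambda>x. disc \<delta> * P \<delta> (g (Suc i)) x) i \<omega>"
      if \<omega>: "\<omega> \<in> space N" for \<omega>
    proof (cases "\<omega> \<in> R i")
      case False
      then show ?thesis by (auto simp: D_def R_def indicator_def less_Suc_eq)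
    next
      case R: True
      show ?thesis
      proof (cases "\<omega> \<in> S i")
        case True
        then have "g i (X z (real i * \<delta>) \<omega>) = G (X z (real i * \<delta>) \<omega>)"
          using gS[OF i] by (intro antisym) (auto simp: S_def)
        then show ?thesis using True R by (auto simp: D_def R_def h_def indicator_def less_Suc_eq)
      next
        case False
        then have "G (X z (real i * \<delta>) \<omega>) < g i (X z (real i * \<delta>) \<omega>)" using \<omega> by (auto simp: S_def not_le)
        then have "g i (X z (real i * \<delta>) \<omega>) = disc \<delta> * P \<delta> (g (Suc i)) (X z (real i * \<delta>) \<omega>)"
          unfolding gS[OF i] by (auto simp: max_def split: if_splits)
        then show ?thesis using False R by (auto simp: D_def R_def h_def indicator_def less_Suc_eq)
      qed
    qed
    have "(\<integral>\<^sup>+\<omega>. indicator (R i) \<omega> * h (g i) i \<omega> \<partial>N) = (\<integral>\<^sup>+\<omega>. indicator (D i) \<omega> * h G i \<omega> + indicator (R (Suc i)) \<omega> * h (\<lambda>x. disc \<delta> * P \<delta> (g (Suc i)) x) i \<omega> \<partial>N)"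
      using split by (intro nn_integral_cong) auto
    also have "\<dots> = (\<integral>\<^sup>+\<omega>. indicator (D i) \<omega> * h G i \<omega> \<partial>N) + (\<integral>\<^sup>+\<omega>. indicator (R (Suc i)) \<omega> * h (\<lambda>x. disc \<delta> * P \<delta> (g (Suc i)) x) i \<omega> \<partial>N)"
      by (rule nn_integral_add) measurable
    also have "(\<integral>\<^sup>+\<omega>. indicator (R (Suc i)) \<omega> * h (\<lambda>x. disc \<delta> * P \<delta> (g (Suc i)) x) i \<omega> \<partial>N) = (\<integral>\<^sup>+\<omega>. indicator (R (Suc i)) \<omega> * h (g (Suc i)) (Suc i) \<omega> \<partial>N)"
      unfolding h_def by (rule markov_disc[OF \<delta> RF, symmetric]) auto
    finally show ?case using Suc.IH i by (simp add: add.assoc)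
  qed
  have "R n = D n" using Sn by (auto simp: D_def R_def)
  then have "(\<Sum>j\<le>n. \<integral>\<^sup>+\<omega>. indicator (D j) \<omega> * h G j \<omega> \<partial>N) = g 0 z"
    using claim[of n] by (simp add: gn lessThan_Suc_atMost[symmetric])
  then show ?thesis using DF dj un unfolding h_def g_def by (intro exI[of _ D]) auto
qed

end

section \<open>Comparison with the continuous-time value\<close>

context gbm
begin

text \<open>An optimal rule on the grid is a stopping time of the continuous problem. It takes grid
  values only, so \<open>Z\<close> and \<open>X\<close>, equal almost surely at each fixed time,
  agree along it.\<close>

lemma H_le_stopping_value:
  assumes FF: "\<And>t. 0 \<le> t \<Longrightarrow> FF (ennreal t) = F t"
    and FFmono: "\<And>s t. s \<le> t \<Longrightarrow> sets (FF s) \<subseteq> sets (FF t)" and FFspace: "\<And>t. space (FF t) = space N"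
    and ZX: "\<And>t. 0 \<le> t \<Longrightarrow> AE \<omega> in N. Z z t \<omega> = X z t \<omega>"
    and G[measurable]: "G \<in> borel_measurable borel" and Gg: "\<And>x. 0 < x \<Longrightarrow> G x = ennreal (g x)"
    and z: "0 < z" and \<delta>: "0 \<le> \<delta>"
  shows "H G \<delta> z \<le> stopping_value N FF Z \<rho> g z"
  unfolding H_def
proof (rule SUP_least)
  fix n
  have pos: "0 \<le> real j * \<delta>" for j using \<delta> by simp
  obtain D where D: "\<forall>j\<le>n. D j \<in> sets (F (real j * \<delta>))" "disjoint_family_on D {..n}" "(\<Union>j\<le>n. D j) = space N"
    "(\<Sum>j\<le>n. \<integral>\<^sup>+\<omega>. indicator (D j) \<omega> * (disc (real j * \<delta>) * G (X z (real j * \<delta>) \<omega>)) \<partial>N) = (bellman G \<delta> ^^ n) G z"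
    using optimal_rule[OF \<delta> G, of n z] by (elim exE conjE)
  define J where "J = (\<lambda>\<omega>. LEAST j. \<omega> \<in> D j)"
  have J: "J \<omega> = j" if "j \<le> n" "\<omega> \<in> D j" for j \<omega>
  proof -
    have "\<omega> \<in> D (J \<omega>)" "J \<omega> \<le> j" unfolding J_def using that(2) by (rule LeastI, rule Least_le)
    then show ?thesis using disjoint_family_onD[OF D(2), of "J \<omega>" j] that by auto
  qed
  define \<tau> where "\<tau> = (\<lambda>\<omega>. ennreal (real (J \<omega>) * \<delta>))"
  have "stopping_time FF \<tau>"
  proof (rule stopping_timeI)
    fix t
    have "{\<omega>\<in>space N. \<tau> \<omega> \<le> t} = (\<Union>j\<in>{j. j \<le> n \<and> ennreal (real j * \<delta>) \<le> t}. D j)"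
    proof (intro set_eqI iffI)
      fix \<omega> assume \<omega>: "\<omega> \<in> {\<omega>\<in>space N. \<tau> \<omega> \<le> t}"
      then obtain j where j: "j \<le> n" "\<omega> \<in> D j" using D(3) by blast
      then show "\<omega> \<in> (\<Union>j\<in>{j. j \<le> n \<and> ennreal (real j * \<delta>) \<le> t}. D j)" using \<omega> J[OF j] by (auto simp: \<tau>_def)
    next
      fix \<omega> assume "\<omega> \<in> (\<Union>j\<in>{j. j \<le> n \<and> ennreal (real j * \<delta>) \<le> t}. D j)"
      then obtain j where j: "j \<le> n" "ennreal (real j * \<delta>) \<le> t" "\<omega> \<in> D j" by blast
      then show "\<omega> \<in> {\<omega>\<in>space N. \<tau> \<omega> \<le> t}" using J[OF j(1,3)] D(3) by (auto simp: \<tau>_def)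
    qed
    also have "\<dots> \<in> sets (FF t)"
    proof (intro sets.finite_UN)
      fix j assume "j \<in> {j. j \<le> n \<and> ennreal (real j * \<delta>) \<le> t}"
      then show "D j \<in> sets (FF t)" using D(1) FFmono[of "ennreal (real j * \<delta>)" t] FF[OF pos[of j]] by auto
    qed simp
    finally show "Measurable.pred (FF t) (\<lambda>\<omega>. \<tau> \<omega> \<le> t)" by (simp add: pred_def FFspace)
  qed
  moreover have "(bellman G \<delta> ^^ n) G z \<le> (\<integral>\<^sup>+ \<omega>. (if \<tau> \<omega> = \<infinity> then 0
              else ennreal (exp (- \<rho> * enn2real (\<tau> \<omega>)) * g (Z z (enn2real (\<tau> \<omega>)) \<omega>))) \<partial>N)"
  proof -
    have [measurable]: "D j \<in> sets N" if "j \<le> n" for j using D(1) that sets_F[OF pos] by blast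
    have [measurable]: "X z (real j * \<delta>) \<in> borel_measurable N" for j by (rule X_measurable[OF pos])
    have "(bellman G \<delta> ^^ n) G z = (\<integral>\<^sup>+\<omega>. (\<Sum>j\<le>n. indicator (D j) \<omega> * (disc (real j * \<delta>) * G (X z (real j * \<delta>) \<omega>))) \<partial>N)"
      unfolding D(4)[symmetric] by (subst nn_integral_sum) auto
    also have "\<dots> \<le> (\<integral>\<^sup>+ \<omega>. (if \<tau> \<omega> = \<infinity> then 0
              else ennreal (exp (- \<rho> * enn2real (\<tau> \<omega>)) * g (Z z (enn2real (\<tau> \<omega>)) \<omega>))) \<partial>N)"
    proof (rule nn_integral_mono_AE)
      have "AE \<omega> in N. \<forall>j::nat. Z z (real j * \<delta>) \<omega> = X z (real j * \<delta>) \<omega>"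
        unfolding AE_all_countable using ZX[OF pos] by blast
      then show "AE \<omega> in N. (\<Sum>j\<le>n. indicator (D j) \<omega> * (disc (real j * \<delta>) * G (X z (real j * \<delta>) \<omega>))) \<le>
          (if \<tau> \<omega> = \<infinity> then 0 else ennreal (exp (- \<rho> * enn2real (\<tau> \<omega>)) * g (Z z (enn2real (\<tau> \<omega>)) \<omega>)))"
        using AE_space
      proof eventually_elim
        case (elim \<omega>)
        then obtain j where j: "j \<le> n" "\<omega> \<in> D j" using D(3) by blast
        have "(\<Sum>i\<le>n. indicator (D i) \<omega> * (disc (real i * \<delta>) * G (X z (real i * \<delta>) \<omega>))) =
          (\<Sum>i\<le>n. if i = j then disc (real j * \<delta>) * G (X z (real j * \<delta>) \<omega>) else 0)"
        proof (intro sum.cong refl)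
          fix i assume "i \<in> {..n}"
          then have "\<omega> \<in> D i \<longleftrightarrow> i = j" using J[OF j] J[of i \<omega>] j(2) by auto
          then show "indicator (D i) \<omega> * (disc (real i * \<delta>) * G (X z (real i * \<delta>) \<omega>)) = (if i = j then disc (real j * \<delta>) * G (X z (real j * \<delta>) \<omega>) else 0)"
            by (simp add: indicator_def)
        qed
        also have "\<dots> = disc (real j * \<delta>) * G (X z (real j * \<delta>) \<omega>)" using j(1) by simp
        also have "\<dots> = ennreal (exp (- \<rho> * (real j * \<delta>)) * g (Z z (real j * \<delta>) \<omega>))"
          using elim X_pos[OF z] by (simp add: Gg ennreal_mult')
        finally show ?case using J[OF j] pos[of j] by (simp add: \<tau>_def)
      qed
    qed
    finally show ?thesis .
  qed
  ultimately show "(bellman G \<delta> ^^ n) G z \<le> stopping_value N FF Z \<rho> g z"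
    unfolding stopping_value_def by (intro SUP_upper2[of \<tau>]) auto
qed

text \<open>Rounding a stopping time up to the next grid point keeps it a stopping time, and the
  rounded times converge to it. Continuity of \<open>g\<close> and of the paths makes the payoffs
  converge, and Fatou's lemma gives the inequality without an integrable bound.\<close>

lemma stopping_value_le_liminf:
  assumes FF: "\<And>t. 0 \<le> t \<Longrightarrow> FF (ennreal t) = F t"
    and FFspace: "\<And>t. space (FF t) = space N"
    and ZX: "\<And>t. 0 \<le> t \<Longrightarrow> AE \<omega> in N. Z z t \<omega> = X z t \<omega>"
    and Zc: "AE \<omega> in N. continuous_on {0..} (\<lambda>t. Z z t \<omega>)"
    and G[measurable]: "G \<in> borel_measurable borel" and Gg: "\<And>x. 0 < x \<Longrightarrow> G x = ennreal (g x)"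
    and g: "continuous_on {0<..} g" and z: "0 < z"
  shows "stopping_value N FF Z \<rho> g z \<le> liminf (\<lambda>k. H G (1 / 2 ^ k) z)"
  unfolding stopping_value_def
proof (rule SUP_least)
  fix \<tau> assume "\<tau> \<in> {\<tau>. stopping_time FF \<tau>}"
  then have \<tau>: "{\<omega>\<in>space N. \<tau> \<omega> \<le> t} \<in> sets (FF t)" for t
    using stopping_timeD[of FF \<tau> t] by (simp add: pred_def FFspace)
  define \<delta> :: "nat \<Rightarrow> real" where "\<delta> = (\<lambda>k. 1 / 2 ^ k)"
  have \<delta>: "0 < \<delta> k" for k by (simp add: \<delta>_def)
  have pos: "0 \<le> real j * \<delta> k" for j k using less_imp_le[OF \<delta>] by simp
  define E where "E = (\<lambda>k j. {\<omega>\<in>space N. \<tau> \<omega> \<le> ennreal (real j * \<delta> k)})"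
  \<comment> \<open>\<open>A k j\<close> is the event that the rounded time equals
    \<open>real j * \<delta> k\<close>. The case \<open>j = 0\<close> is separate because natural
    subtraction would make \<open>E k (j - 1)\<close> equal to \<open>E k 0\<close> and leave
    nothing.\<close>
  define A where "A = (\<lambda>k j. E k j - (if j = 0 then {} else E k (j - 1)))"
  have E: "E k j \<in> sets (F (real i * \<delta> k))" if "j \<le> i" for k i j
  proof -
    have "E k j \<in> sets (F (real j * \<delta> k))" unfolding E_def using \<tau>[of "ennreal (real j * \<delta> k)"] FF[OF pos] by simp
    then show ?thesis using F_mono[OF pos, of j k "real i * \<delta> k"] that \<delta>[of k] by (auto intro: mult_right_mono)
  qed
  have AF: "A k j \<in> sets (F (real j * \<delta> k))" for k j
    unfolding A_def using E[of j j k] E[of "j - 1" j k] by auto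
  have AN[measurable]: "A k j \<in> sets N" for k j by (rule sets_F[OF pos AF])
  have Emono: "E k i \<subseteq> E k j" if "i \<le> j" for i j k
  proof -
    have "ennreal (real i * \<delta> k) \<le> ennreal (real j * \<delta> k)" using that \<delta>[of k] by (intro ennreal_leI mult_right_mono) auto
    then show ?thesis unfolding E_def by (auto intro: order_trans)
  qed
  have dj: "disjoint_family (A k)" for k
    unfolding disjoint_family_on_def
  proof (intro ballI impI)
    fix i j :: nat assume "i \<noteq> j"
    then show "A k i \<inter> A k j = {}"
    proof (cases i j rule: linorder_cases)
      case less
      then have "E k i \<subseteq> E k (j - 1)" by (intro Emono) simp
      then show ?thesis using less by (auto simp: A_def)
    next
      case greater
      then have "E k j \<subseteq> E k (i - 1)" by (intro Emono) simp
      then show ?thesis using greater by (auto simp: A_def)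
    qed simp
  qed
  have XN[measurable]: "X z (real j * \<delta> k) \<in> borel_measurable N" for j k by (rule X_measurable[OF pos])
  \<comment> \<open>The payoff of the rounded time, written as a series since there is no bounded
    horizon; where \<tau> is infinite every term vanishes.\<close>
  define f where "f = (\<lambda>k \<omega>. \<Sum>j. indicator (A k j) \<omega> * (disc (real j * \<delta> k) * G (X z (real j * \<delta> k) \<omega>)))"
  have fN[measurable]: "f k \<in> borel_measurable N" for k unfolding f_def by measurable
  have fH: "(\<integral>\<^sup>+\<omega>. f k \<omega> \<partial>N) \<le> H G (1 / 2 ^ k) z" for k
  proof -
    have "(\<integral>\<^sup>+\<omega>. f k \<omega> \<partial>N) = (\<Sum>j. \<integral>\<^sup>+\<omega>. indicator (A k j) \<omega> * (disc (real j * \<delta> k) * G (X z (real j * \<delta> k) \<omega>)) \<partial>N)"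
      unfolding f_def by (rule nn_integral_suminf) measurable
    also have "\<dots> \<le> H G (\<delta> k) z"
    proof (rule suminf_le_const[OF summableI])
      fix n
      have "(\<Sum>j<n. \<integral>\<^sup>+\<omega>. indicator (A k j) \<omega> * (disc (real j * \<delta> k) * G (X z (real j * \<delta> k) \<omega>)) \<partial>N) \<le>
         (\<Sum>j<n. \<integral>\<^sup>+\<omega>. indicator (A k j) \<omega> * (disc (real j * \<delta> k) * H G (\<delta> k) (X z (real j * \<delta> k) \<omega>)) \<partial>N)"
        by (intro sum_mono nn_integral_mono mult_left_mono G_le_H) auto
      also have "\<dots> \<le> H G (\<delta> k) z"
        using \<delta>[of k] by (intro superharmonic_stopped_le H_superharmonic AF dj) auto
      finally show "(\<Sum>j<n. \<integral>\<^sup>+\<omega>. indicator (A k j) \<omega> * (disc (real j * \<delta> k) * G (X z (real j * \<delta> k) \<omega>)) \<partial>N) \<le> H G (\<delta> k) z" .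
    qed
    finally show ?thesis by (simp add: \<delta>_def)
  qed
  have rats: "AE \<omega> in N. \<forall>k j. Z z (real j * \<delta> k) \<omega> = X z (real j * \<delta> k) \<omega>"
    unfolding AE_all_countable using ZX[OF pos] by blast
  have "(\<integral>\<^sup>+ \<omega>. (if \<tau> \<omega> = \<infinity> then 0 else ennreal (exp (- \<rho> * enn2real (\<tau> \<omega>)) * g (Z z (enn2real (\<tau> \<omega>)) \<omega>))) \<partial>N)
     \<le> (\<integral>\<^sup>+ \<omega>. liminf (\<lambda>k. f k \<omega>) \<partial>N)"
  proof (rule nn_integral_mono_AE)
    show "AE \<omega> in N. (if \<tau> \<omega> = \<infinity> then 0 else ennreal (exp (- \<rho> * enn2real (\<tau> \<omega>)) * g (Z z (enn2real (\<tau> \<omega>)) \<omega>))) \<le> liminf (\<lambda>k. f k \<omega>)"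
      using rats Zc W_cont AE_space
    proof eventually_elim
      case (elim \<omega>)
      show ?case
      proof (cases "\<tau> \<omega> = \<infinity>")
        case False
        define t where "t = enn2real (\<tau> \<omega>)"
        have t: "0 \<le> t" "\<tau> \<omega> = ennreal t" using False by (auto simp: t_def less_top)
        define J where "J = (\<lambda>k. nat \<lceil>t / \<delta> k\<rceil>)"
        define T where "T = (\<lambda>k. real (J k) * \<delta> k)"
        have rJ: "real (J k) = of_int \<lceil>t / \<delta> k\<rceil>" for k
          using t(1) \<delta>[of k] by (simp add: J_def)
        have b: "t \<le> T k" "T k < t + \<delta> k" for k
        proof -
          have "t / \<delta> k \<le> real (J k)" "real (J k) < t / \<delta> k + 1" unfolding rJ by linarith+
          then show "t \<le> T k" "T k < t + \<delta> k"
            using \<delta>[of k] unfolding T_def by (simp_all add: field_simps)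
        qed
        have "(\<lambda>k. (1 / 2) ^ k) \<longlonglongrightarrow> (0::real)" by (rule LIMSEQ_power_zero) simp
        then have d0: "\<delta> \<longlonglongrightarrow> 0" unfolding \<delta>_def by (simp add: power_one_over)
        have "(\<lambda>k. t + \<delta> k) \<longlonglongrightarrow> t + 0" by (intro tendsto_intros d0)
        then have up: "(\<lambda>k. t + \<delta> k) \<longlonglongrightarrow> t" by simp
        have Tt: "T \<longlonglongrightarrow> t"
        proof (rule tendsto_sandwich[OF _ _ tendsto_const up])
          show "\<forall>\<^sub>F k in sequentially. t \<le> T k" by (intro always_eventually allI b)
          show "\<forall>\<^sub>F k in sequentially. T k \<le> t + \<delta> k" by (intro always_eventually allI less_imp_le b)
        qed
        have Tpos: "0 \<le> T k" for k unfolding T_def by (rule pos)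
        have WT: "(\<lambda>k. W (T k) \<omega>) \<longlonglongrightarrow> W t \<omega>"
          using continuous_on_tendsto_compose[OF elim(3) Tt] t(1) Tpos by simp
        have XT: "(\<lambda>k. X z (T k) \<omega>) \<longlonglongrightarrow> X z t \<omega>" unfolding X_def by (intro tendsto_intros WT Tt)
        \<comment> \<open>The time \<open>t\<close> depends on \<omega>, so the almost sure equality
          of \<open>Z\<close> and \<open>X\<close> at fixed times does not cover it; both are limits
          of their common values at grid times.\<close>
        have "(\<lambda>k. Z z (T k) \<omega>) \<longlonglongrightarrow> Z z t \<omega>"
          using continuous_on_tendsto_compose[OF elim(2) Tt] t(1) Tpos by simp
        moreover have "Z z (T k) \<omega> = X z (T k) \<omega>" for k using elim(1) by (simp add: T_def)
        ultimately have ZXt: "Z z t \<omega> = X z t \<omega>" using LIMSEQ_unique[OF XT] by simp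
        have "(\<lambda>k. g (X z (T k) \<omega>)) \<longlonglongrightarrow> g (X z t \<omega>)"
          using continuous_on_tendsto_compose[OF g XT] X_pos[OF z] by simp
        then have "(\<lambda>k. ennreal (exp (- \<rho> * T k) * g (X z (T k) \<omega>))) \<longlonglongrightarrow> ennreal (exp (- \<rho> * t) * g (X z t \<omega>))"
          by (intro tendsto_intros tendsto_ennrealI Tt)
        then have "ennreal (exp (- \<rho> * t) * g (X z t \<omega>)) = liminf (\<lambda>k. ennreal (exp (- \<rho> * T k) * g (X z (T k) \<omega>)))"
          by (intro lim_imp_Liminf[symmetric]) auto
        also have "\<dots> \<le> liminf (\<lambda>k. f k \<omega>)"
        proof (intro Liminf_mono always_eventually allI)
          fix k
          have "\<omega> \<in> A k (J k)"
          proof -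
            have "\<omega> \<in> E k (J k)" unfolding E_def using elim(4) t b(1)[of k] by (simp add: T_def ennreal_leI)
            moreover have "\<omega> \<notin> E k (J k - 1)" if "J k \<noteq> 0"
            proof -
              have "real (J k - 1) * \<delta> k = T k - \<delta> k" using that by (simp add: T_def of_nat_diff left_diff_distrib)
              then have "real (J k - 1) * \<delta> k < t" using b(2)[of k] by simp
              then show ?thesis unfolding E_def using t pos by (simp add: not_le ennreal_lessI ennreal_less_iff)
            qed
            ultimately show ?thesis by (auto simp: A_def)
          qed
          then have "ennreal (exp (- \<rho> * T k) * g (X z (T k) \<omega>)) = (\<Sum>j\<in>{J k}. indicator (A k j) \<omega> * (disc (real j * \<delta> k) * G (X z (real j * \<delta> k) \<omega>)))"
            using X_pos[OF z] by (simp add: Gg T_def ennreal_mult')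
          also have "\<dots> \<le> f k \<omega>" unfolding f_def by (rule sum_le_suminf[OF summableI]) auto
          finally show "ennreal (exp (- \<rho> * T k) * g (X z (T k) \<omega>)) \<le> f k \<omega>" .
        qed
        finally show ?thesis using False ZXt by (simp add: t_def)
      qed simp
    qed
  qed
  also have "\<dots> \<le> liminf (\<lambda>k. \<integral>\<^sup>+\<omega>. f k \<omega> \<partial>N)" by (rule nn_integral_liminf) measurable
  also have "\<dots> \<le> liminf (\<lambda>k. H G (1 / 2 ^ k) z)" using fH by (intro Liminf_mono always_eventually allI)
  finally show "(\<integral>\<^sup>+ \<omega>. (if \<tau> \<omega> = \<infinity> then 0 else ennreal (exp (- \<rho> * enn2real (\<tau> \<omega>)) * g (Z z (enn2real (\<tau> \<omega>)) \<omega>))) \<partial>N)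
     \<le> liminf (\<lambda>k. H G (1 / 2 ^ k) z)" .
qed

text \<open>For \<open>k\<close> at least \<open>j\<close> the step \<open>1 / 2 ^ j\<close> is a
  multiple of \<open>1 / 2 ^ k\<close>, so each of these \<open>H\<close> is superharmonic for the
  coarse step. Fatou's lemma bounds \<open>P\<close> of \<open>V\<close> by the liminf of
  \<open>P\<close> of \<open>H\<close>, and each of these is bounded through \<open>V\<close>
  again.\<close>

lemma limit_superharmonic:
  assumes G[measurable]: "G \<in> borel_measurable borel"
    and le: "\<And>k x. 0 < x \<Longrightarrow> H G (1 / 2 ^ k) x \<le> V x" and ge: "\<And>x. 0 < x \<Longrightarrow> V x \<le> liminf (\<lambda>k. H G (1 / 2 ^ k) x)"
    and z: "0 < z"
  shows "disc (1 / 2 ^ j) * P (1 / 2 ^ j) V z \<le> V z"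
proof -
  \<comment> \<open>The discount factor is moved to the other side and back, so that the liminf
    concerns \<open>P\<close> alone.\<close>
  have one: "ennreal (exp (\<rho> * (1 / 2 ^ j))) * disc (1 / 2 ^ j) = 1"
    by (simp add: ennreal_mult[symmetric] exp_add[symmetric])
  have "P (1 / 2 ^ j) V z \<le> (\<integral>\<^sup>+y. liminf (\<lambda>k. H G (1 / 2 ^ k) (Q z (1 / 2 ^ j) y)) \<partial>gauss)"
    unfolding P_def by (intro nn_integral_mono ge Q_pos z)
  also have "\<dots> \<le> liminf (\<lambda>k. P (1 / 2 ^ j) (H G (1 / 2 ^ k)) z)"
    unfolding P_def by (rule nn_integral_liminf) measurable
  also have "\<dots> \<le> liminf (\<lambda>k::nat. ennreal (exp (\<rho> * (1 / 2 ^ j))) * V z)"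
  proof (rule Liminf_mono)
    show "\<forall>\<^sub>F k in sequentially. P (1 / 2 ^ j) (H G (1 / 2 ^ k)) z \<le> ennreal (exp (\<rho> * (1 / 2 ^ j))) * V z"
      using eventually_ge_at_top[of j]
    proof eventually_elim
      case (elim k)
      have e: "(1::real) / 2 ^ j = real (2 ^ (k - j)) * (1 / 2 ^ k)"
        using elim by (simp add: field_simps flip: power_add)
      have "disc (1 / 2 ^ j) * P (1 / 2 ^ j) (H G (1 / 2 ^ k)) z \<le> H G (1 / 2 ^ k) z"
        unfolding e by (rule H_superharmonic_multiple[OF G]) simp
      also have "\<dots> \<le> V z" by (rule le[OF z])
      finally have "ennreal (exp (\<rho> * (1 / 2 ^ j))) * (disc (1 / 2 ^ j) * P (1 / 2 ^ j) (H G (1 / 2 ^ k)) z) \<le> ennreal (exp (\<rho> * (1 / 2 ^ j))) * V z"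
        by (rule mult_left_mono) simp
      then show ?case by (simp add: mult.assoc[symmetric] one ennreal_mult[symmetric] exp_add[symmetric])
    qed
  qed
  also have "\<dots> = ennreal (exp (\<rho> * (1 / 2 ^ j))) * V z" by (simp add: Liminf_const)
  finally have "disc (1 / 2 ^ j) * P (1 / 2 ^ j) V z \<le> disc (1 / 2 ^ j) * (ennreal (exp (\<rho> * (1 / 2 ^ j))) * V z)"
    by (rule mult_left_mono) simp
  also have "\<dots> = (ennreal (exp (\<rho> * (1 / 2 ^ j))) * disc (1 / 2 ^ j)) * V z" by (simp only: mult_ac)
  also have "\<dots> = V z" unfolding one by simp
  finally show ?thesis .
qed

text \<open>The error weight \<open>1 + x\<close> is affine and superharmonic for the discounted
  semigroup (\<open>disc_P_linear_le\<close>), which makes the notion stable under one step with the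
  same \<open>c\<close>. Values in \<open>ennreal\<close> admit iterates whose finiteness has not
  been established.\<close>

definition approx_convex :: "real \<Rightarrow> (real \<Rightarrow> ennreal) \<Rightarrow> bool" where
  "approx_convex c f \<longleftrightarrow> (\<forall>x>0. \<forall>y>0. \<forall>l\<in>{0..1}. f (l * x + (1 - l) * y) \<le>
     ennreal l * f x + ennreal (1 - l) * f y + ennreal (c * (1 + (l * x + (1 - l) * y))))"

lemma approx_convexD:
  "approx_convex c f \<Longrightarrow> 0 < x \<Longrightarrow> 0 < y \<Longrightarrow> 0 \<le> l \<Longrightarrow> l \<le> 1 \<Longrightarrow> f (l * x + (1 - l) * y) \<le>
     ennreal l * f x + ennreal (1 - l) * f y + ennreal (c * (1 + (l * x + (1 - l) * y)))"
  by (auto simp: approx_convex_def)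

lemma convex_comb_pos: "0 < x \<Longrightarrow> 0 < y \<Longrightarrow> 0 \<le> l \<Longrightarrow> l \<le> 1 \<Longrightarrow> 0 < l * x + (1 - l) * (y::real)"
  by (cases "l = 0") (auto intro: add_pos_nonneg)

lemma approx_convex_mono_comb:
  assumes f: "\<And>x. 0 < x \<Longrightarrow> f x \<le> h x" "0 < x" "0 < y"
  shows "ennreal l * f x + ennreal (1 - l) * f y + c \<le> ennreal l * h x + ennreal (1 - l) * h y + c"
  using f by (intro add_mono mult_left_mono) auto

lemma approx_convex_max: "approx_convex c f \<Longrightarrow> approx_convex c h \<Longrightarrow> approx_convex c (\<lambda>x. max (f x) (h x))"
  unfolding approx_convex_def
proof (intro allI impI ballI max.boundedI)
  fix x y l :: real
  assume f: "\<forall>x>0. \<forall>y>0. \<forall>l\<in>{0..1}. f (l * x + (1 - l) * y) \<le> ennreal l * f x + ennreal (1 - l) * f y + ennreal (c * (1 + (l * x + (1 - l) * y)))"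
    and h: "\<forall>x>0. \<forall>y>0. \<forall>l\<in>{0..1}. h (l * x + (1 - l) * y) \<le> ennreal l * h x + ennreal (1 - l) * h y + ennreal (c * (1 + (l * x + (1 - l) * y)))"
    and *: "0 < x" "0 < y" "l \<in> {0..1}"
  show "f (l * x + (1 - l) * y) \<le> ennreal l * max (f x) (h x) + ennreal (1 - l) * max (f y) (h y) + ennreal (c * (1 + (l * x + (1 - l) * y)))"
    by (rule order_trans[OF f[rule_format, OF *]], rule approx_convex_mono_comb) (use * in auto)
  show "h (l * x + (1 - l) * y) \<le> ennreal l * max (f x) (h x) + ennreal (1 - l) * max (f y) (h y) + ennreal (c * (1 + (l * x + (1 - l) * y)))"
    by (rule order_trans[OF h[rule_format, OF *]], rule approx_convex_mono_comb) (use * in auto)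
qed

lemma approx_convex_SUP:
  assumes "\<And>n. approx_convex c (f n)"
  shows "approx_convex c (\<lambda>x. SUP n. f n x)"
  unfolding approx_convex_def
proof (intro allI impI ballI SUP_least)
  fix x y l :: real and n assume *: "0 < x" "0 < y" "l \<in> {0..1}"
  have "f n (l * x + (1 - l) * y) \<le> ennreal l * f n x + ennreal (1 - l) * f n y + ennreal (c * (1 + (l * x + (1 - l) * y)))"
    using approx_convexD[OF assms *(1,2)] *(3) by simp
  also have "\<dots> \<le> ennreal l * (SUP n. f n x) + ennreal (1 - l) * (SUP n. f n y) + ennreal (c * (1 + (l * x + (1 - l) * y)))"
    by (rule approx_convex_mono_comb) (use * in \<open>auto intro: SUP_upper\<close>)
  finally show "f n (l * x + (1 - l) * y) \<le> ennreal l * (SUP n. f n x) + ennreal (1 - l) * (SUP n. f n y) + ennreal (c * (1 + (l * x + (1 - l) * y)))" .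
qed

text \<open>The two bounds on \<open>V\<close> enter on opposite sides of the inequality: the liminf
  at the intermediate point, \<open>h k \<le> V\<close> at the two ends.\<close>

lemma approx_convex_limit:
  assumes h: "\<And>k. approx_convex c (h k)"
    and le: "\<And>k x. 0 < x \<Longrightarrow> h k x \<le> V x" and ge: "\<And>x. 0 < x \<Longrightarrow> V x \<le> liminf (\<lambda>k. h k x)"
  shows "approx_convex c V"
  unfolding approx_convex_def
proof (intro allI impI ballI)
  fix x y l :: real assume *: "0 < x" "0 < y" "l \<in> {0..1}"
  have "V (l * x + (1 - l) * y) \<le> liminf (\<lambda>k. h k (l * x + (1 - l) * y))"
    using * by (intro ge convex_comb_pos) auto
  also have "\<dots> \<le> liminf (\<lambda>k::nat. ennreal l * V x + ennreal (1 - l) * V y + ennreal (c * (1 + (l * x + (1 - l) * y))))"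
  proof (intro Liminf_mono always_eventually allI)
    fix k
    have "h k (l * x + (1 - l) * y) \<le> ennreal l * h k x + ennreal (1 - l) * h k y + ennreal (c * (1 + (l * x + (1 - l) * y)))"
      using approx_convexD[OF h *(1,2)] *(3) by simp
    also have "\<dots> \<le> ennreal l * V x + ennreal (1 - l) * V y + ennreal (c * (1 + (l * x + (1 - l) * y)))"
      by (rule approx_convex_mono_comb[OF le *(1,2)])
    finally show "h k (l * x + (1 - l) * y) \<le> ennreal l * V x + ennreal (1 - l) * V y + ennreal (c * (1 + (l * x + (1 - l) * y)))" .
  qed
  also have "\<dots> = ennreal l * V x + ennreal (1 - l) * V y + ennreal (c * (1 + (l * x + (1 - l) * y)))"
    by (simp add: Liminf_const)
  finally show "V (l * x + (1 - l) * y) \<le> ennreal l * V x + ennreal (1 - l) * V y + ennreal (c * (1 + (l * x + (1 - l) * y)))" .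
qed

lemma P_linear:
  assumes c: "0 \<le> c" and t: "0 \<le> t" and z: "0 < z"
  shows "P t (\<lambda>x. ennreal (c * (1 + x))) z = ennreal (c * (1 + z * exp (m * t)))"
proof -
  interpret g: prob_space gauss by (rule prob_space_gauss)
  have "P t (\<lambda>x. ennreal (c * (1 + x))) z = (\<integral>\<^sup>+y. ennreal c + ennreal (c * z * exp ((m - sg\<^sup>2 / 2) * t)) * ennreal (exp ((sg * sqrt t) * y)) \<partial>gauss)"
    unfolding P_def
  proof (intro nn_integral_cong)
    fix y
    have "c * (1 + Q z t y) = c + c * z * exp ((m - sg\<^sup>2 / 2) * t) * exp ((sg * sqrt t) * y)"
      by (simp only: Q_def exp_add mult.assoc distrib_left mult_1_right)
    then show "ennreal (c * (1 + Q z t y)) = ennreal c + ennreal (c * z * exp ((m - sg\<^sup>2 / 2) * t)) * ennreal (exp ((sg * sqrt t) * y))"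
      using c z by (simp add: ennreal_mult')
  qed
  also have "\<dots> = (\<integral>\<^sup>+y. ennreal c \<partial>gauss) + ennreal (c * z * exp ((m - sg\<^sup>2 / 2) * t)) * (\<integral>\<^sup>+y. ennreal (exp ((sg * sqrt t) * y)) \<partial>gauss)"
    by (subst nn_integral_add) (auto simp: nn_integral_cmult)
  also have "\<dots> = ennreal c + ennreal (c * z * exp ((m - sg\<^sup>2 / 2) * t)) * ennreal (exp ((sg * sqrt t)\<^sup>2 / 2))"
    unfolding nn_integral_gauss_exp using g.emeasure_space_1 by simp
  also have "\<dots> = ennreal (c + c * z * exp ((m - sg\<^sup>2 / 2) * t) * exp ((sg * sqrt t)\<^sup>2 / 2))"
    using c z by (simp add: ennreal_mult')
  also have "c + c * z * exp ((m - sg\<^sup>2 / 2) * t) * exp ((sg * sqrt t)\<^sup>2 / 2) = c * (1 + z * exp (m * t))"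
    using t by (simp add: power_mult_distrib mult.assoc exp_add[symmetric] algebra_simps)
  finally show ?thesis .
qed

lemma disc_P_linear_le:
  assumes c: "0 \<le> c" and t: "0 \<le> t" and z: "0 < z"
  shows "disc t * P t (\<lambda>x. ennreal (c * (1 + x))) z \<le> ennreal (c * (1 + z))"
proof -
  have "disc t * P t (\<lambda>x. ennreal (c * (1 + x))) z = ennreal (exp (- \<rho> * t) * (c * (1 + z * exp (m * t))))"
    unfolding P_linear[OF assms] by (simp add: ennreal_mult')
  also have "exp (- \<rho> * t) * (c * (1 + z * exp (m * t))) = c * (exp (- \<rho> * t) + z * exp ((m - \<rho>) * t))"
    by (simp add: exp_add[symmetric] algebra_simps)
  also have "\<dots> \<le> c * (1 + z)"
  proof (intro mult_left_mono add_mono c)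
    show "exp (- \<rho> * t) \<le> 1" using \<rho> t by simp
    have "exp ((m - \<rho>) * t) \<le> 1" using \<rho> t by (simp add: mult_nonpos_nonneg)
    then show "z * exp ((m - \<rho>) * t) \<le> z" using z by simp
  qed
  finally show ?thesis by (simp add: ennreal_leI)
qed

text \<open>\<open>Q\<close> is linear in its starting point, so for each value of the noise the
  inequality for \<open>f\<close> applies to the two displaced points, and integration preserves it.
  The error becomes the discounted semigroup applied to the weight, which is at most the
  weight.\<close>

lemma approx_convex_disc_P:
  assumes c: "0 \<le> c" and t: "0 \<le> t" and f[measurable]: "f \<in> borel_measurable borel" and ac: "approx_convex c f"
  shows "approx_convex c (\<lambda>x. disc t * P t f x)"
  unfolding approx_convex_def
proof (intro allI impI ballI)
  fix x y l :: real assume *: "0 < x" "0 < y" "l \<in> {0..1}"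
  let ?p = "l * x + (1 - l) * y"
  have p: "0 < ?p" using * by (intro convex_comb_pos) auto
  have "P t f ?p \<le> (\<integral>\<^sup>+v. (ennreal l * f (Q x t v) + ennreal (1 - l) * f (Q y t v)) + ennreal (c * (1 + Q ?p t v)) \<partial>gauss)"
    unfolding P_def
  proof (rule nn_integral_mono)
    fix v
    have "Q ?p t v = l * Q x t v + (1 - l) * Q y t v" by (simp add: Q_def algebra_simps)
    then show "f (Q ?p t v) \<le> (ennreal l * f (Q x t v) + ennreal (1 - l) * f (Q y t v)) + ennreal (c * (1 + Q ?p t v))"
      using approx_convexD[OF ac Q_pos[OF *(1)] Q_pos[OF *(2)], of l t v t v] *(3) by simp
  qed
  also have "\<dots> = ennreal l * P t f x + ennreal (1 - l) * P t f y + P t (\<lambda>x. ennreal (c * (1 + x))) ?p"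
    unfolding P_def by (simp add: nn_integral_add nn_integral_cmult)
  finally have "disc t * P t f ?p \<le> disc t * (ennreal l * P t f x + ennreal (1 - l) * P t f y + P t (\<lambda>x. ennreal (c * (1 + x))) ?p)"
    by (rule mult_left_mono) simp
  also have "\<dots> = ennreal l * (disc t * P t f x) + ennreal (1 - l) * (disc t * P t f y) + disc t * P t (\<lambda>x. ennreal (c * (1 + x))) ?p"
    by (simp only: distrib_left mult_ac)
  also have "\<dots> \<le> ennreal l * (disc t * P t f x) + ennreal (1 - l) * (disc t * P t f y) + ennreal (c * (1 + ?p))"
    by (intro add_left_mono disc_P_linear_le c t p)
  finally show "disc t * P t f ?p \<le> ennreal l * (disc t * P t f x) + ennreal (1 - l) * (disc t * P t f y) + ennreal (c * (1 + ?p))" .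
qed

lemma approx_convex_H:
  assumes c: "0 \<le> c" and \<delta>: "0 \<le> \<delta>" and G[measurable]: "G \<in> borel_measurable borel" and ac: "approx_convex c G"
  shows "approx_convex c (H G \<delta>)"
proof -
  have "approx_convex c ((bellman G \<delta> ^^ n) G)" for n
  proof (induction n)
    case (Suc n)
    have "approx_convex c (\<lambda>x. max (G x) (disc \<delta> * P \<delta> ((bellman G \<delta> ^^ n) G) x))"
      by (intro approx_convex_max ac approx_convex_disc_P c \<delta> Suc) measurable
    moreover have "(bellman G \<delta> ^^ Suc n) G = (\<lambda>x. max (G x) (disc \<delta> * P \<delta> ((bellman G \<delta> ^^ n) G) x))"
      by (rule ext) (simp add: bellman_def)
    ultimately show ?case by (simp only:)
  qed (simp add: ac)
  from approx_convex_SUP[OF this] show ?thesis unfolding H_def[abs_def] .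
qed

end

section \<open>Convexity and the absence of kinks\<close>

lemma convex_slope_mono:
  fixes u :: "real \<Rightarrow> real"
  assumes u: "convex_on I u" and I: "x \<in> I" "s \<in> I" "t \<in> I" and st: "s \<le> t" "s \<noteq> x" "t \<noteq> x"
  shows "(u s - u x) / (s - x) \<le> (u t - u x) / (t - x)"
proof (cases "s = t")
  case False
  have sym: "(u a - u b) / (a - b) = (u b - u a) / (b - a)" for a b
    by (metis minus_diff_eq minus_divide_divide)
  consider "x < s" "s < t" | "s < x" "x < t" | "s < t" "t < x" using st False by linarith
  then show ?thesis
  proof cases
    case 1
    then show ?thesis using convex_on_slope_le(1)[OF u I(1,3), of s] by (simp add: sym[of x])
  next
    case 2
    then show ?thesis using convex_on_slope_le[OF u I(2,3), of x] by (simp add: sym[of x t])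
  next
    case 3
    then show ?thesis using convex_on_slope_le(2)[OF u I(2,1), of t] by simp
  qed
qed simp

text \<open>The supremum \<open>a\<close> of the slopes to the left and the infimum \<open>b\<close>
  of those to the right are the one-sided derivatives, and both belong to supporting lines. If they
  differ there are two subgradients; if they agree, monotonicity of the slopes squeezes the
  difference quotient to \<open>b\<close>.\<close>

lemma convex_differentiable_if_unique_subgradient:
  fixes u :: "real \<Rightarrow> real"
  assumes u: "convex_on {0<..} u" and x: "0 < x"
    and uniq: "\<And>a b. a < b \<Longrightarrow> (\<And>y. 0 < y \<Longrightarrow> u y \<ge> u x + a * (y - x)) \<Longrightarrow> (\<And>y. 0 < y \<Longrightarrow> u y \<ge> u x + b * (y - x)) \<Longrightarrow> False"
  shows "\<exists>d. (u has_field_derivative d) (at x)"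
proof -
  define s where "s = (\<lambda>t. (u t - u x) / (t - x))"
  have mono: "s y \<le> s t" if "0 < y" "y \<le> t" "y \<noteq> x" "t \<noteq> x" for y t
    unfolding s_def using that x by (intro convex_slope_mono[OF u]) auto
  have us: "u y = u x + s y * (y - x)" if "y \<noteq> x" for y using that by (simp add: s_def)
  define b where "b = Inf (s ` {x<..})"
  define a where "a = Sup (s ` {0<..<x})"
  have R: "bdd_below (s ` {x<..})" using mono[of "x / 2"] x by (intro bdd_belowI[of _ "s (x / 2)"]) auto
  have L: "bdd_above (s ` {0<..<x})" using mono[of _ "x + 1"] x by (intro bdd_aboveI[of _ "s (x + 1)"]) auto
  have Lne: "s ` {0<..<x} \<noteq> {}" using dense[OF x] by auto
  have Rne: "s ` {x<..} \<noteq> {}" using gt_ex[of x] by auto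
  have br: "b \<le> s y" if "x < y" for y unfolding b_def using that R by (intro cInf_lower) auto
  have al: "s y \<le> a" if "0 < y" "y < x" for y unfolding a_def using that L by (intro cSup_upper) auto
  have ab: "a \<le> b" unfolding a_def
  proof (rule cSup_least[OF Lne])
    fix v assume "v \<in> s ` {0<..<x}"
    then obtain y where y: "0 < y" "y < x" "v = s y" by auto
    show "v \<le> b" unfolding b_def y(3)
      by (rule cInf_greatest[OF Rne]) (use y mono in auto)
  qed
  have sub: "u y \<ge> u x + c * (y - x)" if c: "a \<le> c" "c \<le> b" and y: "0 < y" for c y
  proof (cases y x rule: linorder_cases)
    case less
    have "s y \<le> c" using al[OF y less] c by simp
    then have "c * (y - x) \<le> s y * (y - x)" using less by (intro mult_right_mono_neg) auto
    then show ?thesis using us[of y] less by simp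
  next
    case greater
    have "c \<le> s y" using br[OF greater] c by simp
    then have "c * (y - x) \<le> s y * (y - x)" using greater by (intro mult_right_mono) auto
    then show ?thesis using us[of y] greater by simp
  qed simp
  have eq: "a = b"
  proof (rule ccontr)
    assume "a \<noteq> b"
    then have "a < b" using ab by simp
    then show False using sub ab by (intro uniq[of a b]) auto
  qed
  have "(s \<longlongrightarrow> b) (at x)"
  proof (rule order_tendstoI)
    fix c assume "b < c"
    then obtain t where t: "x < t" "s t < c" unfolding b_def using cInf_lessD[OF Rne] by auto
    have "\<forall>\<^sub>F y in at x. y \<in> {0<..<t}" using t x by (intro eventually_at_in_open') auto
    moreover have "\<forall>\<^sub>F y in at x. y \<noteq> x" by (simp add: eventually_at_filter)
    ultimately show "\<forall>\<^sub>F y in at x. s y < c"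
    proof eventually_elim
      case (elim y)
      then have "s y \<le> s t" using mono[of y t] t by auto
      then show ?case using t by simp
    qed
  next
    fix c assume "c < b"
    then have "c < a" by (simp add: eq)
    then have "\<exists>v\<in>s ` {0<..<x}. c < v" unfolding a_def by (rule less_cSupD[OF Lne])
    then obtain t where t: "0 < t" "t < x" "c < s t" by auto
    have "\<forall>\<^sub>F y in at x. y \<in> {t<..}" using t x by (intro eventually_at_in_open') auto
    moreover have "\<forall>\<^sub>F y in at x. y \<noteq> x" by (simp add: eventually_at_filter)
    ultimately show "\<forall>\<^sub>F y in at x. c < s y"
    proof eventually_elim
      case (elim y)
      then have "s t \<le> s y" using mono[of t y] t by auto
      then show ?case using t by simp
    qed
  qed
  then have "(u has_field_derivative b) (at x)"
    unfolding has_field_derivative_iff s_def .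
  then show ?thesis ..
qed

text \<open>For a fixed \<open>t\<close> near \<open>x\<close> the tangent inequality bounds
  \<open>D y\<close> by the slope from \<open>y\<close> to \<open>t\<close>, from above if
  \<open>t\<close> is to the right of \<open>y\<close> and from below if it is to the left. That
  slope is continuous in \<open>y\<close>, and at \<open>y = x\<close> it is close to
  \<open>D x\<close>; so \<open>D\<close> is upper and lower semicontinuous at
  \<open>x\<close>.\<close>

lemma convex_differentiable_imp_C1:
  fixes u :: "real \<Rightarrow> real"
  assumes u: "convex_on {0<..} u" and d: "\<And>x. 0 < x \<Longrightarrow> \<exists>d. (u has_field_derivative d) (at x)"
  shows "u C1_differentiable_on {0<..}"
proof -
  obtain D where D: "\<And>x. 0 < x \<Longrightarrow> (u has_field_derivative D x) (at x)" using d by metis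
  have cu: "isCont u x" if "0 < x" for x using D[OF that] by (rule DERIV_isCont)
  have tangent: "D y * (t - y) \<le> u t - u y" if "0 < y" "0 < t" for y t
  proof (rule convex_on_imp_above_tangent[OF u])
    show "connected {0::real<..}" by simp
    show "y \<in> interior {0<..}" using that by (subst interior_open) auto
    show "(u has_real_derivative D y) (at y within {0<..})" by (rule DERIV_subset[OF D[OF that(1)]]) simp
  qed (use that in auto)
  have slope: "((\<lambda>t. (u t - u x) / (t - x)) \<longlongrightarrow> D x) (at x)" if "0 < x" for x
    using D[OF that] by (simp add: has_field_derivative_iff)
  have "continuous_on {0<..} D"
    unfolding continuous_on_def
  proof (intro ballI order_tendstoI)
    fix x c :: real assume x: "x \<in> {0<..}" and c: "D x < c"
    have "\<forall>\<^sub>F t in at x. (u t - u x) / (t - x) < c" using slope[of x] x c by (intro order_tendstoD) auto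
    then have e1: "\<forall>\<^sub>F t in at_right x. (u t - u x) / (t - x) < c" by (rule filter_leD[OF at_le, rotated]) simp
    have e2: "\<forall>\<^sub>F t in at_right x. x < t" by (simp add: eventually_at_right_less)
    obtain t where t: "x < t" "(u t - u x) / (t - x) < c"
      using eventually_happens'[OF trivial_limit_at_right_real eventually_conj[OF e1 e2]] by auto
    have "((\<lambda>y. (u t - u y) / (t - y)) \<longlongrightarrow> (u t - u x) / (t - x)) (at x within {0<..})"
      using t x cu[of x] by (intro tendsto_intros) (auto simp: isCont_def intro: tendsto_within_subset)
    then have "\<forall>\<^sub>F y in at x within {0<..}. (u t - u y) / (t - y) < c" using t by (intro order_tendstoD) auto
    moreover have "\<forall>\<^sub>F y in at x within {0<..}. y < t"
      using t(1) by (intro order_tendstoD(2)[OF tendsto_ident_at])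
    moreover have "\<forall>\<^sub>F y in at x within {0<..}. 0 < y" by (simp add: eventually_at_filter)
    ultimately show "\<forall>\<^sub>F y in at x within {0<..}. D y < c"
    proof eventually_elim
      case (elim y)
      then have "D y \<le> (u t - u y) / (t - y)" using tangent[of y t] by (simp add: pos_le_divide_eq)
      then show ?case using elim by simp
    qed
  next
    fix x c :: real assume x: "x \<in> {0<..}" and c: "c < D x"
    have "\<forall>\<^sub>F t in at x. c < (u t - u x) / (t - x)" using slope[of x] x c by (intro order_tendstoD) auto
    then have e1: "\<forall>\<^sub>F t in at_left x. c < (u t - u x) / (t - x)" by (rule filter_leD[OF at_le, rotated]) simp
    have e2: "\<forall>\<^sub>F t in at_left x. t \<in> {0<..<x}" using x by (intro eventually_at_leftI[of 0]) auto
    obtain t where t: "0 < t" "t < x" "c < (u t - u x) / (t - x)"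
      using eventually_happens'[OF trivial_limit_at_left_real eventually_conj[OF e1 e2]] by auto
    have "((\<lambda>y. (u t - u y) / (t - y)) \<longlongrightarrow> (u t - u x) / (t - x)) (at x within {0<..})"
      using t x cu[of x] by (intro tendsto_intros) (auto simp: isCont_def intro: tendsto_within_subset)
    then have "\<forall>\<^sub>F y in at x within {0<..}. c < (u t - u y) / (t - y)" using t by (intro order_tendstoD) auto
    moreover have "\<forall>\<^sub>F y in at x within {0<..}. t < y"
      using t(2) by (intro order_tendstoD(1)[OF tendsto_ident_at])
    ultimately show "\<forall>\<^sub>F y in at x within {0<..}. c < D y"
    proof eventually_elim
      case (elim y)
      then have "D y * (t - y) \<le> u t - u y" using tangent[of y t] t by simp
      then have "(u t - u y) / (t - y) \<le> D y" using elim by (simp add: neg_divide_le_eq)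
      then show ?case using elim by simp
    qed
  qed
  moreover have "\<forall>x\<in>{0<..}. (u has_vector_derivative D x) (at x)"
    using D by (simp add: has_real_derivative_iff_has_vector_derivative)
  ultimately show ?thesis unfolding C1_differentiable_on_def by blast
qed

text \<open>This is the difference quotient at \<open>0\<close> of a function whose derivative
  vanishes there. With \<open>h = sqrt t\<close> it says that terms of order \<open>t\<close> are
  negligible against \<open>sqrt t\<close>.\<close>

lemma tendsto_exp_square_quotient: "((\<lambda>h. (exp (c * h\<^sup>2) - 1) / h) \<longlongrightarrow> 0) (at (0::real))"
proof -
  have "((\<lambda>h. exp (c * h\<^sup>2)) has_real_derivative exp (c * 0\<^sup>2) * (c * (2 * 0))) (at 0)"
    by (auto intro!: derivative_eq_intros)
  then show ?thesis by (simp add: has_field_derivative_iff)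
qed

text \<open>\<open>f\<close> may take negative values, which \<open>ennreal\<close> cuts off at
  \<open>0\<close>; the right-hand side keeps the positive part only.\<close>

lemma ennreal_integral_le_nn_integral:
  fixes f :: "'a \<Rightarrow> real"
  assumes "integrable M f"
  shows "ennreal (integral\<^sup>L M f) \<le> (\<integral>\<^sup>+x. ennreal (f x) \<partial>M)"
proof -
  have "integral\<^sup>L M f \<le> enn2real (\<integral>\<^sup>+x. ennreal (f x) \<partial>M)"
    unfolding real_lebesgue_integral_def[OF assms] using enn2real_nonneg by (simp add: algebra_simps)
  then have "ennreal (integral\<^sup>L M f) \<le> ennreal (enn2real (\<integral>\<^sup>+x. ennreal (f x) \<partial>M))" by (rule ennreal_leI)
  also have "\<dots> \<le> (\<integral>\<^sup>+x. ennreal (f x) \<partial>M)"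
    by (cases "\<integral>\<^sup>+x. ennreal (f x) \<partial>M" rule: ennreal_cases) auto
  finally show ?thesis .
qed

context gbm
begin

text \<open>The term with the square root comes from $E (Z_t - z)^+$, the excess of the two supporting
  lines at $z$ over the single line of slope $a$.\<close>

lemma superharmonic_subgradient_bound:
  fixes u :: "real \<Rightarrow> real"
  assumes z: "0 < z" and ab: "a \<le> b" and u0: "\<And>x. 0 < x \<Longrightarrow> 0 \<le> u x"
    and a: "\<And>y. 0 < y \<Longrightarrow> u y \<ge> u z + a * (y - z)" and b: "\<And>y. 0 < y \<Longrightarrow> u y \<ge> u z + b * (y - z)"
    and t: "0 \<le> t" and sup: "disc t * P t (\<lambda>x. ennreal (u x)) z \<le> ennreal (u z)"
  shows "u z + a * z * (exp (m * t) - 1) + (b - a) * z * (sg * sqrt t * (\<integral>y. max 0 y \<partial>gauss) - \<bar>m - sg\<^sup>2 / 2\<bar> * t)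
    \<le> exp (\<rho> * t) * u z"
proof -
  let ?k = "m - sg\<^sup>2 / 2"
  interpret g: prob_space gauss by (rule prob_space_gauss)
  have mx: "has_bochner_integral gauss (\<lambda>y. max 0 y) (\<integral>y. max 0 y \<partial>gauss)"
    using has_bochner_integral_gauss_id by (intro has_bochner_integral_integrable integrable_max) (auto simp: has_bochner_integral_iff)
  have Qi: "has_bochner_integral gauss (Q z t) (z * exp (m * t))"
  proof -
    have "has_bochner_integral gauss (\<lambda>y. z * exp (?k * t) * exp ((sg * sqrt t) * y)) (z * exp (?k * t) * exp ((sg * sqrt t)\<^sup>2 / 2))"
      by (intro has_bochner_integral_mult_right has_bochner_integral_gauss_exp)
    moreover have "z * exp (?k * t) * exp ((sg * sqrt t)\<^sup>2 / 2) = z * exp (m * t)"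
      using t by (simp add: power_mult_distrib mult.assoc exp_add[symmetric] algebra_simps)
    moreover have "z * exp (?k * t) * exp ((sg * sqrt t) * y) = Q z t y" for y
      by (simp only: Q_def exp_add mult.assoc)
    ultimately show ?thesis by simp
  qed
  \<comment> \<open>A minorant of \<open>u\<close> along the process: the supporting line of slope
    \<open>a\<close>, plus \<open>b - a\<close> times a lower bound for the positive part of
    \<open>Q z t y - z\<close> that comes from \<open>1 + x \<le> exp x\<close>.\<close>
  define L where "L = (\<lambda>y. u z + a * (Q z t y - z) + (b - a) * z * (sg * sqrt t * max 0 y - \<bar>?k\<bar> * t))"
  have LI: "has_bochner_integral gauss L (u z + a * (z * exp (m * t) - z) + (b - a) * z * (sg * sqrt t * (\<integral>y. max 0 y \<partial>gauss) - \<bar>?k\<bar> * t))"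
    unfolding L_def
    by (intro has_bochner_integral_add has_bochner_integral_diff has_bochner_integral_mult_right has_bochner_integral_gauss_const Qi mx)
  have Lu: "L y \<le> u (Q z t y)" for y
  proof -
    have Qp: "0 < Q z t y" by (rule Q_pos[OF z])
    have "z * (1 + (?k * t + sg * (sqrt t * y))) \<le> Q z t y"
      unfolding Q_def using z by (intro mult_left_mono exp_ge_add_one_self) auto
    then have q1: "z * (?k * t + sg * (sqrt t * y)) \<le> Q z t y - z" by (simp add: algebra_simps)
    have kt: "- (\<bar>?k\<bar> * t) \<le> ?k * t" using t mult_right_mono[of "- \<bar>?k\<bar>" ?k t] by simp
    have "z * (sg * sqrt t * max 0 y - \<bar>?k\<bar> * t) \<le> max 0 (Q z t y - z)"
    proof (cases "0 \<le> y")
      case True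
      have "z * (sg * sqrt t * max 0 y - \<bar>?k\<bar> * t) \<le> z * (?k * t + sg * (sqrt t * y))"
        using True kt z by (intro mult_left_mono) (auto simp: max_def mult.assoc)
      then show ?thesis using q1 by simp
    next
      case False
      have "z * (sg * sqrt t * max 0 y - \<bar>?k\<bar> * t) \<le> 0"
        using False z t by (simp add: max_def mult_nonneg_nonneg)
      then show ?thesis by simp
    qed
    then have "(b - a) * (z * (sg * sqrt t * max 0 y - \<bar>?k\<bar> * t)) \<le> (b - a) * max 0 (Q z t y - z)"
      using ab by (intro mult_left_mono) auto
    then have "L y \<le> u z + a * (Q z t y - z) + (b - a) * max 0 (Q z t y - z)"
      unfolding L_def by (simp add: mult.assoc)
    also have "\<dots> \<le> u (Q z t y)"
      using a[OF Qp] b[OF Qp] by (auto simp: max_def algebra_simps)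
    finally show ?thesis .
  qed
  define l where "l = u z + a * (z * exp (m * t) - z) + (b - a) * z * (sg * sqrt t * (\<integral>y. max 0 y \<partial>gauss) - \<bar>?k\<bar> * t)"
  have "ennreal l \<le> (\<integral>\<^sup>+y. ennreal (L y) \<partial>gauss)"
    using ennreal_integral_le_nn_integral[of gauss L] LI by (simp add: has_bochner_integral_iff l_def)
  also have "\<dots> \<le> P t (\<lambda>x. ennreal (u x)) z"
    unfolding P_def by (intro nn_integral_mono ennreal_leI Lu)
  finally have "disc t * ennreal l \<le> disc t * P t (\<lambda>x. ennreal (u x)) z" by (rule mult_left_mono) simp
  then have "ennreal (exp (- \<rho> * t) * l) \<le> ennreal (u z)" using sup by (simp add: ennreal_mult')
  then have "exp (- \<rho> * t) * l \<le> u z" using u0[OF z] by (simp add: ennreal_le_iff)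
  then have "exp (\<rho> * t) * (exp (- \<rho> * t) * l) \<le> exp (\<rho> * t) * u z" by (intro mult_left_mono) auto
  moreover have "exp (\<rho> * t) * (exp (- \<rho> * t) * l) = l" by (simp add: mult.assoc[symmetric] exp_add[symmetric])
  ultimately show ?thesis by (simp add: l_def algebra_simps)
qed

text \<open>If the positive part had integral \<open>0\<close>, the negative part would too, since
  the mean is \<open>0\<close>; then \<open>y = 0\<close> almost everywhere, against variance
  1.\<close>

lemma gauss_positive_part: "0 < (\<integral>y. max 0 y \<partial>gauss)"
proof -
  have i: "integrable gauss (\<lambda>y. max 0 y)" "integrable gauss (\<lambda>y. max 0 (-y))"
    using has_bochner_integral_gauss_id by (auto simp: has_bochner_integral_iff intro!: integrable_max)
  have n: "0 \<le> (\<integral>y. max 0 y \<partial>gauss)" by (rule integral_nonneg_AE) simp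
  have "(\<integral>y. max 0 y \<partial>gauss) \<noteq> 0"
  proof
    assume 0: "(\<integral>y. max 0 y \<partial>gauss) = 0"
    then have "AE y in gauss. max 0 y = (0::real)"
      using integral_nonneg_eq_0_iff_AE[OF i(1)] by simp
    then have e1: "AE y in gauss. y \<le> 0" by eventually_elim (simp add: max_def split: if_splits)
    have "(\<integral>y. y \<partial>gauss) = 0" using has_bochner_integral_gauss_id by (simp add: has_bochner_integral_iff)
    moreover have "(\<integral>y. max 0 (-y) \<partial>gauss) = (\<integral>y. - y \<partial>gauss)"
      using e1 by (intro integral_cong_AE) (auto simp: max_def)
    ultimately have "(\<integral>y. max 0 (-y) \<partial>gauss) = 0" by simp
    then have "AE y in gauss. max 0 (-y) = (0::real)"
      using integral_nonneg_eq_0_iff_AE[OF i(2)] by simp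
    with e1 have "AE y in gauss. y\<^sup>2 = 0" by eventually_elim (simp add: max_def split: if_splits)
    then have "(\<integral>y. y\<^sup>2 \<partial>gauss) = (\<integral>y. 0 \<partial>gauss)" by (intro integral_cong_AE) auto
    then show False using has_bochner_integral_gauss_square by (simp add: has_bochner_integral_iff)
  qed
  then show ?thesis unfolding less_le using n by metis
qed

theorem superharmonic_convex_C1:
  fixes u :: "real \<Rightarrow> real"
  assumes u: "convex_on {0<..} u" and u0: "\<And>x. 0 < x \<Longrightarrow> 0 \<le> u x"
    and sup: "\<And>x j. 0 < x \<Longrightarrow> disc (1 / 2 ^ j) * P (1 / 2 ^ j) (\<lambda>x. ennreal (u x)) x \<le> ennreal (u x)"
  shows "u C1_differentiable_on {0<..}"
proof (rule convex_differentiable_imp_C1[OF u convex_differentiable_if_unique_subgradient[OF u]])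
  fix z a b :: real
  assume z: "0 < z" and ab: "a < b" and a: "\<And>y. 0 < y \<Longrightarrow> u y \<ge> u z + a * (y - z)" and b: "\<And>y. 0 < y \<Longrightarrow> u y \<ge> u z + b * (y - z)"
  define c where "c = (\<integral>y. max 0 y \<partial>gauss)"
  define k where "k = \<bar>m - sg\<^sup>2 / 2\<bar>"
  define h :: "nat \<Rightarrow> real" where "h = (\<lambda>j. sqrt (1 / 2 ^ j))"
  have h: "0 < h j" "(h j)\<^sup>2 = 1 / 2 ^ j" "sqrt (1 / 2 ^ j) = h j" for j by (auto simp: h_def)
  have "(\<lambda>j. sqrt ((1 / 2) ^ j)) \<longlonglongrightarrow> sqrt 0" by (intro tendsto_intros LIMSEQ_power_zero) simp
  then have h0: "h \<longlonglongrightarrow> 0" by (simp add: h_def power_one_over)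
  then have hat: "filterlim h (at 0) sequentially"
    using h(1) by (intro filterlim_atI) (auto simp: less_imp_neq[symmetric])
  \<comment> \<open>The subgradient bound at time \<open>(h j)\<^sup>2\<close>, divided by
    \<open>h j\<close>: the left side does not depend on \<open>j\<close>, and every term on the
    right tends to \<open>0\<close>.\<close>
  have le: "(b - a) * z * sg * c \<le> u z * ((exp (\<rho> * (h j)\<^sup>2) - 1) / h j) - a * z * ((exp (m * (h j)\<^sup>2) - 1) / h j) + (b - a) * z * k * h j" for j
  proof -
    have "u z + a * z * (exp (m * (h j)\<^sup>2) - 1) + (b - a) * z * (sg * h j * c - k * (h j)\<^sup>2) \<le> exp (\<rho> * (h j)\<^sup>2) * u z"
      using superharmonic_subgradient_bound[OF z less_imp_le[OF ab] u0 a b _ sup[OF z], of j]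
      unfolding h(3) c_def[symmetric] k_def[symmetric] by (simp add: h(2))
    moreover have "(u z * ((exp (\<rho> * (h j)\<^sup>2) - 1) / h j) - a * z * ((exp (m * (h j)\<^sup>2) - 1) / h j) + (b - a) * z * k * h j) * h j =
        u z * (exp (\<rho> * (h j)\<^sup>2) - 1) - a * z * (exp (m * (h j)\<^sup>2) - 1) + (b - a) * z * k * (h j)\<^sup>2"
      using h(1)[of j] by (simp add: left_diff_distrib distrib_right power2_eq_square)
    ultimately have "((b - a) * z * sg * c) * h j \<le> (u z * ((exp (\<rho> * (h j)\<^sup>2) - 1) / h j) - a * z * ((exp (m * (h j)\<^sup>2) - 1) / h j) + (b - a) * z * k * h j) * h j"
      by (simp only:) (simp add: algebra_simps)
    then show ?thesis using h(1)[of j] by (simp only: mult_le_cancel_right_pos)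
  qed
  have "(\<lambda>j. u z * ((exp (\<rho> * (h j)\<^sup>2) - 1) / h j) - a * z * ((exp (m * (h j)\<^sup>2) - 1) / h j) + (b - a) * z * k * h j)
     \<longlonglongrightarrow> u z * 0 - a * z * 0 + (b - a) * z * k * 0"
    by (intro tendsto_intros h0 filterlim_compose[OF tendsto_exp_square_quotient hat])
  then have "(b - a) * z * sg * c \<le> u z * 0 - a * z * 0 + (b - a) * z * k * 0"
    by (rule LIMSEQ_le_const) (use le in blast)
  moreover have "0 < (b - a) * z * sg * c" using ab z sg gauss_positive_part by (simp add: c_def)
  ultimately show False by simp
qed

end

section \<open>The fixed point\<close>

lemma real_distribution_interval_measure_cdf:
  assumes "cdf_of_nonneg_rv F"
  shows "real_distribution (interval_measure F)"
proof -
  obtain D where D: "real_distribution D" "F = cdf D" using assms by (auto simp: cdf_of_nonneg_rv_def)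
  interpret real_distribution D by (rule D)
  show ?thesis unfolding D(2)
    by (intro real_distribution_interval_measure cdf_nondecreasing cdf_is_right_cont cdf_lim_at_bot cdf_lim_at_top_prob)
qed

lemma ennreal_convex_combination:
  assumes "0 \<le> l" "l \<le> 1" "0 \<le> a" "0 \<le> b" "0 \<le> e"
  shows "ennreal l * ennreal a + ennreal (1 - l) * ennreal b + ennreal e = ennreal (l * a + (1 - l) * b + e)"
  using assms by (simp add: ennreal_mult)

locale gbm_payoff = gbm N F W m sg \<rho> for N :: "'a measure" and F W m sg \<rho> +
  fixes D :: "real measure" and p K :: real and u :: "real \<Rightarrow> real"
  assumes D: "real_distribution D" and p: "0 < p" "p < 1" and K: "0 \<le> K"
    and u_cont: "continuous_on {0<..} u" and u_nonneg: "\<And>x. 0 < x \<Longrightarrow> 0 \<le> u x"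
    and u_le: "\<And>x. 0 < x \<Longrightarrow> u x \<le> K * (1 + x)"
begin

sublocale D: real_distribution D by (rule D)

text \<open>\<open>u\<close> is arbitrary off the positive half-line; the indicator makes the
  integrand of the payoff operator Borel on the whole line without changing its values along the
  positive process.\<close>

definition r :: "real \<Rightarrow> real" where
  "r x = indicator {0<..} x * (p * (1 + x) + (1 - p) * u x)"

definition h :: "real \<Rightarrow> ennreal" where "h x = ennreal (r x)"

definition c0 :: real where "c0 = p + (1 - p) * K"

text \<open>The payoff operator with values in \<open>ennreal\<close>, where Tonelli and comparison
  arguments carry no integrability conditions; \<open>Pi_operator_eq\<close> identifies the
  two.\<close>

definition PiN :: "real \<Rightarrow> ennreal" where
  "PiN z = (\<integral>\<^sup>+t. indicator {0..} t * (disc t * P t h z) \<partial>D)"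

section \<open>Growth, measurability and continuity of the payoff operator\<close>

lemma c0: "0 \<le> c0" using p K by (simp add: c0_def)

lemma r_measurable[measurable]: "r \<in> borel_measurable borel"
proof -
  have "continuous_on {0<..} (\<lambda>x. p * (1 + x) + (1 - p) * u x)" by (intro continuous_intros u_cont)
  then have "(\<lambda>x. indicator {0<..} x *\<^sub>R (p * (1 + x) + (1 - p) * u x)) \<in> borel_measurable borel"
    by (intro borel_measurable_continuous_on_indicator) auto
  then show ?thesis by (simp add: r_def[abs_def])
qed

lemma h_measurable[measurable]: "h \<in> borel_measurable borel"
  unfolding h_def by measurable

lemma r_pos: "0 < x \<Longrightarrow> r x = p * (1 + x) + (1 - p) * u x" by (simp add: r_def)

lemma r_nonneg: "0 \<le> r x" using u_nonneg[of x] p by (simp add: r_def indicator_def)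

lemma r_le: "0 < x \<Longrightarrow> r x \<le> c0 * (1 + x)"
proof -
  assume x: "0 < x"
  have "(1 - p) * u x \<le> (1 - p) * (K * (1 + x))" using u_le[OF x] p by (intro mult_left_mono) auto
  then show ?thesis using x by (simp add: r_pos c0_def algebra_simps)
qed

lemma h_le: "0 < x \<Longrightarrow> h x \<le> ennreal (c0 * (1 + x))"
  unfolding h_def by (intro ennreal_leI r_le)

lemma P_mono_pos: "0 < z \<Longrightarrow> (\<And>x. 0 < x \<Longrightarrow> f x \<le> g x) \<Longrightarrow> P t f z \<le> P t g z"
  unfolding P_def by (intro nn_integral_mono) (simp add: Q_pos)

lemma disc_P_h_le: "0 < z \<Longrightarrow> 0 \<le> t \<Longrightarrow> disc t * P t h z \<le> ennreal (c0 * (1 + z))"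
  by (rule order_trans[OF mult_left_mono[OF P_mono_pos[OF _ h_le]] disc_P_linear_le[OF c0]]) auto

lemma P_h_finite: "0 < z \<Longrightarrow> 0 \<le> t \<Longrightarrow> P t h z < \<infinity>"
proof -
  assume zt: "0 < z" "0 \<le> t"
  have "P t h z \<le> P t (\<lambda>x. ennreal (c0 * (1 + x))) z" by (rule P_mono_pos[OF zt(1) h_le])
  also have "\<dots> < \<infinity>" unfolding P_linear[OF c0 zt(2,1)] by simp
  finally show ?thesis .
qed

lemma P_h_measurable_time: "(\<lambda>t. P t h z) \<in> borel_measurable borel"
proof -
  interpret g: prob_space gauss by (rule prob_space_gauss)
  have "(\<lambda>(t, y). h (z * exp ((m - sg\<^sup>2 / 2) * t + sg * (sqrt t * y)))) \<in> borel_measurable (borel \<Otimes>\<^sub>M gauss)"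
  proof -
    have "sets (borel \<Otimes>\<^sub>M gauss) = sets (borel \<Otimes>\<^sub>M (borel :: real measure))" by (rule sets_pair_measure_cong) auto
    then show ?thesis by (subst measurable_cong_sets[OF _ refl]) measurable
  qed
  from g.borel_measurable_nn_integral[OF this] show ?thesis unfolding P_def Q_def by simp
qed

lemma P_h_measurable_pair: "(\<lambda>(z, t). P t h z) \<in> borel_measurable (borel \<Otimes>\<^sub>M borel)"
proof -
  interpret g: prob_space gauss by (rule prob_space_gauss)
  have "(\<lambda>(x, y). h (fst x * exp ((m - sg\<^sup>2 / 2) * snd x + sg * (sqrt (snd x) * y)))) \<in> borel_measurable ((borel \<Otimes>\<^sub>M borel) \<Otimes>\<^sub>M gauss)"
  proof -
    have "sets ((borel \<Otimes>\<^sub>M borel) \<Otimes>\<^sub>M gauss) = sets ((borel \<Otimes>\<^sub>M borel) \<Otimes>\<^sub>M (borel :: real measure))" by (rule sets_pair_measure_cong) auto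
    then show ?thesis by (subst measurable_cong_sets[OF _ refl]) measurable
  qed
  from g.borel_measurable_nn_integral[OF this] show ?thesis unfolding P_def Q_def by (simp add: case_prod_beta)
qed

lemma PiN_measurable[measurable]: "PiN \<in> borel_measurable borel"
proof -
  have "(\<lambda>(z, t). indicator {0..} t * (disc t * P t h z)) \<in> borel_measurable (borel \<Otimes>\<^sub>M D)"
  proof -
    have s: "sets (borel \<Otimes>\<^sub>M D) = sets (borel \<Otimes>\<^sub>M (borel :: real measure))" by (rule sets_pair_measure_cong) auto
    show ?thesis
      unfolding measurable_cong_sets[OF s refl] using P_h_measurable_pair
      by (auto simp: case_prod_beta intro!: borel_measurable_times_ennreal)
  qed
  from D.borel_measurable_nn_integral[OF this] show ?thesis unfolding PiN_def by simp
qed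

lemma PiN_le: "0 < z \<Longrightarrow> PiN z \<le> ennreal (c0 * (1 + z))"
proof -
  assume z: "0 < z"
  have "PiN z \<le> (\<integral>\<^sup>+t. ennreal (c0 * (1 + z)) \<partial>D)"
    unfolding PiN_def using disc_P_h_le[OF z] by (intro nn_integral_mono) (auto simp: indicator_def)
  then show ?thesis using D.emeasure_space_1 by simp
qed

lemma Pi_operator_eq:
  assumes ZX: "\<And>t. 0 \<le> t \<Longrightarrow> AE \<omega> in N. Z z t \<omega> = X z t \<omega>" and z: "0 < z"
    and F': "interval_measure F' = D"
  shows "ennreal (Pi_operator N Z F' \<rho> p u z) = PiN z"
proof -
  have inner: "(LINT \<omega>|N. p * (1 + Z z t \<omega>) + (1 - p) * u (Z z t \<omega>)) = enn2real (P t h z)" if t: "0 \<le> t" for t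
  proof -
    have Xm: "X z t \<in> borel_measurable (F t)" by (rule X_adapted[OF t])
    have rm: "(\<lambda>\<omega>. r (X z t \<omega>)) \<in> borel_measurable (F t)" using Xm by measurable
    have rN: "(\<lambda>\<omega>. r (X z t \<omega>)) \<in> borel_measurable N" by (rule measurable_F_N[OF rm t])
    have ae: "AE \<omega> in N. r (X z t \<omega>) = p * (1 + Z z t \<omega>) + (1 - p) * u (Z z t \<omega>)"
      using ZX[OF t] by eventually_elim (simp add: r_pos X_pos z)
    \<comment> \<open>\<open>u\<close> need not be Borel off the positive half-line, and
      \<open>Z\<close> is positive only almost surely. Measurability therefore comes from the
      version \<open>r (X z t \<omega>)\<close> through completeness.\<close>
    have "(\<lambda>\<omega>. p * (1 + Z z t \<omega>) + (1 - p) * u (Z z t \<omega>)) \<in> borel_measurable N"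
      by (rule measurable_F_N[OF AE_cong_F[OF rm ae t] t])
    then have "(LINT \<omega>|N. p * (1 + Z z t \<omega>) + (1 - p) * u (Z z t \<omega>)) = (LINT \<omega>|N. r (X z t \<omega>))"
      using ae rN by (intro integral_cong_AE) auto
    also have "\<dots> = enn2real (\<integral>\<^sup>+\<omega>. ennreal (r (X z t \<omega>)) \<partial>N)"
      by (rule integral_eq_nn_integral[OF rN]) (simp add: r_nonneg)
    also have "(\<integral>\<^sup>+\<omega>. ennreal (r (X z t \<omega>)) \<partial>N) = P t h z"
      using nn_integral_X[OF t h_measurable] by (simp add: h_def)
    finally show ?thesis .
  qed
  define v where "v = (\<lambda>t. indicator {0..} t * (exp (- \<rho> * t) * enn2real (P t h z)))"
  have vm: "v \<in> borel_measurable D" unfolding v_def using P_h_measurable_time[of z] by measurable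
  have v0: "0 \<le> v t" for t by (simp add: v_def)
  have ev: "ennreal (v t) = indicator {0..} t * (disc t * P t h z)" for t
  proof (cases "0 \<le> t")
    case True
    \<comment> \<open>\<open>enn2real\<close> sends an infinite value to \<open>0\<close>; linear
      growth of \<open>u\<close> excludes that case.\<close>
    then have "ennreal (enn2real (P t h z)) = P t h z" using P_h_finite[OF z True] by simp
    then show ?thesis using True by (simp add: v_def ennreal_mult')
  qed (simp add: v_def)
  have "Pi_operator N Z F' \<rho> p u z = (\<integral>t. v t \<partial>D)"
    unfolding Pi_operator_def F' set_lebesgue_integral_def v_def
    by (intro Bochner_Integration.integral_cong refl) (auto simp: indicator_def inner)
  also have "\<dots> = enn2real (\<integral>\<^sup>+t. ennreal (v t) \<partial>D)" by (rule integral_eq_nn_integral[OF vm]) (simp add: v0)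
  also have "(\<integral>\<^sup>+t. ennreal (v t) \<partial>D) = PiN z" unfolding PiN_def ev ..
  finally show ?thesis using le_less_trans[OF PiN_le[OF z], of \<infinity>] by simp
qed

text \<open>Dominated convergence twice, in the noise and in time. The starting points are bounded
  by some \<open>C\<close> and \<open>Q\<close> increases with its starting point, so the linear
  bound at \<open>C\<close> dominates.\<close>

lemma PiN_tendsto:
  assumes zk: "\<And>k. 0 < zs k" and z: "0 < z" and lim: "zs \<longlonglongrightarrow> z"
  shows "(\<lambda>k. PiN (zs k)) \<longlonglongrightarrow> PiN z"
proof -
  interpret g: prob_space gauss by (rule prob_space_gauss)
  obtain C where C: "\<And>k. norm (zs k) \<le> C"
    using convergent_imp_Bseq[OF convergentI[OF lim]] by (auto simp: Bseq_def)
  have Cz: "zs k \<le> C" for k using C[of k] by simp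
  have C0: "0 < C" using zk[of 0] Cz[of 0] by simp
  have inner: "(\<lambda>k. P t h (zs k)) \<longlonglongrightarrow> P t h z" if t: "0 \<le> t" for t
    unfolding P_def
  proof (rule nn_integral_dominated_convergence[where w = "\<lambda>y. ennreal (c0 * (1 + Q C t y))"])
    show "AE y in gauss. h (Q (zs k) t y) \<le> ennreal (c0 * (1 + Q C t y))" for k
    proof (rule AE_I2)
      fix y
      have "Q (zs k) t y \<le> Q C t y" unfolding Q_def using Cz[of k] by (intro mult_right_mono) auto
      then have "ennreal (c0 * (1 + Q (zs k) t y)) \<le> ennreal (c0 * (1 + Q C t y))" using c0 by (intro ennreal_leI mult_left_mono) auto
      with h_le[OF Q_pos[OF zk]] show "h (Q (zs k) t y) \<le> ennreal (c0 * (1 + Q C t y))" by (rule order_trans)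
    qed
    have "(\<integral>\<^sup>+y. ennreal (c0 * (1 + Q C t y)) \<partial>gauss) = P t (\<lambda>x. ennreal (c0 * (1 + x))) C" by (simp add: P_def)
    then show "(\<integral>\<^sup>+y. ennreal (c0 * (1 + Q C t y)) \<partial>gauss) < \<infinity>" using P_linear[OF c0 t C0] by simp
    show "AE y in gauss. (\<lambda>k. h (Q (zs k) t y)) \<longlonglongrightarrow> h (Q z t y)"
    proof (rule AE_I2)
      fix y
      have Ql: "(\<lambda>k. Q (zs k) t y) \<longlonglongrightarrow> Q z t y" unfolding Q_def by (intro tendsto_intros lim)
      have "continuous_on {0<..} (\<lambda>x. p * (1 + x) + (1 - p) * u x)" by (intro continuous_intros u_cont)
      from continuous_on_tendsto_compose[OF this Ql] have "(\<lambda>k. r (Q (zs k) t y)) \<longlonglongrightarrow> r (Q z t y)"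
        by (simp add: r_pos Q_pos zk z)
      then show "(\<lambda>k. h (Q (zs k) t y)) \<longlonglongrightarrow> h (Q z t y)" unfolding h_def by (rule tendsto_ennrealI)
    qed
  qed measurable
  show ?thesis
    unfolding PiN_def
  proof (rule nn_integral_dominated_convergence[where w = "\<lambda>_. ennreal (c0 * (1 + C))"])
    show "(\<lambda>t. indicator {0..} t * (disc t * P t h (zs k))) \<in> borel_measurable D" for k
      using P_h_measurable_time[of "zs k"] by measurable
    show "(\<lambda>t. indicator {0..} t * (disc t * P t h z)) \<in> borel_measurable D"
      using P_h_measurable_time[of z] by measurable
    show "AE t in D. indicator {0..} t * (disc t * P t h (zs k)) \<le> ennreal (c0 * (1 + C))" for k
    proof (rule AE_I2)
      fix t
      have "ennreal (c0 * (1 + zs k)) \<le> ennreal (c0 * (1 + C))" using c0 Cz[of k] by (intro ennreal_leI mult_left_mono) auto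
      then show "indicator {0..} t * (disc t * P t h (zs k)) \<le> ennreal (c0 * (1 + C))"
        using order_trans[OF disc_P_h_le[OF zk[of k]]] by (auto simp: indicator_def)
    qed
    show "(\<integral>\<^sup>+t. ennreal (c0 * (1 + C)) \<partial>D) < \<infinity>" using D.emeasure_space_1 by simp
    show "AE t in D. (\<lambda>k. indicator {0..} t * (disc t * P t h (zs k))) \<longlonglongrightarrow> indicator {0..} t * (disc t * P t h z)"
    proof (rule AE_I2)
      fix t
      show "(\<lambda>k. indicator {0..} t * (disc t * P t h (zs k))) \<longlonglongrightarrow> indicator {0..} t * (disc t * P t h z)"
      proof (cases "0 \<le> t")
        case True
        have "(\<lambda>k. disc t * P t h (zs k)) \<longlonglongrightarrow> disc t * P t h z"
          by (intro ennreal_tendsto_cmult inner[OF True]) simp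
        then show ?thesis using True by simp
      qed simp
    qed
  qed simp
qed

text \<open>The part \<open>p * (1 + x)\<close> of the integrand is affine and contributes no error;
  only \<open>(1 - p) * u x\<close> does, which gives the factor. Discounted integration against a
  probability measure in time does not increase it.\<close>

lemma approx_convex_PiN:
  assumes c: "0 \<le> c" and ac: "approx_convex c (\<lambda>x. ennreal (u x))"
  shows "approx_convex ((1 - p) * c) PiN"
proof -
  have cp: "0 \<le> (1 - p) * c" using c p by simp
  have ach: "approx_convex ((1 - p) * c) h"
    unfolding approx_convex_def
  proof (intro allI impI ballI)
    fix x y l :: real assume *: "0 < x" "0 < y" "l \<in> {0..1}"
    let ?q = "l * x + (1 - l) * y"
    have q: "0 < ?q" using * by (intro convex_comb_pos) auto
    have "ennreal (u ?q) \<le> ennreal l * ennreal (u x) + ennreal (1 - l) * ennreal (u y) + ennreal (c * (1 + ?q))"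
      using approx_convexD[OF ac *(1,2)] *(3) by simp
    also have "\<dots> = ennreal (l * u x + (1 - l) * u y + c * (1 + ?q))"
      using * c q u_nonneg by (intro ennreal_convex_combination) auto
    finally have "u ?q \<le> l * u x + (1 - l) * u y + c * (1 + ?q)"
      using * c q u_nonneg by (subst (asm) ennreal_le_iff) auto
    then have "(1 - p) * u ?q \<le> (1 - p) * (l * u x + (1 - l) * u y + c * (1 + ?q))" using p by (intro mult_left_mono) auto
    then have "r ?q \<le> l * r x + (1 - l) * r y + (1 - p) * c * (1 + ?q)"
      using * q by (simp add: r_pos algebra_simps)
    then have "h ?q \<le> ennreal (l * r x + (1 - l) * r y + (1 - p) * c * (1 + ?q))" unfolding h_def by (rule ennreal_leI)
    also have "\<dots> = ennreal l * h x + ennreal (1 - l) * h y + ennreal ((1 - p) * c * (1 + ?q))"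
      unfolding h_def using * cp q r_nonneg by (intro ennreal_convex_combination[symmetric]) auto
    finally show "h ?q \<le> ennreal l * h x + ennreal (1 - l) * h y + ennreal ((1 - p) * c * (1 + ?q))" .
  qed
  show ?thesis
    unfolding approx_convex_def
  proof (intro allI impI ballI)
    fix x y l :: real assume *: "0 < x" "0 < y" "l \<in> {0..1}"
    let ?q = "l * x + (1 - l) * y" and ?v = "\<lambda>z t. indicator {0..} t * (disc t * P t h z)"
    have [measurable]: "?v z \<in> borel_measurable D" for z
      using P_h_measurable_time[of z] by measurable
    have "PiN ?q \<le> (\<integral>\<^sup>+t. (ennreal l * ?v x t + ennreal (1 - l) * ?v y t) + ennreal ((1 - p) * c * (1 + ?q)) \<partial>D)"
      unfolding PiN_def
    proof (rule nn_integral_mono)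
      fix t
      show "?v ?q t \<le> (ennreal l * ?v x t + ennreal (1 - l) * ?v y t) + ennreal ((1 - p) * c * (1 + ?q))"
      proof (cases "0 \<le> t")
        case True
        then show ?thesis
          using approx_convexD[OF approx_convex_disc_P[OF cp True h_measurable ach] *(1,2), of l] *(3) by simp
      qed simp
    qed
    also have "\<dots> = (ennreal l * PiN x + ennreal (1 - l) * PiN y) + ennreal ((1 - p) * c * (1 + ?q))"
    proof -
      have "(\<integral>\<^sup>+t. (ennreal l * ?v x t + ennreal (1 - l) * ?v y t) + ennreal ((1 - p) * c * (1 + ?q)) \<partial>D) =
        (\<integral>\<^sup>+t. ennreal l * ?v x t + ennreal (1 - l) * ?v y t \<partial>D) + (\<integral>\<^sup>+t. ennreal ((1 - p) * c * (1 + ?q)) \<partial>D)"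
        by (rule nn_integral_add) measurable
      also have "(\<integral>\<^sup>+t. ennreal l * ?v x t + ennreal (1 - l) * ?v y t \<partial>D) = (\<integral>\<^sup>+t. ennreal l * ?v x t \<partial>D) + (\<integral>\<^sup>+t. ennreal (1 - l) * ?v y t \<partial>D)"
        by (rule nn_integral_add) measurable
      also have "(\<integral>\<^sup>+t. ennreal l * ?v x t \<partial>D) = ennreal l * (\<integral>\<^sup>+t. ?v x t \<partial>D)" by (rule nn_integral_cmult) measurable
      also have "(\<integral>\<^sup>+t. ennreal (1 - l) * ?v y t \<partial>D) = ennreal (1 - l) * (\<integral>\<^sup>+t. ?v y t \<partial>D)" by (rule nn_integral_cmult) measurable
      finally show ?thesis unfolding PiN_def using D.emeasure_space_1 by simp
    qed
    finally show "PiN ?q \<le> ennreal l * PiN x + ennreal (1 - l) * PiN y + ennreal ((1 - p) * c * (1 + ?q))" .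
  qed
qed

theorem value_function_C1:
  assumes FF: "\<And>t. 0 \<le> t \<Longrightarrow> FF (ennreal t) = F t"
    and FFmono: "\<And>s t. s \<le> t \<Longrightarrow> sets (FF s) \<subseteq> sets (FF t)" and FFspace: "\<And>t. space (FF t) = space N"
    and ZX: "\<And>z t. 0 < z \<Longrightarrow> 0 \<le> t \<Longrightarrow> AE \<omega> in N. Z z t \<omega> = X z t \<omega>"
    and Zc: "\<And>z. 0 < z \<Longrightarrow> AE \<omega> in N. continuous_on {0..} (\<lambda>t. Z z t \<omega>)"
    and F': "interval_measure F' = D"
    and u: "\<And>z. 0 < z \<Longrightarrow> ennreal (u z) = stopping_value N FF Z \<rho> (\<lambda>x. max 1 (Pi_operator N Z F' \<rho> p u x)) z"
  shows "u C1_differentiable_on {0<..}"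
proof -
  define g where "g = (\<lambda>x. max 1 (Pi_operator N Z F' \<rho> p u x))"
  define G where "G = (\<lambda>x. max 1 (PiN x))"
  have Pi: "ennreal (Pi_operator N Z F' \<rho> p u x) = PiN x" if "0 < x" for x
    by (rule Pi_operator_eq[where Z = Z and z = x and F' = F', OF ZX[OF that] that F'])
  have Gm[measurable]: "G \<in> borel_measurable borel" unfolding G_def by measurable
  have Gg: "G x = ennreal (g x)" if "0 < x" for x
  proof (cases "1 \<le> Pi_operator N Z F' \<rho> p u x")
    case True
    then have "ennreal 1 \<le> PiN x" unfolding Pi[OF that, symmetric] by (rule ennreal_leI)
    then show ?thesis using True Pi[OF that] by (simp add: G_def g_def max_absorb2)
  next
    case False
    then have "PiN x \<le> ennreal 1" unfolding Pi[OF that, symmetric] by (intro ennreal_leI) simp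
    then show ?thesis using False by (simp add: G_def g_def max_absorb1)
  qed
  \<comment> \<open>The rounding of stopping times relies on a continuous payoff.\<close>
  have gc: "continuous_on {0<..} g"
    unfolding continuous_on_sequentially
  proof (intro allI ballI impI)
    fix xs :: "nat \<Rightarrow> real" and x assume x: "x \<in> {0<..}" and xs: "(\<forall>n. xs n \<in> {0<..}) \<and> xs \<longlonglongrightarrow> x"
    have "(\<lambda>k. G (xs k)) \<longlonglongrightarrow> G x"
      unfolding G_def using x xs by (intro tendsto_max tendsto_const PiN_tendsto) auto
    then have "(\<lambda>k. ennreal (g (xs k))) \<longlonglongrightarrow> ennreal (g x)" using x xs by (simp add: Gg)
    then show "(g \<circ> xs) \<longlonglongrightarrow> g x"
      unfolding comp_def by (rule tendsto_ennrealD) (auto simp: g_def max_def)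
  qed
  have le: "H G (1 / 2 ^ k) x \<le> ennreal (u x)" if "0 < x" for k x
    unfolding u[OF that] g_def[symmetric]
    by (rule H_le_stopping_value[where FF = FF and Z = Z and G = G and g = g and z = x, OF FF FFmono FFspace ZX[OF that] Gm Gg that]) auto
  have ge: "ennreal (u x) \<le> liminf (\<lambda>k. H G (1 / 2 ^ k) x)" if "0 < x" for x
    unfolding u[OF that] g_def[symmetric]
    by (rule stopping_value_le_liminf[where FF = FF and Z = Z and G = G and g = g and z = x, OF FF FFspace ZX[OF that] Zc[OF that] Gm Gg gc that]) auto
  have step: "approx_convex ((1 - p) * c) (\<lambda>x. ennreal (u x))" if c: "0 \<le> c" "approx_convex c (\<lambda>x. ennreal (u x))" for c
  proof (rule approx_convex_limit[where h = "\<lambda>k. H G (1 / 2 ^ k)", OF _ le ge])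
    have "approx_convex ((1 - p) * c) (\<lambda>x. 1)"
      unfolding approx_convex_def
    proof (intro allI impI ballI)
      fix x y l :: real assume *: "0 < x" "0 < y" "l \<in> {0..1}"
      have "ennreal l * 1 + ennreal (1 - l) * 1 = 1" using * by (simp add: ennreal_plus[symmetric] del: ennreal_plus)
      then show "(1::ennreal) \<le> ennreal l * 1 + ennreal (1 - l) * 1 + ennreal ((1 - p) * c * (1 + (l * x + (1 - l) * y)))" by simp
    qed
    then have "approx_convex ((1 - p) * c) G"
      unfolding G_def by (intro approx_convex_max approx_convex_PiN c)
    then show "approx_convex ((1 - p) * c) (H G (1 / 2 ^ k))" for k
      using c p by (intro approx_convex_H Gm) auto
  qed
  have "approx_convex ((1 - p) ^ n * K) (\<lambda>x. ennreal (u x))" for n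
  proof (induction n)
    case 0
    show ?case
      unfolding approx_convex_def
    proof (intro allI impI ballI)
      fix x y l :: real assume *: "0 < x" "0 < y" "l \<in> {0..1}"
      have "0 < l * x + (1 - l) * y" using * by (intro convex_comb_pos) auto
      then have "ennreal (u (l * x + (1 - l) * y)) \<le> ennreal ((1 - p) ^ 0 * K * (1 + (l * x + (1 - l) * y)))"
        using u_le by (intro ennreal_leI) simp
      then show "ennreal (u (l * x + (1 - l) * y)) \<le> ennreal l * ennreal (u x) + ennreal (1 - l) * ennreal (u y) + ennreal ((1 - p) ^ 0 * K * (1 + (l * x + (1 - l) * y)))"
        by (rule order_trans) simp
    qed
  next
    case (Suc n)
    have "0 \<le> (1 - p) ^ n * K" using p K by simp
    from step[OF this Suc] show ?case by (simp add: mult.assoc)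
  qed
  note ac = this
  have "convex_on {0<..} u"
  proof (rule convex_onI)
    fix l x y :: real assume l: "0 < l" "l < 1" and xy: "x \<in> {0<..}" "y \<in> {0<..}"
    let ?q = "(1 - l) * x + l * y"
    have q: "0 < ?q" using convex_comb_pos[of x y "1 - l"] l xy by simp
    have "u ?q \<le> (1 - l) * u x + l * u y + (1 - p) ^ n * K * (1 + ?q)" for n
    proof -
      have k: "0 \<le> (1 - p) ^ n * K" using p K by simp
      have "ennreal (u ?q) \<le> ennreal (1 - l) * ennreal (u x) + ennreal l * ennreal (u y) + ennreal ((1 - p) ^ n * K * (1 + ?q))"
        using approx_convexD[OF ac, of x y "1 - l"] l xy by simp
      also have "\<dots> = ennreal ((1 - l) * u x + l * u y + (1 - p) ^ n * K * (1 + ?q))"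
        using ennreal_convex_combination[of "1 - l" "u x" "u y" "(1 - p) ^ n * K * (1 + ?q)"] l xy k q u_nonneg by simp
      finally show ?thesis using l xy k q u_nonneg by (subst (asm) ennreal_le_iff) auto
    qed
    moreover have "(\<lambda>n. (1 - l) * u x + l * u y + (1 - p) ^ n * K * (1 + ?q)) \<longlonglongrightarrow> (1 - l) * u x + l * u y + 0 * K * (1 + ?q)"
      using p by (intro tendsto_intros LIMSEQ_power_zero) auto
    ultimately have "u ?q \<le> (1 - l) * u x + l * u y + 0 * K * (1 + ?q)"
      by (metis (no_types, lifting) LIMSEQ_le_const)
    then show "u ((1 - l) *\<^sub>R x + l *\<^sub>R y) \<le> (1 - l) * u x + l * u y" by simp
  qed (rule convex_real_interval)
  then show ?thesis
    using u_nonneg limit_superharmonic[where V = "\<lambda>x. ennreal (u x)", OF Gm le ge] by (rule superharmonic_convex_C1)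
qed

end

section \<open>From the two Brownian motions to the abstract setting\<close>

theorem proposition4p9:
  fixes M :: "'a measure"
    and B1 B2 Bt :: "real \<Rightarrow> 'a \<Rightarrow> real"
    and FF :: "ennreal \<Rightarrow> 'a measure"
    and \<mu>1 \<mu>2 \<sigma>1 \<sigma>2 \<nu> p r \<beta>1 \<beta>2 :: real
    and F :: "real \<Rightarrow> real"
    and Z :: "real \<Rightarrow> real \<Rightarrow> 'a \<Rightarrow> real"
    and u :: "real \<Rightarrow> real"
  assumes "prob_space M"
    and "brownian_motion M B1" and "brownian_motion M B2" and "indep_processes M B1 B2"
    and "FF = completed_natural_filtration M B1 B2"
    and "\<sigma>1 > 0" and "\<sigma>2 > 0" and "\<nu> \<in> {-1..1}" and "p \<in> {0<..<1}" and "r > 0"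
    and "r > \<mu>1 + \<sigma>1\<^sup>2 / 2" and "r > \<mu>2 + \<sigma>2\<^sup>2 / 2"
    and "cdf_of_nonneg_rv F"
    and "\<beta>1 = \<sigma>2 * \<nu> - \<sigma>1" and "\<beta>2 = \<sigma>2 * sqrt (1 - \<nu>\<^sup>2)" and "\<beta>1\<^sup>2 + \<beta>2\<^sup>2 > 0"
    and "Bt = (\<lambda>t \<omega>. (\<beta>1 * B1 t \<omega> + \<beta>2 * B2 t \<omega>) / sqrt (\<beta>1\<^sup>2 + \<beta>2\<^sup>2))"
    and "\<And>z. z > 0 \<Longrightarrow>
           sde_solution (completion M) FF Bt
             (\<lambda>x. (\<mu>2 - \<mu>1) * x) (\<lambda>x. sqrt (\<beta>1\<^sup>2 + \<beta>2\<^sup>2) * x) z (Z z)"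
    and "u \<in> A1plus"
    and "\<And>z. z > 0 \<Longrightarrow>
           ennreal (u z) =
             stopping_value (completion M) FF Z (r - \<mu>1)
               (\<lambda>x. max 1 (Pi_operator (completion M) Z F (r - \<mu>1) p u x)) z"
  shows "u C1_differentiable_on {0<..}"
proof -
  note M = assms(1) and bm = assms(2,3) and ip = assms(4) and FF = assms(5) and cdfF = assms(13)
    and b = assms(16) and Bt = assms(17) and sde = assms(18) and u = assms(19) and val = assms(20)
  interpret filtered_bm "completion M" "\<lambda>t. FF (ennreal t)" Bt
    unfolding FF Bt by (rule filtered_bm_combination[OF M bm ip b])
  have uc: "continuous_on {0<..} u" and u0: "\<And>z. 0 < z \<Longrightarrow> 0 \<le> u z"
    and bdd: "bdd_above ((\<lambda>z. \<bar>u z\<bar>\<^sup>2 / (1 + z\<^sup>2)) ` {0<..})"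
    using u by (auto simp: A1plus_def)
  obtain C where C: "\<And>z. 0 < z \<Longrightarrow> \<bar>u z\<bar>\<^sup>2 / (1 + z\<^sup>2) \<le> C"
    using bdd unfolding bdd_above_def by auto
  have "0 \<le> \<bar>u 1\<bar>\<^sup>2 / (1 + 1\<^sup>2)" by simp
  also have "\<dots> \<le> C" by (rule C) simp
  finally have C0: "0 \<le> C" .
  \<comment> \<open>Membership in \<open>A1plus\<close> bounds the square of \<open>u z\<close> by
    \<open>C * (1 + z\<^sup>2)\<close>, which is at most \<open>C * (1 + z)\<^sup>2\<close> for
    positive \<open>z\<close>; a square root gives linear growth.\<close>
  have ub: "u z \<le> sqrt C * (1 + z)" if z: "0 < z" for z
  proof (rule power2_le_imp_le)
    have "(u z)\<^sup>2 \<le> C * (1 + z\<^sup>2)" using C[OF z] by (simp add: divide_le_eq add_pos_nonneg)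
    also have "\<dots> \<le> C * (1 + z)\<^sup>2" using C0 z by (intro mult_left_mono) (auto simp: power2_sum)
    also have "\<dots> = (sqrt C * (1 + z))\<^sup>2" using C0 by (simp add: power_mult_distrib)
    finally show "(u z)\<^sup>2 \<le> (sqrt C * (1 + z))\<^sup>2" .
  qed (use C0 z in auto)
  interpret gbm_payoff "completion M" "\<lambda>t. FF (ennreal t)" Bt "\<mu>2 - \<mu>1" "sqrt (\<beta>1\<^sup>2 + \<beta>2\<^sup>2)" "r - \<mu>1"
    "interval_measure F" p "sqrt C" u
  proof (intro gbm_payoff.intro gbm.intro filtered_bm_axioms gbm_axioms.intro gbm_payoff_axioms.intro)
    show "0 < sqrt (\<beta>1\<^sup>2 + \<beta>2\<^sup>2)" using b by simp
    \<comment> \<open>The assumptions on \<open>r\<close> give these two inequalities with margins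
      of half the squared volatilities.\<close>
    show "0 \<le> r - \<mu>1" "\<mu>2 - \<mu>1 \<le> r - \<mu>1" using assms(11,12) zero_le_power2[of \<sigma>1] zero_le_power2[of \<sigma>2] by linarith+
    show "real_distribution (interval_measure F)" by (rule real_distribution_interval_measure_cdf[OF cdfF])
    show "0 < p" "p < 1" using assms(9) by auto
    show "0 \<le> sqrt C" using C0 by simp
  qed (use uc u0 ub in auto)
  let ?G = "\<lambda>t. {B1 s -` A \<inter> space M | s A. 0 \<le> s \<and> ennreal s \<le> t \<and> A \<in> sets borel} \<union>
        {B2 s -` A \<inter> space M | s A. 0 \<le> s \<and> ennreal s \<le> t \<and> A \<in> sets borel} \<union>
        null_sets (completion M)"
  have GP: "?G t \<subseteq> Pow (space M)" for t
    using sets.sets_into_space[of _ "completion M"] by auto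
  have sp: "space (FF t) = space (completion M)" for t
    unfolding FF completed_natural_filtration_def using GP[of t] by (simp add: space_measure_of)
  have mono: "sets (FF s) \<subseteq> sets (FF t)" if "s \<le> t" for s t
    unfolding FF completed_natural_filtration_def sets_measure_of[OF GP]
  proof (rule sigma_sets_mono')
    show "?G s \<subseteq> ?G t" using that by (blast intro: order_trans)
  qed
  show ?thesis
  proof (rule value_function_C1[OF refl mono sp _ _ refl val])
    show "AE \<omega> in completion M. Z z t \<omega> = X z t \<omega>" if "0 < z" "0 \<le> t" for z t
      unfolding X_def by (rule linear_sde_solution_AE[OF refl sde[OF that(1)] that(2)])
    show "AE \<omega> in completion M. continuous_on {0..} (\<lambda>t. Z z t \<omega>)" if "0 < z" for z
      using sde[OF that] by (simp add: sde_solution_def)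
  qed auto
qed

end
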